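(* Let $\gamma>0$ and $0<q_1<q_2<q\leq 2$ be arbitrarily fixed, and let $\alpha,\beta\in\mathbb{R}$. Let $\Gamma(\gamma,q_1,q_2,q)$ be the parametric curve, and $\phi_{\gamma,q_1,q_2,q}:\mathbb{R}\to\mathbb{R}$ the function whose graph it is, both defined in the context. Consider the equation $${}^cD^{q}x(t)+\alpha\,{}^cD^{q_1}x(t)+\beta\,{}^cD^{q_2}x(t)+\gamma x(t)=0 .\qquad (E)$$ Then: (i) The characteristic equation $s^q+\alpha s^{q_1}+\beta s^{q_2}+\gamma=0$ has a pair of complex conjugate roots on the imaginary axis of the complex plane if and only if $(\alpha,\beta)\in\Gamma(\gamma,q_1,q_2,q)$. (ii) The trivial solution of (E) is $\mathcal{O}(t^{-q'})$-asymptotically stable, where $q'$ is the minimum of the fractional parts $\{q^*\}=q^*-\lfloor q^*\rfloor$ over those $q^*\in\{q_1,q_2,q\}$ that are not integers, if and only if $\beta>\phi_{\gamma,q_1,q_2,q}(\alpha)$. (iii) If $\beta<\phi_{\gamma,q_1,q_2,q}(\alpha)$, then the trivial solution of (E) is unstable.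
   Context: Caputo derivative of order $q>0$: ${}^cD^{q}x(t)=\frac{1}{\Gamma(n-q)}\int_0^t\frac{x^{(n)}(\tau)}{(t-\tau)^{q+1-n}}\,d\tau$ if $n-1<q<n$, and ${}^cD^{q}x(t)=x^{(n)}(t)$ if $q=n$ ($n\in\mathbb{N}$, $n\ge 1$; here $\Gamma(\cdot)$ is the Gamma function). Initial data for (E): $x_i=x(0)=x_0\in\mathbb{R}$ if $q\in(0,1]$, and $x_i=(x(0),x'(0))=(x_0,x_1)\in\mathbb{R}^2$ if $q\in(1,2]$. Denote by $\varphi(t,x_i)$, $t\ge 0$, the unique solution of (E) with initial data $x_i$. Stability notions. The trivial solution of (E) is stable if for every $\varepsilon>0$ there is $\delta>0$ such that $\|x_i\|<\delta$ implies $|\varphi(t,x_i)|\le\varepsilon$ for all $t\ge0$; unstable if it is not stable. For $a>0$ it is $\mathcal{O}(t^{-a})$-asymptotically stable if it is stable and there is $\rho>0$ such that for all $\|x_i\|<\rho$ one has $|\varphi(t,x_i)|=\mathcal{O}(t^{-a})$ as $t\to\infty$. In the characteristic equation, $s^{q^*}$ denotes the first (principal) branch of the complex power function. Curve. Let $\rho(a,b)=\dfrac{\sin\frac{a\pi}{2}}{\sin\frac{b\pi}{2}}$ for $a\in[0,2]$, $b\in(-2,2)\setminus\{0\}$. For $q\in(0,2]$ and distinct $a,b\in(0,q)$, and $\omega>0$, let $$h(\omega,a,b,q)=\omega^{-\frac{a}{q}}\left[\omega\,\rho(q-b,b-a)-\rho(b,b-a)\right].$$ $\Gamma(\gamma,q_1,q_2,q)$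 is the curve in the $(\alpha,\beta)$-plane given by $$\alpha=\gamma^{1-\frac{q_1}{q}}h(\omega,q_1,q_2,q),\qquad \beta=\gamma^{1-\frac{q_2}{q}}h(\omega,q_2,q_1,q),\qquad \omega>0 .$$ This curve is the graph $\{(\alpha,\phi_{\gamma,q_1,q_2,q}(\alpha)):\alpha\in\mathbb{R}\}$ of a (smooth, decreasing, convex, bijective) function $\phi_{\gamma,q_1,q_2,q}:\mathbb{R}\to\mathbb{R}$. *)

theory Defs
  imports "HOL-Analysis.Analysis" "HOL-Real_Asymp.Real_Asymp"
begin

section \<open>The Caputo derivative\<close>

text \<open>The derivative of order k of a function on the half-line: functions have type
  real to real, but only their values on the half-line matter, and the derivative at 0 is
  one-sided.\<close>
definition hderiv :: "nat \<Rightarrow> (real \<Rightarrow> real) \<Rightarrow> real \<Rightarrow> real" where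
  "hderiv k x = ((\<lambda>f t. vector_derivative f (at t within {0..})) ^^ k) x"

definition caputo :: "real \<Rightarrow> (real \<Rightarrow> real) \<Rightarrow> real \<Rightarrow> real" where
  "caputo q x t = (let n = nat \<lceil>q\<rceil> in
     if q = real n then hderiv n x t
     else 1 / Gamma (real n - q) *
            integral {0..t} (\<lambda>\<tau>. hderiv n x \<tau> / (t - \<tau>) powr (q + 1 - real n)))"


section \<open>Solutions and stability\<close>

text \<open>With n the least integer that is at least q, solutions are the functions of class
  C\<open>^(n-1)\<close> on the closed half-line and C\<open>^n\<close> on the open one whose derivative of order n
  is Lebesgue integrable near 0; for non-integer q that derivative is in general unbounded
  near 0. All Caputo integrals of order at most q then converge for t > 0. The equation is
  imposed only for t > 0, since at t = 0 the integrals vanish and it would restrict the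
  initial data.\<close>
definition is_solution ::
  "real \<Rightarrow> real \<Rightarrow> real \<Rightarrow> real \<Rightarrow> real \<Rightarrow> real \<Rightarrow> (real \<Rightarrow> real) \<Rightarrow> bool" where
  "is_solution \<alpha> \<beta> \<gamma> q1 q2 q x \<longleftrightarrow>
     (let n = nat \<lceil>q\<rceil> in
        (\<forall>k. Suc k < n \<longrightarrow> hderiv k x differentiable_on {0..}) \<and>
        continuous_on {0..} (hderiv (n - 1) x) \<and>
        hderiv (n - 1) x differentiable_on {0<..} \<and>
        continuous_on {0<..} (hderiv n x) \<and>
        (\<forall>T>0. hderiv n x absolutely_integrable_on {0..T})) \<and>
     (\<forall>t>0. caputo q x t + \<alpha> * caputo q1 x t + \<beta> * caputo q2 x t + \<gamma> * x t = 0)"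

text \<open>The Euclidean norm of the initial data: x(0) if q is at most 1, and (x(0), x'(0))
  otherwise.\<close>
definition initial_norm :: "real \<Rightarrow> (real \<Rightarrow> real) \<Rightarrow> real" where
  "initial_norm q x = (if q \<le> 1 then norm (x 0) else norm (x 0, hderiv 1 x 0))"

text \<open>The solution with given initial data is unique, so a condition on the solutions for all
  initial data of norm less than d is a condition on all solutions whose initial data have
  norm less than d.\<close>
definition stable :: "real \<Rightarrow> real \<Rightarrow> real \<Rightarrow> real \<Rightarrow> real \<Rightarrow> real \<Rightarrow> bool" where
  "stable \<alpha> \<beta> \<gamma> q1 q2 q \<longleftrightarrow>
     (\<forall>\<epsilon>>0. \<exists>\<delta>>0. \<forall>x. is_solution \<alpha> \<beta> \<gamma> q1 q2 q x \<and> initial_norm q x < \<delta> \<longrightarrow>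
        (\<forall>t\<ge>0. \<bar>x t\<bar> \<le> \<epsilon>))"

abbreviation unstable :: "real \<Rightarrow> real \<Rightarrow> real \<Rightarrow> real \<Rightarrow> real \<Rightarrow> real \<Rightarrow> bool" where
  "unstable \<alpha> \<beta> \<gamma> q1 q2 q \<equiv> \<not> stable \<alpha> \<beta> \<gamma> q1 q2 q"

definition O_asymptotically_stable ::
  "real \<Rightarrow> real \<Rightarrow> real \<Rightarrow> real \<Rightarrow> real \<Rightarrow> real \<Rightarrow> real \<Rightarrow> bool" where
  "O_asymptotically_stable a \<alpha> \<beta> \<gamma> q1 q2 q \<longleftrightarrow>
     stable \<alpha> \<beta> \<gamma> q1 q2 q \<and>
     (\<exists>\<rho>>0. \<forall>x. is_solution \<alpha> \<beta> \<gamma> q1 q2 q x \<and> initial_norm q x < \<rho> \<longrightarrow>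
        x \<in> O[at_top](\<lambda>t. t powr (- a)))"


section \<open>The characteristic function and the stability curve\<close>

text \<open>The operator powr on the complex numbers is the principal branch.\<close>
definition char_fun ::
  "real \<Rightarrow> real \<Rightarrow> real \<Rightarrow> real \<Rightarrow> real \<Rightarrow> real \<Rightarrow> complex \<Rightarrow> complex" where
  "char_fun \<alpha> \<beta> \<gamma> q1 q2 q s =
     s powr of_real q + of_real \<alpha> * s powr of_real q1 + of_real \<beta> * s powr of_real q2 + of_real \<gamma>"

definition rho :: "real \<Rightarrow> real \<Rightarrow> real" where
  "rho a b = sin (a * pi / 2) / sin (b * pi / 2)"

definition h_fun :: "real \<Rightarrow> real \<Rightarrow> real \<Rightarrow> real \<Rightarrow> real" where
  "h_fun \<omega> a b q = \<omega> powr (- a / q) * (\<omega> * rho (q - b) (b - a) - rho b (b - a))"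

definition Gamma_curve :: "real \<Rightarrow> real \<Rightarrow> real \<Rightarrow> real \<Rightarrow> (real \<times> real) set" where
  "Gamma_curve \<gamma> q1 q2 q =
     {(\<gamma> powr (1 - q1 / q) * h_fun \<omega> q1 q2 q, \<gamma> powr (1 - q2 / q) * h_fun \<omega> q2 q1 q) |\<omega>. \<omega> > 0}"

definition phi :: "real \<Rightarrow> real \<Rightarrow> real \<Rightarrow> real \<Rightarrow> real \<Rightarrow> real" where
  "phi \<gamma> q1 q2 q \<alpha> = (THE \<beta>. (\<alpha>, \<beta>) \<in> Gamma_curve \<gamma> q1 q2 q)"

lemma ex1_h_eq:
  fixes q1 q2 q c :: real
  assumes "0 < q1" "q1 < q2" "q2 < q" "q \<le> 2"
  shows "\<exists>!\<omega>. \<omega> > 0 \<and> h_fun \<omega> q1 q2 q = c"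
proof -
  define A where "A = rho (q - q2) (q2 - q1)"
  define B where "B = rho q2 (q2 - q1)"
  define p where "p = q1 / q"
  have p: "0 < p" "p < 1"
    using assms by (auto simp: p_def)
  have pos: "sin (a * pi / 2) > 0" if "0 < a" "a < 2" for a :: real
    using that by (intro sin_gt_zero) (auto simp: field_simps)
  have A: "A > 0" unfolding A_def rho_def
    using assms by (intro divide_pos_pos pos) auto
  have B: "B > 0" unfolding B_def rho_def
    using assms by (intro divide_pos_pos pos) auto
  define f where "f = (\<lambda>\<omega>. A * \<omega> powr (1 - p) - B * \<omega> powr (- p))"
  have h_eq: "h_fun \<omega> q1 q2 q = f \<omega>" if "\<omega> > 0" for \<omega>
    using that by (simp add: h_fun_def f_def A_def B_def p_def powr_diff powr_minus field_simps)
  have mono: "f x < f y" if "0 < x" "x < y" for x y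
  proof -
    have "x powr (1 - p) < y powr (1 - p)"
      using that p by (intro powr_less_mono2) auto
    moreover have "y powr (- p) < x powr (- p)"
      using that p by (intro powr_less_mono2_neg) auto
    ultimately show ?thesis
      unfolding f_def using A B by (smt (verit) mult_less_cancel_left_pos)
  qed
  have "filterlim f at_top at_top"
    unfolding f_def using A B p by real_asymp
  hence "eventually (\<lambda>x. f x > c \<and> x > 1) at_top"
    by (intro eventually_conj eventually_gt_at_top) (simp add: filterlim_at_top_dense)
  then obtain y where y: "f y > c" "y > 1"
    by (auto simp: eventually_at_top_linorder)
  have "filterlim f at_bot (at_right 0)"
    unfolding f_def using A B p by real_asymp
  hence "eventually (\<lambda>x. f x < c \<and> x \<in> {0<..<1}) (at_right 0)"
    by (intro eventually_conj eventually_at_right_real)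
       (simp_all add: filterlim_at_bot_dense)
  then obtain x where x: "f x < c" "0 < x" "x < 1"
    using eventually_happens[of _ "at_right (0::real)"] by fastforce
  have "continuous_on {x..y} f"
    unfolding f_def using x by (intro continuous_intros) auto
  then obtain w where w: "x \<le> w" "w \<le> y" "f w = c"
    using IVT'[of f x c y] x y by auto
  show ?thesis
  proof (rule ex1I[of _ w])
    show "w > 0 \<and> h_fun w q1 q2 q = c"
      using w x h_eq by auto
  next
    fix v assume v: "v > 0 \<and> h_fun v q1 q2 q = c"
    hence "f v = f w"
      using w h_eq by auto
    thus "v = w"
      using mono[of v w] mono[of w v] v w x by (cases v w rule: linorder_cases) auto
  qed
qed

text \<open>The curve is the graph of \<open>phi\<close>, so the definite description in its definition is
  legitimate.\<close>
lemma Gamma_curve_eq_graph: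
  assumes "0 < \<gamma>" "0 < q1" "q1 < q2" "q2 < q" "q \<le> 2"
  shows "Gamma_curve \<gamma> q1 q2 q = {(\<alpha>, phi \<gamma> q1 q2 q \<alpha>) |\<alpha>. True}"
proof -
  have ex1: "\<exists>!\<beta>. (\<alpha>, \<beta>) \<in> Gamma_curve \<gamma> q1 q2 q" for \<alpha>
  proof -
    have "\<gamma> powr (1 - q1 / q) > 0"
      using assms by simp
    hence eq: "\<alpha> = \<gamma> powr (1 - q1 / q) * h_fun \<omega> q1 q2 q \<longleftrightarrow> h_fun \<omega> q1 q2 q = \<alpha> / \<gamma> powr (1 - q1 / q)" for \<omega>
      by (auto simp: field_simps)
    show ?thesis
      using ex1_h_eq[of q1 q2 q "\<alpha> / \<gamma> powr (1 - q1 / q)"] assms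
      unfolding Gamma_curve_def by (simp add: eq) metis
  qed
  have "(\<alpha>, \<beta>) \<in> Gamma_curve \<gamma> q1 q2 q \<longleftrightarrow> \<beta> = phi \<gamma> q1 q2 q \<alpha>" for \<alpha> \<beta>
    unfolding phi_def using theI'[OF ex1[of \<alpha>]] ex1[of \<alpha>] by auto
  thus ?thesis
    by auto
qed

end

theory Submission
  imports Defs "HOL-Complex_Analysis.Complex_Analysis"
begin

text \<open>Separating real and imaginary parts on the imaginary axis gives a linear system for
  \<open>\<alpha>\<close> and \<open>\<beta>\<close>, whose solution is the curve. Along a segment of parameters that avoids the curve,
  the existence of a root with positive real part is an open and closed condition (Hurwitz, and
  compactness of the root set). Below the curve, \<open>\<beta>\<close> can be lowered until a positive real root appears;
  above it, \<open>\<alpha>\<close> and then \<open>\<beta>\<close> can be raised until both are nonnegative, where the imaginary part of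
  the characteristic function excludes roots.

  Fractional integration of order q turns the equation into a Volterra equation of the second kind.
  Hence solutions are exponentially bounded, and their Laplace transforms X satisfy
  \<open>X(s) \<Delta>(s) = N(s)\<close>, with \<open>\<Delta>\<close> the characteristic function and N given by the initial data. For
  \<open>x(0) = c\<close> and \<open>x'(0) = 0\<close> a solution exists by a Neumann series, and
  \<open>s X(s) \<Delta>(s) = c (\<Delta>(s) - \<gamma>)\<close>. If it is bounded, X is holomorphic on the right half-plane, so that
  \<open>\<Delta>\<close> has no root there; if it tends to 0, then \<open>\<sigma> X(\<i>v + \<sigma>)\<close> tends to 0 with \<open>\<sigma>\<close>, so that \<open>\<Delta>\<close> has no
  root \<open>\<i>v\<close>.

  If \<open>\<Delta>\<close> has no root in the closed right half-plane, then \<open>X(s) - x(0) / (s + 1)\<close> is integrable along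
  the imaginary axis, where it behaves like a power of \<open>\<bar>s\<bar>\<close> with exponent at least \<open>q' - 1\<close> at 0.
  Cauchy's formula and the injectivity of the Laplace transform show that its inverse Fourier transform
  is \<open>x(t) - x(0) exp(-t)\<close>; one integration by parts gives the rate \<open>t powr -q'\<close>.\<close>

section \<open>The stability curve\<close>

text \<open>Nothing is known in advance about a solution at infinity. The growth bound comes from
  the Volterra form: in the weight exp(\<sigma> t), fractional integration of order a has norm at
  most \<sigma> to the power -a, so a large \<sigma> makes the integral terms a contraction.
  Identities between transforms are first derived for large real s. Analytic continuation carries
  them to the half-plane for the one explicit bounded solution that the negative results need,
  whereas large real s already determines a solution, which is enough for the positive one. The
  branch point 0 is no root, because the characteristic function tends to \<gamma> > 0 there. At
  infinity the transform of a solution behaves like x(0) / s, which is not integrable along the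
  imaginary axis; subtracting x(0) / (s + 1), the transform of x(0) exp(-t), removes this tail
  without a pole in the closed right half-plane. Near 0 the transform contains the power r - 1 of s
  for each of the three orders r, and the power r - 2 if r > 1. For a rate a the argument therefore
  asks for a \<le> r and, if r > 1, also a \<le> r - 1; the minimal fractional part satisfies
  both.\<close>

lemma sin_half_pi_pos: "0 < a \<Longrightarrow> a < 2 \<Longrightarrow> sin (a * pi / 2) > 0" for a :: real
  by (intro sin_gt_zero) (auto simp: field_simps)

lemma imaginary_powr:
  assumes "v > 0"
  shows "(\<i> * complex_of_real v) powr of_real r = of_real (v powr r) * cis (r * pi / 2)"
proof -
  have "\<i> * complex_of_real v \<noteq> 0" using assms by auto
  moreover have "Ln (\<i> * complex_of_real v) = of_real (ln v) + \<i> * of_real (pi / 2)"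
    using assms Ln_times_of_real[of v "\<i>"] by (simp add: mult.commute Ln_of_real)
  ultimately show ?thesis using assms
    by (simp add: powr_def cis_conv_exp exp_add[symmetric] algebra_simps exp_of_real[symmetric])
qed

text \<open>The slit must be excluded: on the negative real axis conjugation fixes s, while its
  principal powers are in general not real.\<close>

lemma cnj_powr_real:
  assumes "s \<notin> \<real>\<^sub>\<le>\<^sub>0"
  shows "cnj (s powr of_real r) = cnj s powr of_real r"
proof -
  have "Im s = 0 \<longrightarrow> Re s > 0" using assms by (auto simp: complex_nonpos_Reals_iff)
  thus ?thesis using cnj_powr[of s "of_real r"] by auto
qed

lemma char_fun_cnj:
  assumes "s \<notin> \<real>\<^sub>\<le>\<^sub>0"
  shows "char_fun \<alpha> \<beta> \<gamma> q1 q2 q (cnj s) = cnj (char_fun \<alpha> \<beta> \<gamma> q1 q2 q s)"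
  by (simp add: char_fun_def cnj_powr_real[OF assms])

lemma char_fun_imaginary_eq_0_iff:
  assumes "v > 0"
  shows "char_fun \<alpha> \<beta> \<gamma> q1 q2 q (\<i> * of_real v) = 0 \<longleftrightarrow>
    v powr q * cos (q * pi / 2) + \<alpha> * (v powr q1 * cos (q1 * pi / 2)) + \<beta> * (v powr q2 * cos (q2 * pi / 2)) + \<gamma> = 0 \<and>
    v powr q * sin (q * pi / 2) + \<alpha> * (v powr q1 * sin (q1 * pi / 2)) + \<beta> * (v powr q2 * sin (q2 * pi / 2)) = 0"
  by (simp add: char_fun_def imaginary_powr[OF assms] complex_eq_iff)

text \<open>Cramer's rule for two real equations in \<alpha> and \<beta>; up to powers of v the
  determinant will be sin((q2 - q1) pi / 2) > 0. Sines, cosines and powers are abstracted to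
  variables, so that both directions become polynomial identities.\<close>

lemma trig_system:
  fixes C C1 C2 S S1 S2 V V1 V2 :: real
  assumes V: "V > 0" "V1 > 0" "V2 > 0" and D: "S2 * C1 - C2 * S1 > 0"
  shows "V * C + \<alpha> * (V1 * C1) + \<beta> * (V2 * C2) + \<gamma> = 0 \<and> V * S + \<alpha> * (V1 * S1) + \<beta> * (V2 * S2) = 0 \<longleftrightarrow>
    \<alpha> * V1 * (S2 * C1 - C2 * S1) = V * (S * C2 - C * S2) - \<gamma> * S2 \<and>
    \<beta> * V2 * (S2 * C1 - C2 * S1) = - (V * (S * C1 - C * S1)) + \<gamma> * S1"
  (is "?E1 = 0 \<and> ?E2 = 0 \<longleftrightarrow> ?R1 \<and> ?R2")
proof
  assume e: "?E1 = 0 \<and> ?E2 = 0"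
  have "\<alpha> * V1 * (S2 * C1 - C2 * S1) - (V * (S * C2 - C * S2) - \<gamma> * S2) = S2 * ?E1 - C2 * ?E2" by algebra
  moreover have "\<beta> * V2 * (S2 * C1 - C2 * S1) - (- (V * (S * C1 - C * S1)) + \<gamma> * S1) = C1 * ?E2 - S1 * ?E1" by algebra
  ultimately show "?R1 \<and> ?R2" using e by simp
next
  assume r: "?R1 \<and> ?R2"
  let ?D = "S2 * C1 - C2 * S1"
  have "?D * ?E1 = V * C * ?D + C1 * (\<alpha> * V1 * ?D) + C2 * (\<beta> * V2 * ?D) + \<gamma> * ?D" by algebra
  also have "\<dots> = V * C * ?D + C1 * (V * (S * C2 - C * S2) - \<gamma> * S2) + C2 * (- (V * (S * C1 - C * S1)) + \<gamma> * S1) + \<gamma> * ?D"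
    using r by simp
  also have "\<dots> = 0" by algebra
  finally have 1: "?E1 = 0" using D by simp
  have "?D * ?E2 = V * S * ?D + S1 * (\<alpha> * V1 * ?D) + S2 * (\<beta> * V2 * ?D)" by algebra
  also have "\<dots> = V * S * ?D + S1 * (V * (S * C2 - C * S2) - \<gamma> * S2) + S2 * (- (V * (S * C1 - C * S1)) + \<gamma> * S1)"
    using r by simp
  also have "\<dots> = 0" by algebra
  finally have 2: "?E2 = 0" using D by simp
  show "?E1 = 0 \<and> ?E2 = 0" using 1 2 by simp
qed

section \<open>The curve as the locus of imaginary roots\<close>

context
  fixes \<gamma> q1 q2 q :: real
  assumes par: "\<gamma> > 0" "0 < q1" "q1 < q2" "q2 < q" "q \<le> 2"
begin

text \<open>For a root iv the curve parameter is \<omega> = v^q / \<gamma>. In this scaling the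
  powers of \<gamma> and \<omega> cancel against those of v, and the two instances of
  \<open>h_fun\<close> turn into the right-hand sides of Cramer's rule.\<close>

lemma curve_point:
  assumes "\<omega> > 0"
  defines "v \<equiv> (\<gamma> * \<omega>) powr (1 / q)"
  defines "D \<equiv> sin ((q2 - q1) * pi / 2)"
  shows "v powr q = \<gamma> * \<omega>"
    and "\<gamma> powr (1 - q1 / q) * h_fun \<omega> q1 q2 q * (v powr q1 * D) = v powr q * sin ((q - q2) * pi / 2) - \<gamma> * sin (q2 * pi / 2)"
    and "\<gamma> powr (1 - q2 / q) * h_fun \<omega> q2 q1 q * (v powr q2 * D) = - (v powr q * sin ((q - q1) * pi / 2)) + \<gamma> * sin (q1 * pi / 2)"
proof -
  have D: "D > 0" unfolding D_def using par by (intro sin_half_pi_pos) auto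
  \<comment> \<open>The two instances of \<open>h_fun\<close> have denominators of opposite sign,
    hence the reversed signs in the formula for \<beta>.\<close>
  have D': "sin ((q1 - q2) * pi / 2) = - D"
    unfolding D_def sin_minus[symmetric] by (intro arg_cong[of _ _ sin]) (simp add: field_simps)
  show 1: "v powr q = \<gamma> * \<omega>" using par assms(1) by (simp add: v_def powr_powr)
  have v1: "v powr r = \<gamma> powr (r / q) * \<omega> powr (r / q)" for r
    using par assms(1) by (simp add: v_def powr_powr powr_mult)
  have x: "\<omega> powr (- r / q) * \<omega> powr (r / q) = 1" "\<gamma> powr (1 - r / q) * \<gamma> powr (r / q) = \<gamma>" for r
    using par assms(1) by (simp_all add: powr_add[symmetric])
  have y: "\<gamma> powr (1 - r / q) * (\<omega> powr (- r / q) * Z) * (v powr r * D) = \<gamma> * (Z * D)" for r Z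
    unfolding v1 using x[of r] by (metis (no_types, opaque_lifting) mult.assoc mult.commute mult.left_neutral)
  show "\<gamma> powr (1 - q1 / q) * h_fun \<omega> q1 q2 q * (v powr q1 * D) = v powr q * sin ((q - q2) * pi / 2) - \<gamma> * sin (q2 * pi / 2)"
    unfolding h_fun_def y 1 using D unfolding rho_def D_def by (simp add: field_simps)
  show "\<gamma> powr (1 - q2 / q) * h_fun \<omega> q2 q1 q * (v powr q2 * D) = - (v powr q * sin ((q - q1) * pi / 2)) + \<gamma> * sin (q1 * pi / 2)"
    unfolding h_fun_def y 1 rho_def D' using D by (simp add: field_simps)
qed

lemma imaginary_root_iff_curve_param:
  assumes "\<omega> > 0"
  shows "char_fun \<alpha> \<beta> \<gamma> q1 q2 q (\<i> * of_real ((\<gamma> * \<omega>) powr (1 / q))) = 0 \<longleftrightarrow>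
    \<alpha> = \<gamma> powr (1 - q1 / q) * h_fun \<omega> q1 q2 q \<and> \<beta> = \<gamma> powr (1 - q2 / q) * h_fun \<omega> q2 q1 q"
proof -
  define v where "v = (\<gamma> * \<omega>) powr (1 / q)"
  have v: "v > 0" using par assms by (simp add: v_def)
  define D where "D = sin ((q2 - q1) * pi / 2)"
  have D: "D > 0" unfolding D_def using par by (intro sin_half_pi_pos) auto
  have sd: "sin (a * pi / 2) * cos (b * pi / 2) - cos (a * pi / 2) * sin (b * pi / 2) = sin ((a - b) * pi / 2)" for a b
    unfolding sin_diff[symmetric] by (intro arg_cong[of _ _ sin]) (simp add: field_simps)
  note cp = curve_point[OF assms, folded v_def D_def]
  have "char_fun \<alpha> \<beta> \<gamma> q1 q2 q (\<i> * of_real v) = 0 \<longleftrightarrow>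
     \<alpha> * v powr q1 * D = v powr q * sin ((q - q2) * pi / 2) - \<gamma> * sin (q2 * pi / 2) \<and>
     \<beta> * v powr q2 * D = - (v powr q * sin ((q - q1) * pi / 2)) + \<gamma> * sin (q1 * pi / 2)"
    unfolding char_fun_imaginary_eq_0_iff[OF v]
    by (subst trig_system) (use v D in \<open>simp_all add: sd D_def\<close>)
  also have "\<dots> \<longleftrightarrow> \<alpha> = \<gamma> powr (1 - q1 / q) * h_fun \<omega> q1 q2 q \<and> \<beta> = \<gamma> powr (1 - q2 / q) * h_fun \<omega> q2 q1 q"
    unfolding cp(2,3)[symmetric] using v D by simp
  finally show ?thesis unfolding v_def .
qed

lemma imaginary_root_iff_curve:
  "(\<exists>v>0. char_fun \<alpha> \<beta> \<gamma> q1 q2 q (\<i> * of_real v) = 0) \<longleftrightarrow> (\<alpha>, \<beta>) \<in> Gamma_curve \<gamma> q1 q2 q"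
proof
  assume "\<exists>v>0. char_fun \<alpha> \<beta> \<gamma> q1 q2 q (\<i> * of_real v) = 0"
  then obtain v where v: "v > 0" "char_fun \<alpha> \<beta> \<gamma> q1 q2 q (\<i> * of_real v) = 0" by auto
  have "v = (\<gamma> * (v powr q / \<gamma>)) powr (1 / q)" using v par by (simp add: powr_powr)
  hence "\<alpha> = \<gamma> powr (1 - q1 / q) * h_fun (v powr q / \<gamma>) q1 q2 q \<and> \<beta> = \<gamma> powr (1 - q2 / q) * h_fun (v powr q / \<gamma>) q2 q1 q"
    using imaginary_root_iff_curve_param[of "v powr q / \<gamma>"] v par by simp
  moreover have "v powr q / \<gamma> > 0" using v par by simp
  ultimately show "(\<alpha>, \<beta>) \<in> Gamma_curve \<gamma> q1 q2 q" unfolding Gamma_curve_def by blast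
next
  assume "(\<alpha>, \<beta>) \<in> Gamma_curve \<gamma> q1 q2 q"
  then obtain w where "w > 0" "\<alpha> = \<gamma> powr (1 - q1 / q) * h_fun w q1 q2 q" "\<beta> = \<gamma> powr (1 - q2 / q) * h_fun w q2 q1 q"
    unfolding Gamma_curve_def by blast
  thus "\<exists>v>0. char_fun \<alpha> \<beta> \<gamma> q1 q2 q (\<i> * of_real v) = 0"
    using imaginary_root_iff_curve_param[of w \<alpha> \<beta>] par by (intro exI[of _ "(\<gamma> * w) powr (1 / q)"]) auto
qed

text \<open>Conjugation symmetry moves a root on the negative imaginary axis to the positive
  one.\<close>

lemma nonzero_imaginary_root_on_curve:
  assumes "Re s = 0" "s \<noteq> 0" "char_fun \<alpha> \<beta> \<gamma> q1 q2 q s = 0"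
  shows "(\<alpha>, \<beta>) \<in> Gamma_curve \<gamma> q1 q2 q"
proof (cases "Im s > 0")
  case True
  have "s = \<i> * of_real (Im s)" using assms by (simp add: complex_eq_iff)
  thus ?thesis using imaginary_root_iff_curve[of \<alpha> \<beta>] True assms by metis
next
  case False
  hence F: "Im s < 0" using assms by (auto simp: complex_eq_iff)
  hence "s \<notin> \<real>\<^sub>\<le>\<^sub>0" by (auto simp: complex_nonpos_Reals_iff)
  hence "char_fun \<alpha> \<beta> \<gamma> q1 q2 q (cnj s) = 0" using assms char_fun_cnj by simp
  moreover have "cnj s = \<i> * of_real (- Im s)" using assms by (simp add: complex_eq_iff)
  ultimately show ?thesis using imaginary_root_iff_curve[of \<alpha> \<beta>] F by (metis neg_0_less_iff_less)
qed

lemma root_pair_iff_curve: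
  "(\<exists>s. Re s = 0 \<and> s \<noteq> cnj s \<and>
      char_fun \<alpha> \<beta> \<gamma> q1 q2 q s = 0 \<and> char_fun \<alpha> \<beta> \<gamma> q1 q2 q (cnj s) = 0)
   \<longleftrightarrow> (\<alpha>, \<beta>) \<in> Gamma_curve \<gamma> q1 q2 q" (is "?L \<longleftrightarrow> ?R")
proof
  assume ?L
  thus ?R using nonzero_imaginary_root_on_curve by fastforce
next
  assume ?R
  then obtain v where v: "v > 0" "char_fun \<alpha> \<beta> \<gamma> q1 q2 q (\<i> * of_real v) = 0"
    using imaginary_root_iff_curve by auto
  have "\<i> * complex_of_real v \<notin> \<real>\<^sub>\<le>\<^sub>0" using v by (auto simp: complex_nonpos_Reals_iff)
  from char_fun_cnj[OF this] v show ?L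
    by (intro exI[of _ "\<i> * of_real v"]) (auto simp: complex_eq_iff)
qed

lemma curve_iff_phi: "(\<alpha>, \<beta>) \<in> Gamma_curve \<gamma> q1 q2 q \<longleftrightarrow> \<beta> = phi \<gamma> q1 q2 q \<alpha>"
  using Gamma_curve_eq_graph[of \<gamma> q1 q2 q] par by auto

text \<open>Along the curve the first coordinate increases and the second decreases in \<omega>,
  because all sines involved are positive. So a larger \<alpha> belongs to a larger parameter, and
  hence to a smaller \<beta>.\<close>

lemma phi_antimono:
  assumes "\<alpha> \<le> \<alpha>'"
  shows "phi \<gamma> q1 q2 q \<alpha>' \<le> phi \<gamma> q1 q2 q \<alpha>"
proof -
  obtain w where w: "w > 0" "\<alpha> = \<gamma> powr (1 - q1 / q) * h_fun w q1 q2 q"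
     "phi \<gamma> q1 q2 q \<alpha> = \<gamma> powr (1 - q2 / q) * h_fun w q2 q1 q"
    using curve_iff_phi[of \<alpha> "phi \<gamma> q1 q2 q \<alpha>"] unfolding Gamma_curve_def by blast
  obtain w' where w': "w' > 0" "\<alpha>' = \<gamma> powr (1 - q1 / q) * h_fun w' q1 q2 q"
     "phi \<gamma> q1 q2 q \<alpha>' = \<gamma> powr (1 - q2 / q) * h_fun w' q2 q1 q"
    using curve_iff_phi[of \<alpha>' "phi \<gamma> q1 q2 q \<alpha>'"] unfolding Gamma_curve_def by blast
  define D where "D = sin ((q2 - q1) * pi / 2)"
  have D: "D > 0" unfolding D_def using par by (intro sin_half_pi_pos) auto
  have D': "sin ((q1 - q2) * pi / 2) = - D"
    unfolding D_def sin_minus[symmetric] by (intro arg_cong[of _ _ sin]) (simp add: field_simps)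
  have D1: "sin ((q2 - q1) * pi / 2) = D" by (simp add: D_def)
  have pos: "sin (q1 * pi / 2) > 0" "sin (q2 * pi / 2) > 0" "sin ((q - q1) * pi / 2) > 0" "sin ((q - q2) * pi / 2) > 0"
    using par by (auto intro!: sin_half_pi_pos)
  have e1: "h_fun x q1 q2 q = (x powr (1 - q1 / q) * sin ((q - q2) * pi / 2) - x powr (- q1 / q) * sin (q2 * pi / 2)) / D"
    if "x > 0" for x
    unfolding h_fun_def rho_def D1 using that D by (simp add: powr_diff powr_minus field_simps)
  have e2: "h_fun x q2 q1 q = (x powr (- q2 / q) * sin (q1 * pi / 2) - x powr (1 - q2 / q) * sin ((q - q1) * pi / 2)) / D"
    if "x > 0" for x
    unfolding h_fun_def rho_def D' using that D by (simp add: powr_diff powr_minus field_simps)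
  have lt: "h_fun x q1 q2 q < h_fun y q1 q2 q" if "0 < x" "x < y" for x y
  proof -
    have "x powr (1 - q1 / q) * sin ((q - q2) * pi / 2) < y powr (1 - q1 / q) * sin ((q - q2) * pi / 2)"
      using that par pos by (intro mult_strict_right_mono powr_less_mono2) (auto simp: field_simps)
    moreover have "y powr (- q1 / q) * sin (q2 * pi / 2) < x powr (- q1 / q) * sin (q2 * pi / 2)"
      using that par pos by (intro mult_strict_right_mono powr_less_mono2_neg) (auto simp: field_simps)
    ultimately show ?thesis using that D by (simp add: e1 divide_strict_right_mono)
  qed
  have "w \<le> w'"
  proof (rule ccontr)
    assume "\<not> w \<le> w'"
    hence "h_fun w' q1 q2 q < h_fun w q1 q2 q" using lt w' by simp
    moreover have "\<gamma> powr (1 - q1 / q) > 0" using par by simp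
    ultimately have "\<alpha>' < \<alpha>" using w w' by (metis mult_strict_left_mono)
    thus False using assms by simp
  qed
  hence "w' powr (- q2 / q) * sin (q1 * pi / 2) \<le> w powr (- q2 / q) * sin (q1 * pi / 2)"
    using par pos w by (intro mult_right_mono powr_mono2') auto
  moreover have "w powr (1 - q2 / q) * sin ((q - q1) * pi / 2) \<le> w' powr (1 - q2 / q) * sin ((q - q1) * pi / 2)"
    using par pos w \<open>w \<le> w'\<close> by (intro mult_right_mono powr_mono2) auto
  ultimately have "h_fun w' q2 q1 q \<le> h_fun w q2 q1 q" using w w' D by (simp add: e2 divide_right_mono)
  thus ?thesis using w w' by (simp add: mult_left_mono)
qed

end

section \<open>Roots in the right half-plane\<close>

lemma norm_add3_le: "norm (a + b + c) \<le> norm a + norm b + norm c" for a b c :: "'a :: real_normed_vector"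
  using norm_triangle_ineq[of "a + b" c] norm_triangle_ineq[of a b] by linarith

text \<open>Up to modulus 1 the largest power is the one with the smallest exponent. The estimate
  keeps roots away from the branch point.\<close>

lemma char_fun_near_0:
  assumes "0 < q1" "q1 < q2" "q2 < q" "cmod s \<le> 1"
  shows "cmod (char_fun \<alpha> \<beta> \<gamma> q1 q2 q s - of_real \<gamma>) \<le> (1 + \<bar>\<alpha>\<bar> + \<bar>\<beta>\<bar>) * cmod s powr q1"
proof -
  have "cmod (char_fun \<alpha> \<beta> \<gamma> q1 q2 q s - of_real \<gamma>) \<le> cmod s powr q + \<bar>\<alpha>\<bar> * cmod s powr q1 + \<bar>\<beta>\<bar> * cmod s powr q2"
    using norm_add3_le[of "s powr of_real q" "of_real \<alpha> * s powr of_real q1" "of_real \<beta> * s powr of_real q2"]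
    by (simp add: char_fun_def norm_mult norm_powr_real_powr')
  also have "\<dots> \<le> cmod s powr q1 + \<bar>\<alpha>\<bar> * cmod s powr q1 + \<bar>\<beta>\<bar> * cmod s powr q1"
    using assms by (intro add_mono mult_left_mono powr_mono') auto
  finally show ?thesis by (simp add: algebra_simps)
qed

text \<open>From modulus 1 on, the order q2 < q dominates all lower terms. The estimate keeps roots
  bounded.\<close>

lemma char_fun_near_infinity:
  assumes "0 < q1" "q1 < q2" "q2 < q" "cmod s \<ge> 1"
  shows "cmod (char_fun \<alpha> \<beta> \<gamma> q1 q2 q s - s powr of_real q) \<le> (\<bar>\<alpha>\<bar> + \<bar>\<beta>\<bar> + \<bar>\<gamma>\<bar>) * cmod s powr q2"
proof -
  have "cmod (char_fun \<alpha> \<beta> \<gamma> q1 q2 q s - s powr of_real q) \<le> \<bar>\<alpha>\<bar> * cmod s powr q1 + \<bar>\<beta>\<bar> * cmod s powr q2 + \<bar>\<gamma>\<bar>"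
    using norm_add3_le[of "of_real \<alpha> * s powr of_real q1" "of_real \<beta> * s powr of_real q2" "of_real \<gamma>"]
    by (simp add: char_fun_def norm_mult norm_powr_real_powr' add.assoc)
  also have "\<dots> \<le> \<bar>\<alpha>\<bar> * cmod s powr q2 + \<bar>\<beta>\<bar> * cmod s powr q2 + \<bar>\<gamma>\<bar> * cmod s powr q2"
    using assms ge_one_powr_ge_zero[of "cmod s" q2]
    by (intro add_mono mult_left_mono powr_mono) (auto simp: mult_le_cancel_left1)
  finally show ?thesis by (simp add: algebra_simps)
qed

lemma le_root_if_powr_le:
  fixes x :: real
  assumes "x > 0" "b < a" "x powr a \<le> A * x powr b"
  shows "x \<le> A powr (1 / (a - b))"
proof -
  have "x powr (a - b) \<le> A" using assms by (simp add: powr_diff field_simps)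
  hence "(x powr (a - b)) powr (1 / (a - b)) \<le> A powr (1 / (a - b))"
    using assms by (intro powr_mono2) auto
  thus ?thesis using assms by (simp add: powr_powr)
qed

context
  fixes \<gamma> q1 q2 q :: real
  assumes par: "\<gamma> > 0" "0 < q1" "q1 < q2" "q2 < q" "q \<le> 2"
begin

definition rhp_root :: "real \<Rightarrow> real \<Rightarrow> bool" where
  "rhp_root \<alpha> \<beta> \<longleftrightarrow> (\<exists>s. Re s > 0 \<and> char_fun \<alpha> \<beta> \<gamma> q1 q2 q s = 0)"

text \<open>Comparison with the dominant term, s^q far out and \<gamma> near 0. The radii depend on
  \<alpha> and \<beta> only through K, so one annulus serves a whole convergent sequence of
  coefficients.\<close>

lemma roots_bounded:
  assumes "\<bar>\<alpha>\<bar> \<le> K" "\<bar>\<beta>\<bar> \<le> K" "s \<noteq> 0" "char_fun \<alpha> \<beta> \<gamma> q1 q2 q s = 0"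
  shows "cmod s \<le> max 1 ((2 * K + \<gamma>) powr (1 / (q - q2)))"
    and "cmod s \<ge> min 1 ((\<gamma> / (1 + 2 * K)) powr (1 / q1))"
proof -
  have "cmod s \<le> (2 * K + \<gamma>) powr (1 / (q - q2))" if "cmod s \<ge> 1"
  proof -
    have "cmod s powr q \<le> (\<bar>\<alpha>\<bar> + \<bar>\<beta>\<bar> + \<bar>\<gamma>\<bar>) * cmod s powr q2"
      using char_fun_near_infinity[of q1 q2 q s \<alpha> \<beta> \<gamma>] par assms that by (simp add: norm_powr_real_powr')
    also have "\<dots> \<le> (2 * K + \<gamma>) * cmod s powr q2"
      using assms par by (intro mult_right_mono) auto
    finally show ?thesis using assms par by (intro le_root_if_powr_le) auto
  qed
  thus "cmod s \<le> max 1 ((2 * K + \<gamma>) powr (1 / (q - q2)))" by linarith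
  have "cmod s \<ge> (\<gamma> / (1 + 2 * K)) powr (1 / q1)" if "cmod s \<le> 1"
  proof -
    have "\<gamma> \<le> (1 + \<bar>\<alpha>\<bar> + \<bar>\<beta>\<bar>) * cmod s powr q1"
      using char_fun_near_0[of q1 q2 q s \<alpha> \<beta> \<gamma>] par assms that by simp
    also have "\<dots> \<le> (1 + 2 * K) * cmod s powr q1"
      using assms par by (intro mult_right_mono) auto
    finally have "\<gamma> / (1 + 2 * K) \<le> cmod s powr q1" using assms by (simp add: field_simps)
    hence "(\<gamma> / (1 + 2 * K)) powr (1 / q1) \<le> (cmod s powr q1) powr (1 / q1)"
      using assms par by (intro powr_mono2) auto
    thus ?thesis using par assms by (simp add: powr_powr)
  qed
  thus "cmod s \<ge> min 1 ((\<gamma> / (1 + 2 * K)) powr (1 / q1))" by linarith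
qed

text \<open>Roots of the approximating functions stay in a fixed annulus and accumulate in the
  closed half-plane. The limit is not 0 because of the inner radius, and not imaginary because the
  limit coefficients are off the curve.\<close>

lemma rhp_root_limit:
  assumes a: "a \<longlonglongrightarrow> \<alpha>" and b: "b \<longlonglongrightarrow> \<beta>" and r: "\<And>n::nat. rhp_root (a n) (b n)"
    and nc: "(\<alpha>, \<beta>) \<notin> Gamma_curve \<gamma> q1 q2 q"
  shows "rhp_root \<alpha> \<beta>"
proof -
  obtain s where s: "Re (s n) > 0" "char_fun (a n) (b n) \<gamma> q1 q2 q (s n) = 0" for n
    using r unfolding rhp_root_def by metis
  obtain K1 where K1: "\<And>n. \<bar>a n\<bar> \<le> K1"
    using convergent_imp_Bseq[of a] a unfolding Bseq_def convergent_def by auto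
  obtain K2 where K2: "\<And>n. \<bar>b n\<bar> \<le> K2"
    using convergent_imp_Bseq[of b] b unfolding Bseq_def convergent_def by auto
  define K where "K = max K1 K2"
  have K: "\<bar>a n\<bar> \<le> K" "\<bar>b n\<bar> \<le> K" for n using K1[of n] K2[of n] by (auto simp: K_def)
  have K0: "K \<ge> 0" using K(1)[of 0] by linarith
  have s0: "s n \<noteq> 0" for n using s(1)[of n] by auto
  note bd = roots_bounded[OF K s0 s(2)]
  have "bounded (range s)" using bd(1) by (auto simp: bounded_iff)
  then obtain l r where l: "strict_mono r" "(s \<circ> r) \<longlonglongrightarrow> l"
    using bounded_imp_convergent_subsequence by blast
  have "cmod l \<ge> min 1 ((\<gamma> / (1 + 2 * K)) powr (1 / q1))"
    using tendsto_norm[OF l(2)] bd(2) by (intro LIMSEQ_le_const[of _ "cmod l"]) (auto simp: o_def)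
  moreover have "min 1 ((\<gamma> / (1 + 2 * K)) powr (1 / q1)) > 0" using par K0 by simp
  ultimately have "cmod l > 0" by (rule less_le_trans[rotated])
  hence l0: "l \<noteq> 0" by auto
  have Re: "Re l \<ge> 0"
    using tendsto_Re[OF l(2)] s(1) by (intro LIMSEQ_le_const[of _ "Re l"]) (auto simp: o_def less_imp_le)
  \<comment> \<open>The limit lies off the slit, so the principal powers are continuous at
    it.\<close>
  hence "l \<notin> \<real>\<^sub>\<le>\<^sub>0" using l0 by (auto simp: complex_nonpos_Reals_iff complex_eq_iff)
  hence "(\<lambda>n. char_fun ((a \<circ> r) n) ((b \<circ> r) n) \<gamma> q1 q2 q ((s \<circ> r) n)) \<longlonglongrightarrow> char_fun \<alpha> \<beta> \<gamma> q1 q2 q l"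
    unfolding char_fun_def using LIMSEQ_subseq_LIMSEQ[OF a l(1)] LIMSEQ_subseq_LIMSEQ[OF b l(1)]
    by (intro tendsto_intros l(2)) (auto simp: o_def)
  hence "char_fun \<alpha> \<beta> \<gamma> q1 q2 q l = 0" using s(2) by (simp add: LIMSEQ_const_iff)
  moreover have "Re l \<noteq> 0" using nonzero_imaginary_root_on_curve[OF par _ l0 calculation] nc by auto
  ultimately show ?thesis using Re unfolding rhp_root_def by (intro exI[of _ l]) auto
qed

lemma char_fun_holomorphic: "char_fun \<alpha> \<beta> \<gamma> q1 q2 q holomorphic_on {s. Re s > 0}"
  unfolding char_fun_def by (intro holomorphic_intros) (auto simp: complex_nonpos_Reals_iff)

text \<open>A constant value would bound the positive reals, since x^q outgrows x^q2. Hurwitz's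
  theorem asks for this in order to exclude a degenerate limit.\<close>

lemma char_fun_not_constant: "\<not> char_fun \<alpha> \<beta> \<gamma> q1 q2 q constant_on {s. Re s > 0}"
proof
  assume "char_fun \<alpha> \<beta> \<gamma> q1 q2 q constant_on {s. Re s > 0}"
  then obtain c where c: "\<And>s. Re s > 0 \<Longrightarrow> char_fun \<alpha> \<beta> \<gamma> q1 q2 q s = c"
    unfolding constant_on_def by auto
  define A where "A = cmod c + (\<bar>\<alpha>\<bar> + \<bar>\<beta>\<bar> + \<bar>\<gamma>\<bar>)"
  have "x \<le> A powr (1 / (q - q2))" if "x \<ge> 1" for x
  proof -
    have "x powr q = cmod (of_real x powr of_real q)" using that by (simp add: norm_powr_real_powr')
    also have "\<dots> \<le> cmod c + cmod (char_fun \<alpha> \<beta> \<gamma> q1 q2 q (of_real x) - of_real x powr of_real q)"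
      using c[of "of_real x"] that norm_triangle_sub[of "of_real x powr of_real q" c]
      by (simp add: norm_minus_commute)
    also have "\<dots> \<le> cmod c * x powr q2 + (\<bar>\<alpha>\<bar> + \<bar>\<beta>\<bar> + \<bar>\<gamma>\<bar>) * x powr q2"
      using char_fun_near_infinity[of q1 q2 q "of_real x" \<alpha> \<beta> \<gamma>] par that ge_one_powr_ge_zero[of x q2]
      by (intro add_mono) (auto simp: mult_le_cancel_left1)
    also have "\<dots> = A * x powr q2" by (simp add: A_def algebra_simps)
    finally show ?thesis using that par by (intro le_root_if_powr_le) auto
  qed
  from this[of "max 1 (A powr (1 / (q - q2)) + 1)"] show False by simp
qed

text \<open>By Hurwitz's theorem, a zero of the limit in the open half-plane would force zeros of
  the approximating functions.\<close>

lemma no_rhp_root_limit: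
  assumes a: "a \<longlonglongrightarrow> \<alpha>" and b: "b \<longlonglongrightarrow> \<beta>" and r: "\<And>n::nat. \<not> rhp_root (a n) (b n)"
  shows "\<not> rhp_root \<alpha> \<beta>"
proof
  assume "rhp_root \<alpha> \<beta>"
  then obtain z where z: "Re z > 0" "char_fun \<alpha> \<beta> \<gamma> q1 q2 q z = 0" unfolding rhp_root_def by auto
  have "char_fun \<alpha> \<beta> \<gamma> q1 q2 q z \<noteq> 0"
  proof (rule Hurwitz_no_zeros[where S = "{s. Re s > 0}" and \<F> = "\<lambda>n. char_fun (a n) (b n) \<gamma> q1 q2 q" and g = "char_fun \<alpha> \<beta> \<gamma> q1 q2 q"])
    show "open {s. Re s > 0}" by (rule open_halfspace_Re_gt)
    show "connected {s. Re s > 0}" by (intro convex_connected convex_halfspace_Re_gt)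
    show "uniform_limit K (\<lambda>n. char_fun (a n) (b n) \<gamma> q1 q2 q) (char_fun \<alpha> \<beta> \<gamma> q1 q2 q) sequentially"
      if K: "compact K" "K \<subseteq> {s. Re s > 0}" for K
    proof (rule uniform_limitI)
      fix e :: real assume e: "e > 0"
      obtain R where R: "R > 0" "\<And>s. s \<in> K \<Longrightarrow> cmod s \<le> R"
        using compact_imp_bounded[OF K(1)] unfolding bounded_pos by auto
      have "(\<lambda>n. \<bar>a n - \<alpha>\<bar> * R powr q1 + \<bar>b n - \<beta>\<bar> * R powr q2) \<longlonglongrightarrow> \<bar>\<alpha> - \<alpha>\<bar> * R powr q1 + \<bar>\<beta> - \<beta>\<bar> * R powr q2"
        by (intro tendsto_intros a b)
      hence "\<forall>\<^sub>F n in sequentially. \<bar>a n - \<alpha>\<bar> * R powr q1 + \<bar>b n - \<beta>\<bar> * R powr q2 < e"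
        using e by (intro order_tendstoD) auto
      thus "\<forall>\<^sub>F n in sequentially. \<forall>x\<in>K. dist (char_fun (a n) (b n) \<gamma> q1 q2 q x) (char_fun \<alpha> \<beta> \<gamma> q1 q2 q x) < e"
      proof eventually_elim
        case (elim n)
        show ?case
        proof
          fix s assume s: "s \<in> K"
          have "char_fun (a n) (b n) \<gamma> q1 q2 q s - char_fun \<alpha> \<beta> \<gamma> q1 q2 q s =
            of_real (a n - \<alpha>) * s powr of_real q1 + of_real (b n - \<beta>) * s powr of_real q2"
            by (simp add: char_fun_def algebra_simps)
          hence "dist (char_fun (a n) (b n) \<gamma> q1 q2 q s) (char_fun \<alpha> \<beta> \<gamma> q1 q2 q s) \<le>
             \<bar>a n - \<alpha>\<bar> * cmod s powr q1 + \<bar>b n - \<beta>\<bar> * cmod s powr q2"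
            using norm_triangle_ineq[of "of_real (a n - \<alpha>) * s powr of_real q1" "of_real (b n - \<beta>) * s powr of_real q2"]
            unfolding dist_norm norm_mult norm_of_real by (simp add: norm_powr_real_powr')
          also have "\<dots> \<le> \<bar>a n - \<alpha>\<bar> * R powr q1 + \<bar>b n - \<beta>\<bar> * R powr q2"
            using R s par by (intro add_mono mult_left_mono powr_mono2) auto
          finally show "dist (char_fun (a n) (b n) \<gamma> q1 q2 q s) (char_fun \<alpha> \<beta> \<gamma> q1 q2 q s) < e" using elim by simp
        qed
      qed
    qed
    show "char_fun (a n) (b n) \<gamma> q1 q2 q s \<noteq> 0" if "s \<in> {s. Re s > 0}" for n s
      using r[of n] that unfolding rhp_root_def by auto
    show "char_fun (a n) (b n) \<gamma> q1 q2 q holomorphic_on {s. Re s > 0}" for n by (rule char_fun_holomorphic)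
    show "char_fun \<alpha> \<beta> \<gamma> q1 q2 q holomorphic_on {s. Re s > 0}" by (rule char_fun_holomorphic)
    show "\<not> char_fun \<alpha> \<beta> \<gamma> q1 q2 q constant_on {s. Re s > 0}" by (rule char_fun_not_constant)
    show "z \<in> {s. Re s > 0}" using z by simp
  qed
  thus False using z by simp
qed

text \<open>The parameter interval splits into two closed sets, with and without a root, so by
  connectedness one of them is empty. The curve has to be avoided because a root can leave the open
  half-plane through the imaginary axis.\<close>

lemma rhp_root_segment:
  assumes nc: "\<And>u. 0 \<le> u \<Longrightarrow> u \<le> 1 \<Longrightarrow> (\<alpha> + u * (\<alpha>' - \<alpha>), \<beta> + u * (\<beta>' - \<beta>)) \<notin> Gamma_curve \<gamma> q1 q2 q"
  shows "rhp_root \<alpha> \<beta> \<longleftrightarrow> rhp_root \<alpha>' \<beta>'"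
proof -
  define A where "A = (\<lambda>u. \<alpha> + u * (\<alpha>' - \<alpha>))"
  define B where "B = (\<lambda>u. \<beta> + u * (\<beta>' - \<beta>))"
  define Z where "Z = {u\<in>{0..1}. rhp_root (A u) (B u)}"
  define Z' where "Z' = {u\<in>{0..1}. \<not> rhp_root (A u) (B u)}"
  have AB: "(\<lambda>n. A (x n)) \<longlonglongrightarrow> A l" "(\<lambda>n. B (x n)) \<longlonglongrightarrow> B l" if "x \<longlonglongrightarrow> l" for x l
    unfolding A_def B_def by (intro tendsto_intros that)+
  have mem: "l \<in> {0..1}" if "x \<longlonglongrightarrow> l" "\<And>n. x n \<in> {0..1}" for x and l :: real
    using closed_sequentially[of "{0..1::real}" x l] that by auto
  have "closed Z" unfolding closed_sequential_limits
  proof safe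
    fix x l assume x: "\<forall>n. x n \<in> Z" "x \<longlonglongrightarrow> l"
    have l: "l \<in> {0..1}" by (rule mem[OF x(2)]) (use x in \<open>auto simp: Z_def\<close>)
    moreover have "rhp_root (A l) (B l)"
      using x nc l by (intro rhp_root_limit[OF AB[OF x(2)]]) (auto simp: Z_def A_def B_def)
    ultimately show "l \<in> Z" by (simp add: Z_def)
  qed
  moreover have "closed Z'" unfolding closed_sequential_limits
  proof safe
    fix x l assume x: "\<forall>n. x n \<in> Z'" "x \<longlonglongrightarrow> l"
    have l: "l \<in> {0..1}" by (rule mem[OF x(2)]) (use x in \<open>auto simp: Z'_def\<close>)
    moreover have "\<not> rhp_root (A l) (B l)"
      using x by (intro no_rhp_root_limit[OF AB[OF x(2)]]) (auto simp: Z'_def)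
    ultimately show "l \<in> Z'" by (simp add: Z'_def)
  qed
  moreover have "{0..1} \<subseteq> Z \<union> Z'" "Z \<inter> Z' \<inter> {0..1} = {}" by (auto simp: Z_def Z'_def)
  moreover have "connected {0..1::real}" by simp
  ultimately have "Z \<inter> {0..1} = {} \<or> Z' \<inter> {0..1} = {}" unfolding connected_closed by blast
  moreover have "0 \<in> {0..1::real}" "1 \<in> {0..1::real}" by auto
  ultimately have "rhp_root (A 0) (B 0) \<longleftrightarrow> rhp_root (A 1) (B 1)" unfolding Z_def Z'_def by blast
  thus ?thesis by (simp add: A_def B_def)
qed

lemma rhp_root_below:
  assumes "\<beta> < phi \<gamma> q1 q2 q \<alpha>"
  shows "rhp_root \<alpha> \<beta>"
proof -
  \<comment> \<open>With this b the characteristic function is negative at s = 1, as 1 + \<alpha> +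
    b + \<gamma> \<le> -1, and its growth yields a real root beyond 1. The minimum with \<beta>
    keeps the segment below the curve.\<close>
  define b where "b = min \<beta> (- 2 - \<bar>\<alpha>\<bar> - \<gamma>)"
  have "rhp_root \<alpha> \<beta> \<longleftrightarrow> rhp_root \<alpha> b"
  proof (rule rhp_root_segment)
    fix u :: real assume u: "0 \<le> u" "u \<le> 1"
    have "u * (b - \<beta>) \<le> 0" using u by (intro mult_nonneg_nonpos) (auto simp: b_def)
    thus "(\<alpha> + u * (\<alpha> - \<alpha>), \<beta> + u * (b - \<beta>)) \<notin> Gamma_curve \<gamma> q1 q2 q"
      using assms by (simp add: curve_iff_phi[OF par])
  qed
  moreover have "rhp_root \<alpha> b"
  proof -
    define f where "f = (\<lambda>x. x powr q + \<alpha> * x powr q1 + b * x powr q2 + \<gamma>)"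
    have "continuous_on {1..x} f" for x unfolding f_def by (intro continuous_intros) auto
    have "f 1 \<le> 0" by (auto simp: f_def b_def)
    have "filterlim f at_top at_top" unfolding f_def using par by real_asymp
    hence "eventually (\<lambda>x. f x > 0 \<and> x > 1) at_top"
      by (intro eventually_conj eventually_gt_at_top) (simp add: filterlim_at_top_dense)
    then obtain y where y: "f y > 0" "y > 1" by (auto simp: eventually_at_top_linorder)
    obtain x where x: "x \<ge> 1" "f x = 0"
      using IVT'[of f 1 0 y] \<open>f 1 \<le> 0\<close> y \<open>continuous_on {1..y} f\<close> by auto
    have "char_fun \<alpha> b \<gamma> q1 q2 q (of_real x) = of_real (f x)"
      using x(1) by (simp add: char_fun_def f_def powr_of_real)
    thus ?thesis using x unfolding rhp_root_def by (intro exI[of _ "of_real x"]) auto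
  qed
  ultimately show ?thesis by simp
qed

text \<open>For orders r \<le> 2 the angles r Arg s lie strictly between -pi and pi, so the three
  sines share the sign of Arg s and cannot cancel. For real s the real part is positive
  instead.\<close>

lemma no_rhp_root_nonneg:
  assumes "\<alpha> \<ge> 0" "\<beta> \<ge> 0"
  shows "\<not> rhp_root \<alpha> \<beta>"
proof
  assume "rhp_root \<alpha> \<beta>"
  then obtain s where s: "Re s > 0" "char_fun \<alpha> \<beta> \<gamma> q1 q2 q s = 0" unfolding rhp_root_def by auto
  have s0: "s \<noteq> 0" using s by auto
  define \<theta> where "\<theta> = Arg s"
  have th: "\<bar>\<theta>\<bar> < pi / 2" unfolding \<theta>_def using s s0
    by (metis Re_Ln_pos_lt Arg_eq_Im_Ln)
  have pw: "s powr of_real r = of_real (cmod s powr r) * cis (r * \<theta>)" for r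
    using s0 by (simp add: powr_def Ln_Arg \<theta>_def distrib_left exp_add cis_conv_exp exp_of_real[symmetric] mult_ac)
  show False
  proof (cases "\<theta> = 0")
    case True
    hence "Re (char_fun \<alpha> \<beta> \<gamma> q1 q2 q s) = cmod s powr q + \<alpha> * cmod s powr q1 + \<beta> * cmod s powr q2 + \<gamma>"
      unfolding char_fun_def pw by simp
    moreover have "\<dots> > 0" using par assms by (intro add_nonneg_pos) auto
    ultimately show False using s by simp
  next
    case False
    \<comment> \<open>Multiplying by \<theta> treats the upper and the lower half-plane
      together.\<close>
    have sg: "sin (r * \<theta>) * \<theta> > 0" if "r > 0" "r \<le> 2" for r
    proof -
      have "\<bar>r * \<theta>\<bar> < pi" using that th mult_mono[of r 2 "\<bar>\<theta>\<bar>" "\<bar>\<theta>\<bar>"] by (simp add: abs_mult)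
      show ?thesis
      proof (cases "\<theta> > 0")
        case True
        hence "sin (r * \<theta>) > 0" using \<open>\<bar>r * \<theta>\<bar> < pi\<close> that by (intro sin_gt_zero) auto
        thus ?thesis using True by simp
      next
        case F: False
        hence "sin (r * (- \<theta>)) > 0" using \<open>\<bar>r * \<theta>\<bar> < pi\<close> that False
          by (intro sin_gt_zero) (auto simp: mult_less_0_iff)
        thus ?thesis using F False by (simp add: mult_less_0_iff zero_less_mult_iff)
      qed
    qed
    have "0 = Im (char_fun \<alpha> \<beta> \<gamma> q1 q2 q s) * \<theta>" using s by simp
    also have "\<dots> = cmod s powr q * (sin (q * \<theta>) * \<theta>) + \<alpha> * cmod s powr q1 * (sin (q1 * \<theta>) * \<theta>)
       + \<beta> * cmod s powr q2 * (sin (q2 * \<theta>) * \<theta>)"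
      unfolding char_fun_def pw by (simp add: algebra_simps)
    also have "\<dots> > 0"
      by (intro add_pos_nonneg mult_pos_pos[OF _ sg] mult_nonneg_nonneg[OF _ less_imp_le[OF sg]])
         (use par assms s0 in auto)
    finally show False by simp
  qed
qed

lemma no_rhp_root_above:
  assumes "\<beta> > phi \<gamma> q1 q2 q \<alpha>"
  shows "\<not> rhp_root \<alpha> \<beta>"
proof -
  define a where "a = max \<alpha> 0"
  define b where "b = max \<beta> 0"
  have "phi \<gamma> q1 q2 q a \<le> phi \<gamma> q1 q2 q \<alpha>" by (intro phi_antimono par) (auto simp: a_def)
  \<comment> \<open>The point stays above the curve while \<alpha> grows, because \<open>phi\<close>
    is antitone, and afterwards while \<beta> grows.\<close>
  have "rhp_root \<alpha> \<beta> \<longleftrightarrow> rhp_root a \<beta>"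
  proof (rule rhp_root_segment)
    fix u :: real assume u: "0 \<le> u" "u \<le> 1"
    have "u * (a - \<alpha>) \<ge> 0" using u by (auto simp: a_def)
    hence "phi \<gamma> q1 q2 q (\<alpha> + u * (a - \<alpha>)) \<le> phi \<gamma> q1 q2 q \<alpha>" by (intro phi_antimono par) simp
    thus "(\<alpha> + u * (a - \<alpha>), \<beta> + u * (\<beta> - \<beta>)) \<notin> Gamma_curve \<gamma> q1 q2 q"
      using assms by (simp add: curve_iff_phi[OF par])
  qed
  also have "\<dots> \<longleftrightarrow> rhp_root a b"
  proof (rule rhp_root_segment)
    fix u :: real assume u: "0 \<le> u" "u \<le> 1"
    have "u * (b - \<beta>) \<ge> 0" using u by (auto simp: b_def)
    thus "(a + u * (a - a), \<beta> + u * (b - \<beta>)) \<notin> Gamma_curve \<gamma> q1 q2 q"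
      using assms \<open>phi \<gamma> q1 q2 q a \<le> phi \<gamma> q1 q2 q \<alpha>\<close> by (simp add: curve_iff_phi[OF par])
  qed
  finally show ?thesis using no_rhp_root_nonneg[of a b] by (simp add: a_def b_def)
qed

end

section \<open>Fractional integrals\<close>

text \<open>The Riemann-Liouville kernel, extended by 0 so that convolutions need no upper limit of
  integration.\<close>

definition frac_kernel :: "real \<Rightarrow> real \<Rightarrow> real" where
  "frac_kernel a t = (if t > 0 then t powr (a - 1) / Gamma a else 0)"

text \<open>The Riemann-Liouville integral. Order 0 is set apart as the identity, since its kernel
  would be a Dirac mass; integer orders can then be treated with the others.\<close>

definition frac_int :: "real \<Rightarrow> (real \<Rightarrow> real) \<Rightarrow> real \<Rightarrow> real" where
  "frac_int a f t =
     (if a = 0 then f t else (LINT \<tau>|lborel. indicator {0<..} \<tau> * f \<tau> * frac_kernel a (t - \<tau>)))"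

text \<open>Integrability reaches down to 0, but only values on the open half-line count, because a
  top derivative may be unbounded near 0 and has no useful value there.\<close>

definition loc_integrable :: "(real \<Rightarrow> real) \<Rightarrow> bool" where
  "loc_integrable f \<longleftrightarrow> (\<lambda>t. indicator {0<..} t * f t) \<in> borel_measurable borel \<and>
     (\<forall>T. integrable lborel (\<lambda>t. indicator {0<..T} t * f t))"

lemma frac_kernel_measurable [measurable]: "frac_kernel a \<in> borel_measurable borel"
  unfolding frac_kernel_def by measurable

lemma frac_kernel_nonneg [simp]: "a > 0 \<Longrightarrow> frac_kernel a t \<ge> 0"
  by (auto simp: frac_kernel_def Gamma_real_pos less_imp_le)

lemma frac_kernel_nonpos [simp]: "t \<le> 0 \<Longrightarrow> frac_kernel a t = 0"
  by (simp add: frac_kernel_def)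

lemma frac_kernel_1: "frac_kernel 1 t = indicator {0<..} t"
  by (simp add: frac_kernel_def)

lemma frac_kernel_2: "t \<ge> 0 \<Longrightarrow> frac_kernel 2 t = t"
  using Gamma_fact[of 1, where 'a = real] by (simp add: frac_kernel_def)

lemma frac_kernel_le:
  assumes "a \<ge> 1" "t \<le> T" "0 < T"
  shows "frac_kernel a t \<le> T powr (a - 1) / Gamma a"
  using assms by (auto simp: frac_kernel_def intro!: divide_right_mono powr_mono2 divide_nonneg_pos)

lemma has_bochner_integral_Beta:
  fixes a b :: real
  assumes "a > 0" "b > 0"
  shows "has_bochner_integral lborel (\<lambda>t. indicator {0<..<1} t * (t powr (a - 1) * (1 - t) powr (b - 1))) (Beta a b)"
proof -
  have "set_integrable lborel {0<..<1} (\<lambda>t. t powr (a - 1) * (1 - t) powr (b - 1))"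
    by (rule set_integrable_subset[OF integrable_Beta[OF assms]]) auto
  note * = set_borel_integral_eq_integral[OF this]
  have "integral {0<..<1} (\<lambda>t. t powr (a - 1) * (1 - t) powr (b - 1)) = Beta a b"
    using has_integral_Beta_real[OF assms] by (simp add: has_integral_Icc_iff_Ioo integral_unique)
  with * show ?thesis using \<open>set_integrable lborel {0<..<1} _\<close>
    by (simp add: has_bochner_integral_iff set_integrable_def set_lebesgue_integral_def)
qed

text \<open>The substitution \<tau> = \<sigma> + (t - \<sigma>) x turns the product of kernels into
  a Beta integral. The shift \<sigma> is the outer variable of the later Fubini arguments.\<close>

lemma frac_kernel_convolution:
  assumes "a > 0" "b > 0"
  shows "has_bochner_integral lborel (\<lambda>\<tau>. frac_kernel b (\<tau> - \<sigma>) * frac_kernel a (t - \<tau>)) (frac_kernel (a + b) (t - \<sigma>))"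
proof (cases "t > \<sigma>")
  case False
  hence z: "(\<lambda>\<tau>. frac_kernel b (\<tau> - \<sigma>) * frac_kernel a (t - \<tau>)) = (\<lambda>\<tau>. 0)"
    by (auto simp: frac_kernel_def)
  show ?thesis using False unfolding z by (simp add: has_bochner_integral_zero)
next
  case True
  define d where "d = t - \<sigma>"
  have d: "d > 0" using True by (simp add: d_def)
  let ?C = "d powr (a + b - 2) / (Gamma a * Gamma b)"
  have eq: "frac_kernel b (\<sigma> + d * x - \<sigma>) * frac_kernel a (t - (\<sigma> + d * x)) =
      ?C * (indicator {0<..<1} x * (x powr (b - 1) * (1 - x) powr (a - 1)))" for x
  proof -
    have 1: "t - (\<sigma> + d * x) = d * (1 - x)" by (simp add: d_def algebra_simps)
    have "d powr (a + b - 2) = d powr (b - 1) * d powr (a - 1)"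
      by (simp add: powr_add[symmetric] add.commute)
    thus ?thesis using d unfolding 1 frac_kernel_def
      by (auto simp: powr_mult indicator_def zero_less_mult_iff mult_ac)
  qed
  have "has_bochner_integral lborel (\<lambda>x. ?C * (indicator {0<..<1} x * (x powr (b - 1) * (1 - x) powr (a - 1)))) (?C * Beta b a)"
    by (intro has_bochner_integral_mult_right has_bochner_integral_Beta assms)
  note I = this
  have "d * (?C * Beta b a) /\<^sub>R \<bar>d\<bar> = ?C * Beta b a" using d by simp
  with I have "has_bochner_integral lborel (\<lambda>x. frac_kernel b (\<sigma> + d * x - \<sigma>) * frac_kernel a (t - (\<sigma> + d * x))) (d * (?C * Beta b a) /\<^sub>R \<bar>d\<bar>)"
    unfolding eq by (simp only:)
  hence "has_bochner_integral lborel (\<lambda>\<tau>. frac_kernel b (\<tau> - \<sigma>) * frac_kernel a (t - \<tau>)) (d * (?C * Beta b a))"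
    by (subst lborel_has_bochner_integral_real_affine_iff[of d _ _ \<sigma>]) (use d in \<open>simp_all only: less_imp_neq[symmetric] not_False_eq_True\<close>)
  moreover have "d * (?C * Beta b a) = frac_kernel (a + b) (t - \<sigma>)"
  proof -
    have "d powr (a + b - 2) * d = d powr (a + b - 1)"
      using d powr_add[of d "a + b - 2" 1] by (simp add: algebra_simps)
    moreover have "Gamma a > 0" "Gamma b > 0" "Gamma (a + b) > 0" using assms by auto
    ultimately show ?thesis using d
      by (simp add: frac_kernel_def d_def[symmetric] Beta_def add.commute field_simps)
  qed
  ultimately show ?thesis by simp
qed

lemma loc_integrable_bounded_mult:
  assumes f: "loc_integrable f" and g: "g \<in> borel_measurable borel"
    and b: "\<And>\<tau>. 0 < \<tau> \<Longrightarrow> \<tau> \<le> t \<Longrightarrow> \<bar>g \<tau>\<bar> \<le> C" and z: "\<And>\<tau>. \<tau> > t \<Longrightarrow> g \<tau> = 0"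
  shows "integrable lborel (\<lambda>\<tau>. indicator {0<..} \<tau> * f \<tau> * g \<tau>)"
proof (rule Bochner_Integration.integrable_bound)
  show "integrable lborel (\<lambda>\<tau>. C * (indicator {0<..t} \<tau> * f \<tau>))"
    using f by (auto simp: loc_integrable_def)
  show "(\<lambda>\<tau>. indicator {0<..} \<tau> * f \<tau> * g \<tau>) \<in> borel_measurable lborel"
    using f g unfolding loc_integrable_def by auto
  show "AE \<tau> in lborel. norm (indicator {0<..} \<tau> * f \<tau> * g \<tau>) \<le> norm (C * (indicator {0<..t} \<tau> * f \<tau>))"
  proof (rule AE_I2)
    fix \<tau>
    show "norm (indicator {0<..} \<tau> * f \<tau> * g \<tau>) \<le> norm (C * (indicator {0<..t} \<tau> * f \<tau>))"
    proof (cases "0 < \<tau> \<and> \<tau> \<le> t")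
      case True
      hence "\<bar>g \<tau>\<bar> \<le> \<bar>C\<bar>" using b[of \<tau>] by auto
      thus ?thesis using True mult_left_mono[of "\<bar>g \<tau>\<bar>" "\<bar>C\<bar>" "\<bar>f \<tau>\<bar>"]
        by (simp add: abs_mult mult.commute)
    qed (use z in \<open>auto simp: indicator_def not_le\<close>)
  qed
qed

lemma frac_int_integrable_ge_1:
  assumes "loc_integrable f" "a \<ge> 1"
  shows "integrable lborel (\<lambda>\<tau>. indicator {0<..} \<tau> * f \<tau> * frac_kernel a (t - \<tau>))"
proof (rule loc_integrable_bounded_mult[where t = t and C = "(max t 1) powr (a - 1) / Gamma a"])
  fix \<tau> :: real assume "0 < \<tau>" "\<tau> \<le> t"
  thus "\<bar>frac_kernel a (t - \<tau>)\<bar> \<le> (max t 1) powr (a - 1) / Gamma a"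
    using frac_kernel_le[of a "t - \<tau>" "max t 1"] assms by simp
qed (use assms in auto)

text \<open>Fubini and the convolution of kernels give the semigroup law. A total order of at least
  1 makes the combined kernel bounded on bounded sets, so that for every locally integrable f all
  integrals converge at each t, not just at almost every t.\<close>

lemma frac_int_frac_int:
  assumes f: "loc_integrable f" and "a > 0" "b \<ge> 0" "a + b \<ge> 1"
  shows "integrable lborel (\<lambda>\<tau>. indicator {0<..} \<tau> * frac_int b f \<tau> * frac_kernel a (t - \<tau>))"
    and "frac_int a (frac_int b f) t = frac_int (a + b) f t"
proof -
  have "integrable lborel (\<lambda>\<tau>. indicator {0<..} \<tau> * frac_int b f \<tau> * frac_kernel a (t - \<tau>)) \<and>
    frac_int a (frac_int b f) t = frac_int (a + b) f t"
  proof (cases "b = 0")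
    case True
    hence "frac_int b f = f" by (simp add: fun_eq_iff frac_int_def)
    thus ?thesis using True assms frac_int_integrable_ge_1[OF f, of a t] by simp
  next
    case False
    hence b: "b > 0" using assms by simp
    let ?F = "\<lambda>\<sigma> \<tau>. indicator {0<..} \<sigma> * f \<sigma> * (frac_kernel b (\<tau> - \<sigma>) * frac_kernel a (t - \<tau>))"
    note conv = frac_kernel_convolution[OF \<open>a > 0\<close> b, where t = t]
    have m [measurable]: "(\<lambda>t. indicator {0<..} t * f t) \<in> borel_measurable borel"
      using f by (simp add: loc_integrable_def)
    have *: "integrable (lborel \<Otimes>\<^sub>M lborel) (case_prod ?F)"
    proof (rule lborel_pair.Fubini_integrable)
      show "case_prod ?F \<in> borel_measurable (lborel \<Otimes>\<^sub>M lborel)"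
        by measurable
      have "(\<lambda>\<sigma>. LINT \<tau>|lborel. norm (case_prod ?F (\<sigma>, \<tau>))) =
          (\<lambda>\<sigma>. \<bar>indicator {0<..} \<sigma> * f \<sigma> * frac_kernel (a + b) (t - \<sigma>)\<bar>)"
      proof
        fix \<sigma>
        have "(LINT \<tau>|lborel. norm (case_prod ?F (\<sigma>, \<tau>))) =
          (LINT \<tau>|lborel. \<bar>indicator {0<..} \<sigma> * f \<sigma>\<bar> * (frac_kernel b (\<tau> - \<sigma>) * frac_kernel a (t - \<tau>)))"
          using assms b by (intro Bochner_Integration.integral_cong) (auto simp: abs_mult)
        also have "\<dots> = \<bar>indicator {0<..} \<sigma> * f \<sigma>\<bar> * frac_kernel (a + b) (t - \<sigma>)"
          using conv[of \<sigma>] by (simp add: has_bochner_integral_integral_eq)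
        finally show "(LINT \<tau>|lborel. norm (case_prod ?F (\<sigma>, \<tau>))) = \<bar>indicator {0<..} \<sigma> * f \<sigma> * frac_kernel (a + b) (t - \<sigma>)\<bar>"
          using assms b by (simp add: abs_mult)
      qed
      thus "integrable lborel (\<lambda>\<sigma>. LINT \<tau>|lborel. norm (case_prod ?F (\<sigma>, \<tau>)))"
        using frac_int_integrable_ge_1[OF f \<open>a + b \<ge> 1\<close>, of t] by simp
      show "AE \<sigma> in lborel. integrable lborel (\<lambda>\<tau>. case_prod ?F (\<sigma>, \<tau>))"
        using conv by (auto intro!: AE_I2 integrable_mult_right simp: has_bochner_integral_iff simp del: mult_eq_0_iff)
    qed
    have i1: "(LINT \<sigma>|lborel. ?F \<sigma> \<tau>) = indicator {0<..} \<tau> * frac_int b f \<tau> * frac_kernel a (t - \<tau>)" for \<tau>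
    proof (cases "\<tau> > 0")
      case True
      have "(LINT \<sigma>|lborel. ?F \<sigma> \<tau>) = (LINT \<sigma>|lborel. indicator {0<..} \<sigma> * f \<sigma> * frac_kernel b (\<tau> - \<sigma>) * frac_kernel a (t - \<tau>))"
        by (simp add: mult_ac)
      also have "\<dots> = frac_int b f \<tau> * frac_kernel a (t - \<tau>)"
        unfolding integral_mult_left_zero using b by (simp add: frac_int_def)
      finally show ?thesis using True by simp
    next
      case False
      hence "(LINT \<sigma>|lborel. ?F \<sigma> \<tau>) = (LINT \<sigma>|(lborel::real measure). 0)"
        by (intro Bochner_Integration.integral_cong) (auto simp: indicator_def)
      thus ?thesis using False by simp
    qed
    have i2: "(LINT \<tau>|lborel. ?F \<sigma> \<tau>) = indicator {0<..} \<sigma> * f \<sigma> * frac_kernel (a + b) (t - \<sigma>)" for \<sigma>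
      using conv[of \<sigma>] by (simp add: has_bochner_integral_integral_eq)
    have "integrable lborel (\<lambda>\<tau>. LINT \<sigma>|lborel. ?F \<sigma> \<tau>)"
      using lborel_pair.integrable_snd[OF *] by simp
    moreover have "(LINT \<tau>|lborel. LINT \<sigma>|lborel. ?F \<sigma> \<tau>) = (LINT \<sigma>|lborel. LINT \<tau>|lborel. ?F \<sigma> \<tau>)"
      using lborel_pair.Fubini_integral[OF *] by simp
    ultimately show ?thesis using assms b unfolding i1 i2 by (simp add: frac_int_def)
  qed
  thus "integrable lborel (\<lambda>\<tau>. indicator {0<..} \<tau> * frac_int b f \<tau> * frac_kernel a (t - \<tau>))"
    "frac_int a (frac_int b f) t = frac_int (a + b) f t" by auto
qed

lemma frac_int_frac_kernel:
  assumes "a \<ge> 0" "b > 0"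
  shows "frac_int a (frac_kernel b) t = frac_kernel (a + b) t"
proof (cases "a = 0")
  case False
  have "frac_int a (frac_kernel b) t = (LINT \<tau>|lborel. frac_kernel b (\<tau> - 0) * frac_kernel a (t - \<tau>))"
    using False unfolding frac_int_def by (auto intro!: Bochner_Integration.integral_cong simp: indicator_def)
  also have "\<dots> = frac_kernel (a + b) t"
    using frac_kernel_convolution[of a b 0 t] False assms by (simp add: has_bochner_integral_integral_eq)
  finally show ?thesis .
qed (simp add: frac_int_def)

lemma frac_kernel_loc_integrable:
  assumes "b > 0" shows "loc_integrable (frac_kernel b)"
  unfolding loc_integrable_def
proof safe
  fix T
  \<comment> \<open>The kernel of order 1 equals 1 below T + 1, so this convolution contains the
    integral of the kernel of order b over (0, T].\<close>
  have "integrable lborel (\<lambda>\<tau>. frac_kernel b (\<tau> - 0) * frac_kernel 1 (T + 1 - \<tau>))"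
    using frac_kernel_convolution[of 1 b 0 "T + 1"] assms by (auto simp: has_bochner_integral_iff)
  from integrable_mult_indicator[OF _ this, of "{0<..T}"]
  have "integrable lborel (\<lambda>x. indicator {0<..T} x *\<^sub>R (frac_kernel b (x - 0) * frac_kernel 1 (T + 1 - x)))" by simp
  also have "(\<lambda>x. indicator {0<..T} x *\<^sub>R (frac_kernel b (x - 0) * frac_kernel 1 (T + 1 - x))) = (\<lambda>t. indicator {0<..T} t * frac_kernel b t)"
    by (auto simp: fun_eq_iff frac_kernel_1 indicator_def)
  finally show "integrable lborel (\<lambda>t. indicator {0<..T} t * frac_kernel b t)" .
qed measurable

text \<open>Split at t / 2: the kernel is bounded on the lower half, where f may be singular, and f
  is bounded on the upper half, where the kernel may be singular.\<close>

lemma frac_int_integrable: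
  assumes f: "loc_integrable f" "continuous_on {0<..} f" and "b > 0" "t > 0"
  shows "integrable lborel (\<lambda>\<tau>. indicator {0<..} \<tau> * f \<tau> * frac_kernel b (t - \<tau>))"
proof -
  have "compact (f ` {t/2..t})"
    using \<open>t > 0\<close> by (intro compact_continuous_image continuous_on_subset[OF f(2)]) auto
  hence "bounded (f ` {t/2..t})" by (rule compact_imp_bounded)
  then obtain M where "\<forall>y\<in>f ` {t/2..t}. norm y \<le> M" unfolding bounded_iff by blast
  hence M: "\<And>\<tau>. \<tau> \<in> {t/2..t} \<Longrightarrow> \<bar>f \<tau>\<bar> \<le> M" by auto
  \<comment> \<open>The kernel increases or decreases according to the sign of b - 1; the maximum
    over both end points covers the two cases.\<close>
  define C where "C = max ((t/2) powr (b - 1)) (t powr (b - 1)) / Gamma b"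
  have Gb: "Gamma b > 0" using assms by auto
  have C: "frac_kernel b (t - \<tau>) \<le> C" if "0 < \<tau>" "\<tau> \<le> t / 2" for \<tau>
  proof -
    have "(t - \<tau>) powr (b - 1) \<le> max ((t/2) powr (b - 1)) (t powr (b - 1))"
    proof (cases "b \<ge> 1")
      case True
      thus ?thesis using that \<open>t > 0\<close> powr_mono2[of "b - 1" "t - \<tau>" t] by (simp add: le_max_iff_disj)
    next
      case False
      thus ?thesis using that \<open>t > 0\<close> powr_mono2'[of "b - 1" "t/2" "t - \<tau>"] by (simp add: le_max_iff_disj)
    qed
    thus ?thesis using that \<open>t > 0\<close> Gb by (simp add: frac_kernel_def C_def divide_right_mono)
  qed
  have m [measurable]: "(\<lambda>t. indicator {0<..} t * f t) \<in> borel_measurable borel"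
    using f by (simp add: loc_integrable_def)
  have M0: "M \<ge> 0" using M[of t] \<open>t > 0\<close> by auto
  have C0: "C \<ge> 0" using Gb by (auto simp: C_def le_max_iff_disj)
  show ?thesis
  proof (rule Bochner_Integration.integrable_bound)
    show "integrable lborel (\<lambda>\<tau>. C * \<bar>indicator {0<..t} \<tau> * f \<tau>\<bar> + M * (frac_kernel 1 (\<tau> - 0) * frac_kernel b (t - \<tau>)))"
      using f frac_kernel_convolution[of b 1 0 t] assms
      by (intro Bochner_Integration.integrable_add integrable_mult_right integrable_abs) (auto simp: loc_integrable_def has_bochner_integral_iff)
    show "AE \<tau> in lborel. norm (indicator {0<..} \<tau> * f \<tau> * frac_kernel b (t - \<tau>)) \<le>
        norm (C * \<bar>indicator {0<..t} \<tau> * f \<tau>\<bar> + M * (frac_kernel 1 (\<tau> - 0) * frac_kernel b (t - \<tau>)))"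
    proof (rule AE_I2)
      fix \<tau>
      have p: "0 \<le> C * \<bar>indicator {0<..t} \<tau> * f \<tau>\<bar>" "0 \<le> M * (frac_kernel 1 (\<tau> - 0) * frac_kernel b (t - \<tau>))"
        using M0 C0 assms by (auto intro!: mult_nonneg_nonneg)
      have "\<bar>indicator {0<..} \<tau> * f \<tau> * frac_kernel b (t - \<tau>)\<bar> \<le>
        C * \<bar>indicator {0<..t} \<tau> * f \<tau>\<bar> + M * (frac_kernel 1 (\<tau> - 0) * frac_kernel b (t - \<tau>))"
      proof (cases "0 < \<tau> \<and> \<tau> < t")
        case True
        show ?thesis
        proof (cases "\<tau> \<le> t / 2")
          case T: True
          hence "\<bar>f \<tau>\<bar> * frac_kernel b (t - \<tau>) \<le> C * \<bar>f \<tau>\<bar>"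
            using C[of \<tau>] True by (metis abs_ge_zero mult.commute mult_left_mono)
          thus ?thesis using True p assms by (simp add: abs_mult)
        next
          case F: False
          hence "\<bar>f \<tau>\<bar> * frac_kernel b (t - \<tau>) \<le> M * frac_kernel b (t - \<tau>)"
            using M[of \<tau>] True assms by (intro mult_right_mono) auto
          thus ?thesis using True p assms by (simp add: abs_mult frac_kernel_1)
        qed
      qed (use p in \<open>auto simp: indicator_def not_less\<close>)
      thus "norm (indicator {0<..} \<tau> * f \<tau> * frac_kernel b (t - \<tau>)) \<le>
        norm (C * \<bar>indicator {0<..t} \<tau> * f \<tau>\<bar> + M * (frac_kernel 1 (\<tau> - 0) * frac_kernel b (t - \<tau>)))"
        using p by simp
    qed
  qed measurable
qed

lemma loc_integrable_continuous:
  assumes "continuous_on {0..} f"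
  shows "loc_integrable f"
proof -
  have c: "continuous_on {0<..} f" using assms by (rule continuous_on_subset) auto
  have m: "(\<lambda>t. indicator {0<..} t * f t) \<in> borel_measurable borel"
    using borel_measurable_continuous_on_indicator[OF _ c] by simp
  have "integrable lborel (\<lambda>t. indicator {0<..T} t * f t)" for T
  proof -
    have "set_integrable lborel {0..T} f"
      by (intro borel_integrable_atLeastAtMost' continuous_on_subset[OF assms]) auto
    hence "set_integrable lborel {0<..T} f" by (rule set_integrable_subset) auto
    thus ?thesis by (simp add: set_integrable_def)
  qed
  thus ?thesis using m by (simp add: loc_integrable_def)
qed

lemma loc_integrable_absolutely:
  assumes c: "continuous_on {0<..} f" and a: "\<And>T. T > 0 \<Longrightarrow> f absolutely_integrable_on {0..T}"
  shows "loc_integrable f"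
proof -
  have m: "(\<lambda>t. indicator {0<..} t * f t) \<in> borel_measurable borel"
    using borel_measurable_continuous_on_indicator[OF _ c] by simp
  have "integrable lborel (\<lambda>t. indicator {0<..T} t * f t)" for T
  proof -
    have "f absolutely_integrable_on {0<..T}"
      by (rule set_integrable_subset[OF a[of "max T 1"]]) auto
    hence "integrable lebesgue (\<lambda>t. indicator {0<..T} t * f t)" by (simp add: set_integrable_def)
    moreover have "(\<lambda>t. indicator {0<..T} t * (indicator {0<..} t * f t)) \<in> borel_measurable borel" using m by measurable
    hence "(\<lambda>t. indicator {0<..T} t * f t) \<in> borel_measurable borel"
      by (rule back_subst[of "\<lambda>g. g \<in> borel_measurable borel"]) (auto simp: indicator_def)
    ultimately show ?thesis by (subst (asm) integrable_completion) auto
  qed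
  thus ?thesis using m by (simp add: loc_integrable_def)
qed

text \<open>The fundamental theorem is used in its interior form: f may blow up at 0, where F is
  only continuous.\<close>

lemma frac_int_1_FTC:
  assumes f: "loc_integrable f" and F: "continuous_on {0..} F"
    "\<And>t. t > 0 \<Longrightarrow> (F has_vector_derivative f t) (at t)" and t: "t > 0"
  shows "frac_int 1 f t = F t - F 0"
proof -
  have e: "(\<lambda>\<tau>. indicator {0<..} \<tau> * f \<tau> * frac_kernel 1 (t - \<tau>)) = (\<lambda>\<tau>. if \<tau> \<in> {0<..<t} then f \<tau> else 0)"
    by (auto simp: fun_eq_iff frac_kernel_1 indicator_def)
  have "integrable lborel (\<lambda>\<tau>. if \<tau> \<in> {0<..<t} then f \<tau> else 0)"
    using frac_int_integrable_ge_1[OF f, of 1 t] unfolding e by simp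
  from has_integral_integral_lborel[OF this]
  have "(f has_integral (frac_int 1 f t)) {0<..<t}"
    unfolding has_integral_restrict_UNIV by (simp add: frac_int_def e)
  moreover have "(f has_integral F t - F 0) {0..t}"
    using t by (intro fundamental_theorem_of_calculus_interior F continuous_on_subset[OF F(1)]) auto
  ultimately show ?thesis by (metis has_integral_Icc_iff_Ioo has_integral_unique)
qed

lemma frac_int_cong:
  assumes "\<And>\<tau>. \<tau> > 0 \<Longrightarrow> f \<tau> = g \<tau>" "t > 0"
  shows "frac_int a f t = frac_int a g t"
  using assms unfolding frac_int_def
  by (auto intro!: Bochner_Integration.integral_cong simp: indicator_def)

section \<open>Solutions as solutions of a Volterra equation\<close>

lemma hderiv_0: "hderiv 0 x = x" by (simp add: hderiv_def)

lemma hderiv_Suc: "hderiv (Suc k) x t = vector_derivative (hderiv k x) (at t within {0..})"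
  by (simp add: hderiv_def)

lemma at_within_half_line: "t > 0 \<Longrightarrow> at t within {0..} = at (t::real)"
  by (rule at_within_interior) simp

lemma hderiv_Suc_eqI:
  assumes "(hderiv k x has_vector_derivative D) (at t within {0..})" "t \<ge> 0"
  shows "hderiv (Suc k) x t = D"
  unfolding hderiv_Suc
proof (rule vector_derivative_within[OF _ assms(1)])
  have "{t..} \<subseteq> {0..}" using assms by auto
  moreover have "at t within {t..} \<noteq> bot"
    by (metis at_within_Ici_at_right trivial_limit_at_right_real)
  ultimately show "at t within {0..} \<noteq> bot" by (metis at_le bot.extremum_uniqueI)
qed

lemma hderiv_has_vector_derivative:
  assumes "hderiv k x differentiable_on {0<..}" "t > 0"
  shows "(hderiv k x has_vector_derivative hderiv (Suc k) x t) (at t)"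
proof -
  have "hderiv k x differentiable (at t)"
    using assms by (metis at_within_open differentiable_on_def greaterThan_iff open_greaterThan)
  thus ?thesis unfolding hderiv_Suc at_within_half_line[OF assms(2)] by (simp add: vector_derivative_works)
qed

lemma ceiling_order:
  fixes r :: real
  assumes "0 < r" "r \<le> 2"
  shows "nat \<lceil>r\<rceil> = (if r \<le> 1 then 1 else 2)"
proof -
  have "\<lceil>r\<rceil> = (if r \<le> 1 then 1 else 2)" using assms by (auto simp: ceiling_eq_iff)
  thus ?thesis by simp
qed

text \<open>The regularity clause of \<open>is_solution\<close>. It alone turns Caputo derivatives
  into fractional integrals, and it is needed for the explicit function below before that is known
  to be a solution.\<close>

definition caputo_regular :: "nat \<Rightarrow> (real \<Rightarrow> real) \<Rightarrow> bool" where
  "caputo_regular n x \<longleftrightarrow>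
     (\<forall>k. Suc k < n \<longrightarrow> hderiv k x differentiable_on {0..}) \<and>
     continuous_on {0..} (hderiv (n - 1) x) \<and>
     hderiv (n - 1) x differentiable_on {0<..} \<and>
     continuous_on {0<..} (hderiv n x) \<and>
     (\<forall>T>0. hderiv n x absolutely_integrable_on {0..T})"

lemma is_solution_iff:
  "is_solution \<alpha> \<beta> \<gamma> q1 q2 q x \<longleftrightarrow> caputo_regular (nat \<lceil>q\<rceil>) x \<and>
     (\<forall>t>0. caputo q x t + \<alpha> * caputo q1 x t + \<beta> * caputo q2 x t + \<gamma> * x t = 0)"
  by (simp add: is_solution_def caputo_regular_def Let_def)

context
  fixes q :: real and x :: "real \<Rightarrow> real"
  assumes q: "0 < q" "q \<le> 2" and reg: "caputo_regular (nat \<lceil>q\<rceil>) x"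
begin

lemma regular_continuous: "continuous_on {0..} x"
proof (cases "q \<le> 1")
  case True
  thus ?thesis using reg q by (simp add: caputo_regular_def ceiling_order hderiv_0)
next
  case False
  hence "x differentiable_on {0..}" using reg q by (auto simp: caputo_regular_def ceiling_order hderiv_0)
  thus ?thesis by (rule differentiable_imp_continuous_on)
qed

lemma regular_hderiv_n:
  "loc_integrable (hderiv (nat \<lceil>q\<rceil>) x)" "continuous_on {0<..} (hderiv (nat \<lceil>q\<rceil>) x)"
  using reg by (auto simp: caputo_regular_def intro!: loc_integrable_absolutely)

text \<open>If r and q round up differently, then r \<le> 1 < q, and the first derivative is
  continuous up to 0.\<close>

lemma regular_hderiv:
  assumes "0 < r" "r \<le> q"
  shows "loc_integrable (hderiv (nat \<lceil>r\<rceil>) x)" "continuous_on {0<..} (hderiv (nat \<lceil>r\<rceil>) x)"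
proof -
  have "loc_integrable (hderiv (nat \<lceil>r\<rceil>) x) \<and> continuous_on {0<..} (hderiv (nat \<lceil>r\<rceil>) x)"
  proof (cases "nat \<lceil>r\<rceil> = nat \<lceil>q\<rceil>")
    case True
    thus ?thesis using regular_hderiv_n by simp
  next
    case False
    hence 1: "nat \<lceil>r\<rceil> = 1" "nat \<lceil>q\<rceil> = 2" using assms q by (auto simp: ceiling_order split: if_splits)
    hence "continuous_on {0..} (hderiv 1 x)" using reg by (simp add: caputo_regular_def)
    thus ?thesis unfolding 1 by (auto intro!: loc_integrable_continuous elim: continuous_on_subset)
  qed
  thus "loc_integrable (hderiv (nat \<lceil>r\<rceil>) x)" "continuous_on {0<..} (hderiv (nat \<lceil>r\<rceil>) x)" by auto
qed

lemma frac_int_1_hderiv: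
  assumes "t > 0"
  shows "frac_int 1 (hderiv 1 x) t = x t - x 0"
proof (rule frac_int_1_FTC[OF _ regular_continuous _ assms])
  show "loc_integrable (hderiv 1 x)"
    using regular_hderiv[of "min q 1"] q by (auto simp: ceiling_order)
  show "(x has_vector_derivative hderiv 1 x t) (at t)" if "t > 0" for t
  proof -
    have "x differentiable_on {0<..}"
    proof (cases "q \<le> 1")
      case False
      hence "x differentiable_on {0..}" using reg q by (auto simp: caputo_regular_def ceiling_order hderiv_0)
      thus ?thesis by (rule differentiable_on_subset) auto
    qed (use reg q in \<open>auto simp: caputo_regular_def ceiling_order hderiv_0\<close>)
    thus ?thesis using hderiv_has_vector_derivative[of 0 x t] that by (simp add: hderiv_0)
  qed
qed

text \<open>Taylor's formula with integral remainder: two applications of the fundamental theorem,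
  joined by the semigroup law.\<close>

lemma frac_int_2_hderiv:
  assumes "t > 0" "q > 1"
  shows "frac_int 2 (hderiv 2 x) t = x t - x 0 - hderiv 1 x 0 * t"
proof -
  have n: "nat \<lceil>q\<rceil> = 2" using assms q by (simp add: ceiling_order)
  have c: "continuous_on {0..} (hderiv 1 x)" using reg unfolding n by (simp add: caputo_regular_def)
  have l2: "loc_integrable (hderiv 2 x)" using regular_hderiv_n unfolding n by simp
  have 1: "frac_int 1 (hderiv 2 x) t = hderiv 1 x t - hderiv 1 x 0" if "t > 0" for t
  proof (rule frac_int_1_FTC[OF l2 c _ that])
    fix t :: real assume "t > 0"
    thus "(hderiv 1 x has_vector_derivative hderiv 2 x t) (at t)"
      using hderiv_has_vector_derivative[of 1 x t] reg unfolding n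
      by (simp add: caputo_regular_def numeral_2_eq_2)
  qed
  have "frac_int 2 (hderiv 2 x) t = frac_int 1 (frac_int 1 (hderiv 2 x)) t"
    using frac_int_frac_int(2)[OF l2, of 1 1 t] by simp
  also have "\<dots> = frac_int 1 (\<lambda>t. hderiv 1 x t - hderiv 1 x 0) t"
    by (rule frac_int_cong) (use 1 assms in auto)
  also have "\<dots> = (x t - hderiv 1 x 0 * t) - (x 0 - hderiv 1 x 0 * 0)"
  proof (rule frac_int_1_FTC[OF _ _ _ assms(1)])
    show "loc_integrable (\<lambda>t. hderiv 1 x t - hderiv 1 x 0)"
      by (intro loc_integrable_continuous continuous_intros c)
    show "continuous_on {0..} (\<lambda>t. x t - hderiv 1 x 0 * t)"
      by (intro continuous_intros regular_continuous)
    fix t :: real assume t: "t > 0"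
    have "x differentiable_on {0..}" using reg unfolding n by (auto simp: caputo_regular_def hderiv_0)
    hence "x differentiable_on {0<..}" by (rule differentiable_on_subset) auto
    hence "(x has_vector_derivative hderiv 1 x t) (at t)"
      using hderiv_has_vector_derivative[of 0 x t] t by (simp add: hderiv_0)
    thus "((\<lambda>t. x t - hderiv 1 x 0 * t) has_vector_derivative hderiv 1 x t - hderiv 1 x 0) (at t)"
      by (auto intro!: derivative_eq_intros)
  qed
  finally show ?thesis by simp
qed

text \<open>The bridge from the gauge integral in \<open>caputo\<close> to Lebesgue integrals: the
  singular integrand is Lebesgue integrable, so both integrals agree. For integer r both sides are
  the derivative itself.\<close>

lemma caputo_eq_frac_int:
  assumes r: "0 < r" "r \<le> q" and t: "t > 0"
  shows "caputo r x t = frac_int (real (nat \<lceil>r\<rceil>) - r) (hderiv (nat \<lceil>r\<rceil>) x) t"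
proof (cases "r = real (nat \<lceil>r\<rceil>)")
  case True
  thus ?thesis by (simp add: caputo_def frac_int_def Let_def)
next
  case False
  define m where "m = nat \<lceil>r\<rceil>"
  define b where "b = real m - r"
  have b: "b > 0" using False r unfolding b_def m_def by linarith
  define y where "y = hderiv m x"
  have y: "loc_integrable y" "continuous_on {0<..} y"
    using regular_hderiv[OF r] by (auto simp: y_def m_def)
  have e: "(\<lambda>\<tau>. indicator {0<..} \<tau> * y \<tau> * frac_kernel b (t - \<tau>)) =
      (\<lambda>\<tau>. if \<tau> \<in> {0<..<t} then 1 / Gamma b * (y \<tau> / (t - \<tau>) powr (r + 1 - real m)) else 0)"
  proof -
    have r: "r + 1 - real m = - (b - 1)" by (simp add: b_def)
    show ?thesis unfolding r powr_minus
      by (auto simp: fun_eq_iff frac_kernel_def indicator_def divide_inverse)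
  qed
  have "integrable lborel (\<lambda>\<tau>. if \<tau> \<in> {0<..<t} then 1 / Gamma b * (y \<tau> / (t - \<tau>) powr (r + 1 - real m)) else 0)"
    using frac_int_integrable[OF y b t] unfolding e .
  from has_integral_integral_lborel[OF this]
  have "((\<lambda>\<tau>. 1 / Gamma b * (y \<tau> / (t - \<tau>) powr (r + 1 - real m))) has_integral (frac_int b y t)) {0..t}"
    unfolding has_integral_restrict_UNIV using b by (simp add: frac_int_def e has_integral_Icc_iff_Ioo)
  hence "integral {0..t} (\<lambda>\<tau>. 1 / Gamma b * (y \<tau> / (t - \<tau>) powr (r + 1 - real m))) = frac_int b y t"
    by (rule integral_unique)
  hence "1 / Gamma b * integral {0..t} (\<lambda>\<tau>. y \<tau> / (t - \<tau>) powr (r + 1 - real m)) = frac_int b y t"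
    by (subst (asm) integral_mult_right)
  thus ?thesis using False by (simp add: caputo_def Let_def m_def[symmetric] y_def[symmetric] b_def[symmetric])
qed

definition init_slope :: "real \<Rightarrow> real" where
  "init_slope r = (if r > 1 then hderiv 1 x 0 else 0)"

text \<open>With m the ceiling of r, the semigroup law regroups order q after order m - r as order q
  - r after order m, and the latter undoes the m derivatives up to a Taylor polynomial. Its terms 1
  and t are the kernels of order 1 and 2, so integrating them gives kernels again.\<close>

lemma frac_int_caputo:
  assumes r: "0 < r" "r \<le> q" and t: "t > 0"
  shows "integrable lborel (\<lambda>\<tau>. indicator {0<..} \<tau> * caputo r x \<tau> * frac_kernel q (t - \<tau>))"
    and "frac_int q (caputo r x) t = frac_int (q - r) x t - x 0 * frac_kernel (q - r + 1) t - init_slope r * frac_kernel (q - r + 2) t"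
proof -
  define m where "m = nat \<lceil>r\<rceil>"
  have m: "m \<ge> 1" "m \<le> 2" "m = (if r \<le> 1 then 1 else 2)" and mr: "real m \<ge> r"
    unfolding m_def using r q by (auto simp: ceiling_order)
  define y where "y = hderiv m x"
  have y: "loc_integrable y" "continuous_on {0<..} y"
    using regular_hderiv[OF r] by (auto simp: y_def m_def)
  have c: "caputo r x \<tau> = frac_int (real m - r) y \<tau>" if "\<tau> > 0" for \<tau>
    using caputo_eq_frac_int[OF r that] by (simp add: m_def y_def)
  have c': "(\<lambda>\<tau>. indicator {0<..} \<tau> * caputo r x \<tau> * frac_kernel q (t - \<tau>)) =
     (\<lambda>\<tau>. indicator {0<..} \<tau> * frac_int (real m - r) y \<tau> * frac_kernel q (t - \<tau>))"
    using c by (auto simp: fun_eq_iff indicator_def)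
  \<comment> \<open>The total order that the semigroup law asks for; it comes from r \<le> q and m
    \<ge> 1.\<close>
  have mq: "q + (real m - r) \<ge> 1" using m r by auto
  note ff = frac_int_frac_int[OF y(1) q(1) _ mq, of t]
  show "integrable lborel (\<lambda>\<tau>. indicator {0<..} \<tau> * caputo r x \<tau> * frac_kernel q (t - \<tau>))"
    unfolding c' using ff(1) mr by simp
  have p: "frac_int (real m) y \<tau> = x \<tau> - x 0 * frac_kernel 1 \<tau> - init_slope r * frac_kernel 2 \<tau>" if "\<tau> > 0" for \<tau>
  proof (cases "r \<le> 1")
    case True
    thus ?thesis using frac_int_1_hderiv[OF that] m that by (simp add: y_def init_slope_def frac_kernel_1)
  next
    case False
    thus ?thesis using frac_int_2_hderiv[OF that] m that r by (simp add: y_def init_slope_def frac_kernel_1 frac_kernel_2)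
  qed
  have "frac_int q (caputo r x) t = frac_int q (frac_int (real m - r) y) t"
    by (rule frac_int_cong) (use c t in auto)
  also have "\<dots> = frac_int ((q - r) + real m) y t" using ff(2) mr by (simp add: algebra_simps)
  also have "\<dots> = frac_int (q - r) (frac_int (real m) y) t"
  proof (cases "q = r")
    case True thus ?thesis by (simp add: frac_int_def)
  next
    case False
    thus ?thesis using m r by (subst frac_int_frac_int(2)[OF y(1)]) auto
  qed
  also have "\<dots> = frac_int (q - r) (\<lambda>\<tau>. x \<tau> - x 0 * frac_kernel 1 \<tau> - init_slope r * frac_kernel 2 \<tau>) t"
    by (rule frac_int_cong) (use p t in auto)
  also have "\<dots> = frac_int (q - r) x t - x 0 * frac_kernel (q - r + 1) t - init_slope r * frac_kernel (q - r + 2) t"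
  proof (cases "q = r")
    case True thus ?thesis by (simp add: frac_int_def)
  next
    case False
    hence qr: "q - r > 0" using r by simp
    have i1: "integrable lborel (\<lambda>\<tau>. indicator {0<..} \<tau> * x \<tau> * frac_kernel (q - r) (t - \<tau>))"
      by (intro frac_int_integrable loc_integrable_continuous regular_continuous continuous_on_subset[OF regular_continuous] qr t) auto
    have i2: "integrable lborel (\<lambda>\<tau>. indicator {0<..} \<tau> * frac_kernel b \<tau> * frac_kernel (q - r) (t - \<tau>))" if "b \<ge> 1" for b
    proof -
      have "(\<lambda>\<tau>. indicator {0<..} \<tau> * frac_kernel b \<tau> * frac_kernel (q - r) (t - \<tau>)) = (\<lambda>\<tau>. frac_kernel b (\<tau> - 0) * frac_kernel (q - r) (t - \<tau>))"
        by (auto simp: fun_eq_iff indicator_def)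
      thus ?thesis using frac_kernel_convolution[OF qr, of b 0 t] that by (simp add: has_bochner_integral_iff)
    qed
    have "frac_int (q - r) (\<lambda>\<tau>. x \<tau> - x 0 * frac_kernel 1 \<tau> - init_slope r * frac_kernel 2 \<tau>) t =
      (LINT \<tau>|lborel. indicator {0<..} \<tau> * x \<tau> * frac_kernel (q - r) (t - \<tau>) - 
        x 0 * (indicator {0<..} \<tau> * frac_kernel 1 \<tau> * frac_kernel (q - r) (t - \<tau>))
        - init_slope r * (indicator {0<..} \<tau> * frac_kernel 2 \<tau> * frac_kernel (q - r) (t - \<tau>)))"
      using qr unfolding frac_int_def by (simp add: algebra_simps)
    also have "\<dots> = frac_int (q - r) x t - x 0 * frac_int (q - r) (frac_kernel 1) t - init_slope r * frac_int (q - r) (frac_kernel 2) t"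
      using qr i1 i2[of 1] i2[of 2] by (simp add: frac_int_def)
    also have "frac_int (q - r) (frac_kernel 1) t = frac_kernel (q - r + 1) t"
      using qr by (intro frac_int_frac_kernel) auto
    also have "frac_int (q - r) (frac_kernel 2) t = frac_kernel (q - r + 2) t"
      using qr by (intro frac_int_frac_kernel) auto
    finally show ?thesis .
  qed
  finally show "frac_int q (caputo r x) t = frac_int (q - r) x t - x 0 * frac_kernel (q - r + 1) t - init_slope r * frac_kernel (q - r + 2) t" .
qed

end

text \<open>The fractional integral of order q of the Caputo derivative of order r, in terms of x and its
  initial data.\<close>
definition volterra_term :: "real \<Rightarrow> (real \<Rightarrow> real) \<Rightarrow> real \<Rightarrow> real \<Rightarrow> real" where
  "volterra_term q x r t = frac_int (q - r) x t - x 0 * frac_kernel (q - r + 1) t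
     - (if r > 1 then hderiv 1 x 0 else 0) * frac_kernel (q - r + 2) t"

lemma solution_volterra:
  assumes par: "0 < q1" "q1 < q2" "q2 < q" "q \<le> 2"
    and sol: "is_solution \<alpha> \<beta> \<gamma> q1 q2 q x" and t: "t > 0"
  shows "volterra_term q x q t + \<alpha> * volterra_term q x q1 t + \<beta> * volterra_term q x q2 t + \<gamma> * frac_int q x t = 0"
proof -
  have q: "0 < q" using par by simp
  have reg: "caputo_regular (nat \<lceil>q\<rceil>) x" using sol by (simp add: is_solution_iff)
  note fc = frac_int_caputo[OF q par(4) reg _ _ t, unfolded init_slope_def[OF q par(4) reg] volterra_term_def[symmetric]]
  note rc = regular_continuous[OF q par(4) reg]
  let ?I = "\<lambda>f \<tau>. indicator {0<..} \<tau> * f \<tau> * frac_kernel q (t - \<tau>)"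
  have ix: "integrable lborel (?I x)"
    by (intro frac_int_integrable loc_integrable_continuous rc continuous_on_subset[OF rc] q t) auto
  have "0 = (LINT \<tau>|(lborel::real measure). 0)" by simp
  also have "\<dots> = (LINT \<tau>|lborel. ?I (caputo q x) \<tau> + \<alpha> * ?I (caputo q1 x) \<tau> + \<beta> * ?I (caputo q2 x) \<tau> + \<gamma> * ?I x \<tau>)"
  proof (rule Bochner_Integration.integral_cong)
    fix \<tau> :: real
    have "?I (caputo q x) \<tau> + \<alpha> * ?I (caputo q1 x) \<tau> + \<beta> * ?I (caputo q2 x) \<tau> + \<gamma> * ?I x \<tau> =
       indicator {0<..} \<tau> * (caputo q x \<tau> + \<alpha> * caputo q1 x \<tau> + \<beta> * caputo q2 x \<tau> + \<gamma> * x \<tau>) * frac_kernel q (t - \<tau>)"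
      by (simp add: algebra_simps)
    \<comment> \<open>The equation is imposed for positive times only, and the indicator removes all
      others.\<close>
    also have "\<dots> = 0" using sol by (auto simp: is_solution_iff indicator_def)
    finally show "0 = ?I (caputo q x) \<tau> + \<alpha> * ?I (caputo q1 x) \<tau> + \<beta> * ?I (caputo q2 x) \<tau> + \<gamma> * ?I x \<tau>" by simp
  qed simp
  also have "\<dots> = frac_int q (caputo q x) t + \<alpha> * frac_int q (caputo q1 x) t + \<beta> * frac_int q (caputo q2 x) t + \<gamma> * frac_int q x t"
    using fc(1)[of q] fc(1)[of q1] fc(1)[of q2] ix par by (simp add: frac_int_def)
  finally show ?thesis using fc(2)[of q] fc(2)[of q1] fc(2)[of q2] par by simp
qed

section \<open>Laplace transforms\<close>

definition laplace :: "(real \<Rightarrow> real) \<Rightarrow> real \<Rightarrow> real" where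
  "laplace f s = (LINT t|lborel. indicator {0<..} t * f t * exp (- s * t))"

text \<open>Euler's integral for Gamma, in the variable s t.\<close>

lemma frac_kernel_laplace:
  assumes "a > 0" "s > 0"
  shows "has_bochner_integral lborel (\<lambda>t. frac_kernel a t * exp (- s * t)) (s powr (- a))"
proof -
  have Ga: "Gamma a > 0" using assms by auto
  have "(\<integral>\<^sup>+t. ennreal (frac_kernel a t * exp (- t)) \<partial>lborel) =
    (\<integral>\<^sup>+t. ennreal (1 / Gamma a) * ennreal (indicator {0..} t * t powr (a - 1) / exp t) \<partial>lborel)"
    using Ga by (intro nn_integral_cong)
      (auto simp: frac_kernel_def ennreal_mult[symmetric] exp_minus field_simps indicator_def)
  also have "\<dots> = ennreal (1 / Gamma a) * ennreal (Gamma a)"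
    using Gamma_conv_nn_integral_real[OF assms(1)] by (subst nn_integral_cmult) auto
  also have "\<dots> = ennreal 1" using Ga by (simp add: ennreal_mult[symmetric])
  finally have "has_bochner_integral lborel (\<lambda>t. frac_kernel a t * exp (- t)) 1"
    using assms by (intro has_bochner_integral_nn_integral) (auto intro!: mult_nonneg_nonneg)
  hence "has_bochner_integral lborel (\<lambda>t. frac_kernel a (0 + s * t) * exp (- (0 + s * t))) (1 / s)"
    using assms lborel_has_bochner_integral_real_affine_iff[of s "\<lambda>t. frac_kernel a t * exp (- t)" 1 0]
    by (simp add: divide_inverse)
  hence "has_bochner_integral lborel (\<lambda>t. s powr (1 - a) * (frac_kernel a (0 + s * t) * exp (- (0 + s * t)))) (s powr (1 - a) * (1 / s))"
    by (rule has_bochner_integral_mult_right)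
  moreover have "(\<lambda>t. s powr (1 - a) * (frac_kernel a (0 + s * t) * exp (- (0 + s * t)))) = (\<lambda>t. frac_kernel a t * exp (- s * t))"
  proof
    fix t
    have "s powr (1 - a) * s powr (a - 1) = 1" using assms by (simp add: powr_add[symmetric])
    thus "s powr (1 - a) * (frac_kernel a (0 + s * t) * exp (- (0 + s * t))) = frac_kernel a t * exp (- s * t)"
      using assms by (auto simp: frac_kernel_def powr_mult zero_less_mult_iff)
  qed
  moreover have "s powr (1 - a) * (1 / s) = s powr (- a)"
    using assms by (simp add: powr_diff powr_minus field_simps)
  ultimately show ?thesis by simp
qed

lemma frac_kernel_laplace_shift:
  assumes "a > 0" "s > 0"
  shows "has_bochner_integral lborel (\<lambda>t. frac_kernel a (t - \<sigma>) * exp (- s * t)) (exp (- s * \<sigma>) * s powr (- a))"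
proof -
  have "has_bochner_integral lborel (\<lambda>t. exp (- s * \<sigma>) * (frac_kernel a (- \<sigma> + 1 * t) * exp (- s * (- \<sigma> + 1 * t)))) (exp (- s * \<sigma>) * s powr (- a))"
    using frac_kernel_laplace[OF assms]
      lborel_has_bochner_integral_real_affine_iff[of 1 "\<lambda>t. frac_kernel a t * exp (- s * t)" "s powr (- a)" "- \<sigma>"]
    by (intro has_bochner_integral_mult_right) simp
  also have "(\<lambda>t. exp (- s * \<sigma>) * (frac_kernel a (- \<sigma> + 1 * t) * exp (- s * (- \<sigma> + 1 * t)))) = (\<lambda>t. frac_kernel a (t - \<sigma>) * exp (- s * t))"
    by (auto simp: fun_eq_iff exp_add[symmetric] algebra_simps)
  finally show ?thesis .
qed

text \<open>Exponentials are eigenfunctions of fractional integration from minus infinity. The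
  eigenvalue is the contraction factor of the growth estimate.\<close>

lemma frac_kernel_laplace_reflect:
  assumes "a > 0" "s > 0"
  shows "has_bochner_integral lborel (\<lambda>\<tau>. exp (s * \<tau>) * frac_kernel a (t - \<tau>)) (exp (s * t) * s powr (- a))"
proof -
  have "has_bochner_integral lborel (\<lambda>\<tau>. exp (s * t) * (frac_kernel a (t + (-1) * \<tau>) * exp (- s * (t + (-1) * \<tau>)))) (exp (s * t) * s powr (- a))"
    using frac_kernel_laplace[OF assms]
      lborel_has_bochner_integral_real_affine_iff[of "-1" "\<lambda>t. frac_kernel a t * exp (- s * t)" "s powr (- a)" t]
    by (intro has_bochner_integral_mult_right) simp
  also have "(\<lambda>\<tau>. exp (s * t) * (frac_kernel a (t + (-1) * \<tau>) * exp (- s * (t + (-1) * \<tau>)))) = (\<lambda>\<tau>. exp (s * \<tau>) * frac_kernel a (t - \<tau>))"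
    by (auto simp: fun_eq_iff exp_add[symmetric] algebra_simps)
  finally show ?thesis .
qed

text \<open>The convolution theorem, by Fubini: the shifted kernel transforms into exp(- s \<sigma>)
  times a power of s.\<close>

lemma frac_int_laplace:
  assumes a: "a \<ge> 0" and s: "s > 0" and f: "integrable lborel (\<lambda>t. indicator {0<..} t * f t * exp (- s * t))"
  shows "integrable lborel (\<lambda>t. indicator {0<..} t * frac_int a f t * exp (- s * t))"
    and "laplace (frac_int a f) s = s powr (- a) * laplace f s"
proof -
  have "integrable lborel (\<lambda>t. indicator {0<..} t * frac_int a f t * exp (- s * t)) \<and>
    laplace (frac_int a f) s = s powr (- a) * laplace f s"
  proof (cases "a = 0")
    case True
    hence "frac_int a f = f" by (simp add: fun_eq_iff frac_int_def)
    thus ?thesis using True f s by simp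
  next
    case False
    hence a: "a > 0" using a by simp
    have m0: "(\<lambda>t. indicator {0<..} t * f t * exp (- s * t)) \<in> borel_measurable borel"
      using f by auto
    \<comment> \<open>Measurability of f is recovered from the weighted integrand by undoing the
      weight.\<close>
    have "(\<lambda>t. indicator {0<..} t * f t * exp (- s * t) * exp (s * t)) \<in> borel_measurable borel"
      by (intro borel_measurable_times m0) measurable
    also have "(\<lambda>t. indicator {0<..} t * f t * exp (- s * t) * exp (s * t)) = (\<lambda>t. indicator {0<..} t * f t)"
      by (simp add: fun_eq_iff mult.assoc exp_add[symmetric])
    finally have m [measurable]: "(\<lambda>t. indicator {0<..} t * f t) \<in> borel_measurable borel" .
    let ?F = "\<lambda>\<sigma> t. indicator {0<..} \<sigma> * f \<sigma> * (frac_kernel a (t - \<sigma>) * exp (- s * t))"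
    note lk = frac_kernel_laplace_shift[OF a s]
    have *: "integrable (lborel \<Otimes>\<^sub>M lborel) (case_prod ?F)"
    proof (rule lborel_pair.Fubini_integrable)
      show "case_prod ?F \<in> borel_measurable (lborel \<Otimes>\<^sub>M lborel)" by measurable
      have "(LINT t|lborel. norm (case_prod ?F (\<sigma>, t))) = s powr (- a) * \<bar>indicator {0<..} \<sigma> * f \<sigma> * exp (- s * \<sigma>)\<bar>" for \<sigma>
      proof -
        have "(LINT t|lborel. norm (case_prod ?F (\<sigma>, t))) =
          (LINT t|lborel. \<bar>indicator {0<..} \<sigma> * f \<sigma>\<bar> * (frac_kernel a (t - \<sigma>) * exp (- s * t)))"
          using a by (intro Bochner_Integration.integral_cong) (auto simp: abs_mult)
        also have "\<dots> = \<bar>indicator {0<..} \<sigma> * f \<sigma>\<bar> * (exp (- s * \<sigma>) * s powr (- a))"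
          using lk[of \<sigma>] by (simp add: has_bochner_integral_integral_eq)
        finally show ?thesis by (simp only: abs_mult abs_exp_cancel mult_ac)
      qed
      thus "integrable lborel (\<lambda>\<sigma>. LINT t|lborel. norm (case_prod ?F (\<sigma>, t)))"
        using f by (simp del: abs_mult)
      show "AE \<sigma> in lborel. integrable lborel (\<lambda>t. case_prod ?F (\<sigma>, t))"
        using lk by (auto intro!: AE_I2 integrable_mult_right simp: has_bochner_integral_iff simp del: mult_eq_0_iff)
    qed
    have i1: "(LINT \<sigma>|lborel. ?F \<sigma> t) = indicator {0<..} t * frac_int a f t * exp (- s * t)" for t
    proof (cases "t > 0")
      case True
      have "(LINT \<sigma>|lborel. ?F \<sigma> t) = (LINT \<sigma>|lborel. indicator {0<..} \<sigma> * f \<sigma> * frac_kernel a (t - \<sigma>) * exp (- s * t))"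
        by (simp add: mult_ac)
      also have "\<dots> = frac_int a f t * exp (- s * t)"
        unfolding integral_mult_left_zero using a by (simp add: frac_int_def)
      finally show ?thesis using True by simp
    next
      case False
      hence "(LINT \<sigma>|lborel. ?F \<sigma> t) = (LINT \<sigma>|(lborel::real measure). 0)"
        by (intro Bochner_Integration.integral_cong) (auto simp: indicator_def)
      thus ?thesis using False by simp
    qed
    have i2: "(LINT t|lborel. ?F \<sigma> t) = s powr (- a) * (indicator {0<..} \<sigma> * f \<sigma> * exp (- s * \<sigma>))" for \<sigma>
      using lk[of \<sigma>] by (simp add: has_bochner_integral_integral_eq)
    have "integrable lborel (\<lambda>t. LINT \<sigma>|lborel. ?F \<sigma> t)"
      using lborel_pair.integrable_snd[OF *] by simp
    moreover have "(LINT t|lborel. LINT \<sigma>|lborel. ?F \<sigma> t) = (LINT \<sigma>|lborel. LINT t|lborel. ?F \<sigma> t)"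
      using lborel_pair.Fubini_integral[OF *] by simp
    ultimately show ?thesis unfolding i1 i2 by (simp add: laplace_def)
  qed
  thus "integrable lborel (\<lambda>t. indicator {0<..} t * frac_int a f t * exp (- s * t))"
    "laplace (frac_int a f) s = s powr (- a) * laplace f s" by auto
qed

lemma frac_int_exp_bound:
  assumes "a > 0" "\<sigma> > 0" "M \<ge> 0" and f: "\<And>\<tau>. 0 < \<tau> \<Longrightarrow> \<tau> < t \<Longrightarrow> \<bar>f \<tau>\<bar> \<le> M * exp (\<sigma> * \<tau>)"
  shows "\<bar>frac_int a f t\<bar> \<le> M * exp (\<sigma> * t) * \<sigma> powr (- a)"
proof -
  have "\<bar>frac_int a f t\<bar> \<le> (LINT \<tau>|lborel. \<bar>indicator {0<..} \<tau> * f \<tau> * frac_kernel a (t - \<tau>)\<bar>)"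
    using assms(1) unfolding frac_int_def by (simp add: integral_abs_bound)
  also have "\<dots> \<le> (LINT \<tau>|lborel. M * (exp (\<sigma> * \<tau>) * frac_kernel a (t - \<tau>)))"
  proof (rule integral_mono')
    show "integrable lborel (\<lambda>\<tau>. M * (exp (\<sigma> * \<tau>) * frac_kernel a (t - \<tau>)))"
      using frac_kernel_laplace_reflect[OF assms(1,2)] by (intro integrable_mult_right) (auto simp: has_bochner_integral_iff)
    fix \<tau>
    show "\<bar>indicator {0<..} \<tau> * f \<tau> * frac_kernel a (t - \<tau>)\<bar> \<le> M * (exp (\<sigma> * \<tau>) * frac_kernel a (t - \<tau>))"
    proof (cases "0 < \<tau> \<and> \<tau> < t")
      case True
      thus ?thesis using mult_right_mono[OF f, of \<tau> "frac_kernel a (t - \<tau>)"] assms by (simp add: abs_mult mult.assoc)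
    next
      case False
      hence "indicator {0<..} \<tau> * f \<tau> * frac_kernel a (t - \<tau>) = 0" by (auto simp: indicator_def not_less)
      thus ?thesis using assms by (simp only: abs_zero) (intro mult_nonneg_nonneg, auto)
    qed
  qed (use assms in \<open>auto intro!: mult_nonneg_nonneg\<close>)
  also have "\<dots> = M * exp (\<sigma> * t) * \<sigma> powr (- a)"
    using frac_kernel_laplace_reflect[OF assms(1,2), of t] by (simp add: has_bochner_integral_integral_eq)
  finally show ?thesis .
qed

text \<open>From t \<le> exp t and a - 1 \<le> 3. The kernels that carry initial data have orders at
  most q + 2 \<le> 4, which is the origin of the 3.\<close>

lemma frac_kernel_exp_bound:
  assumes "1 \<le> a" "a \<le> 4" "t \<ge> 0"
  shows "frac_kernel a t \<le> 1 / Gamma a * exp (3 * t)"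
proof (cases "t > 0")
  case True
  have "t powr (a - 1) \<le> exp t powr (a - 1)"
    using assms exp_ge_add_one_self[of t] by (intro powr_mono2) linarith+
  also have "\<dots> = exp ((a - 1) * t)" by (simp add: powr_def)
  also have "\<dots> \<le> exp (3 * t)" using assms by (auto intro: mult_right_mono)
  finally show ?thesis using assms True by (simp add: frac_kernel_def divide_right_mono)
qed (use assms in auto)

text \<open>At a maximum point of |x| exp(- \<sigma> t) on [0, T] the hypothesis bounds the maximum
  by G plus half of itself. The resulting constant does not depend on T.\<close>

lemma volterra_exponential_bound:
  assumes c: "continuous_on {0..} x" and ab: "a > 0" "b > 0" "d > 0"
    and G: "G \<ge> 0" and v: "\<And>t. t > 0 \<Longrightarrow>
      \<bar>x t + \<alpha> * frac_int a x t + \<beta> * frac_int b x t + \<gamma> * frac_int d x t\<bar> \<le> G * exp (3 * t)"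
  obtains C \<sigma> where "\<sigma> \<ge> 3" "C \<ge> 0" "\<And>t. t \<ge> 0 \<Longrightarrow> \<bar>x t\<bar> \<le> C * exp (\<sigma> * t)"
proof -
  \<comment> \<open>For large \<sigma> the three integral terms together have norm below 1/2 in the
    weight exp(\<sigma> t).\<close>
  have "((\<lambda>\<sigma>. \<bar>\<alpha>\<bar> * \<sigma> powr (- a) + \<bar>\<beta>\<bar> * \<sigma> powr (- b) + \<bar>\<gamma>\<bar> * \<sigma> powr (- d)) \<longlongrightarrow> \<bar>\<alpha>\<bar> * 0 + \<bar>\<beta>\<bar> * 0 + \<bar>\<gamma>\<bar> * 0) at_top"
    using ab by (intro tendsto_intros tendsto_neg_powr filterlim_ident) auto
  hence "eventually (\<lambda>\<sigma>. \<bar>\<alpha>\<bar> * \<sigma> powr (- a) + \<bar>\<beta>\<bar> * \<sigma> powr (- b) + \<bar>\<gamma>\<bar> * \<sigma> powr (- d) < 1/2 \<and> \<sigma> \<ge> 3) at_top"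
    by (intro eventually_conj eventually_ge_at_top order_tendstoD) auto
  then obtain \<sigma> where \<sigma>: "\<bar>\<alpha>\<bar> * \<sigma> powr (- a) + \<bar>\<beta>\<bar> * \<sigma> powr (- b) + \<bar>\<gamma>\<bar> * \<sigma> powr (- d) < 1/2" "\<sigma> \<ge> 3"
    by (auto simp: eventually_at_top_linorder)
  \<comment> \<open>Either the maximum of \<phi> sits at 0, or it satisfies \<phi>(t) \<le> G +
    \<phi>(t) / 2, that is \<phi>(t) \<le> 2 G.\<close>
  define C where "C = max \<bar>x 0\<bar> (2 * G)"
  have "\<bar>x T\<bar> \<le> C * exp (\<sigma> * T)" if "T \<ge> 0" for T
  proof -
    define \<phi> where "\<phi> = (\<lambda>t. \<bar>x t\<bar> * exp (- \<sigma> * t))"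
    have "continuous_on {0..T} \<phi>" unfolding \<phi>_def
      by (intro continuous_intros continuous_on_subset[OF c]) auto
    hence "\<exists>t\<in>{0..T}. \<forall>u\<in>{0..T}. \<phi> u \<le> \<phi> t"
      using that by (intro continuous_attains_sup) auto
    then obtain t where t: "t \<in> {0..T}" "\<And>u. u \<in> {0..T} \<Longrightarrow> \<phi> u \<le> \<phi> t" by blast
    have p0: "\<phi> t \<ge> 0" by (simp add: \<phi>_def)
    have "\<phi> t \<le> C"
    proof (cases "t = 0")
      case True
      thus ?thesis by (simp add: \<phi>_def C_def)
    next
      case False
      hence t0: "t > 0" using t by simp
      have xb: "\<bar>x u\<bar> \<le> \<phi> t * exp (\<sigma> * u)" if "0 < u" "u < t" for u
      proof -
        have "\<bar>x u\<bar> = \<phi> u * exp (\<sigma> * u)" by (simp add: \<phi>_def mult.assoc exp_add[symmetric])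
        also have "\<dots> \<le> \<phi> t * exp (\<sigma> * u)" using t that by (intro mult_right_mono) auto
        finally show ?thesis .
      qed
      have fb: "\<bar>frac_int e x t\<bar> \<le> \<phi> t * exp (\<sigma> * t) * \<sigma> powr (- e)" if "e > 0" for e
        using \<sigma> p0 xb that by (intro frac_int_exp_bound) auto
      have "\<bar>x t\<bar> \<le> G * exp (3 * t) + \<bar>\<alpha>\<bar> * \<bar>frac_int a x t\<bar> + \<bar>\<beta>\<bar> * \<bar>frac_int b x t\<bar> + \<bar>\<gamma>\<bar> * \<bar>frac_int d x t\<bar>"
        using v[OF t0] unfolding abs_mult[symmetric] by linarith
      also have "\<dots> \<le> G * exp (\<sigma> * t) + \<bar>\<alpha>\<bar> * (\<phi> t * exp (\<sigma> * t) * \<sigma> powr (- a)) +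
         \<bar>\<beta>\<bar> * (\<phi> t * exp (\<sigma> * t) * \<sigma> powr (- b)) + \<bar>\<gamma>\<bar> * (\<phi> t * exp (\<sigma> * t) * \<sigma> powr (- d))"
        using G \<sigma> t0 fb[OF ab(1)] fb[OF ab(2)] fb[OF ab(3)] by (intro add_mono mult_left_mono) auto
      also have "\<dots> = exp (\<sigma> * t) * (G + \<phi> t * (\<bar>\<alpha>\<bar> * \<sigma> powr (- a) + \<bar>\<beta>\<bar> * \<sigma> powr (- b) + \<bar>\<gamma>\<bar> * \<sigma> powr (- d)))"
        by (simp add: algebra_simps)
      also have "\<dots> \<le> exp (\<sigma> * t) * (G + \<phi> t * (1/2))"
        using \<sigma> p0 by (intro mult_left_mono add_left_mono) auto
      finally have "\<bar>x t\<bar> * exp (- \<sigma> * t) \<le> exp (\<sigma> * t) * (G + \<phi> t * (1/2)) * exp (- \<sigma> * t)"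
        by (intro mult_right_mono) auto
      also have "\<dots> = (G + \<phi> t * (1/2)) * (exp (\<sigma> * t) * exp (- \<sigma> * t))" by (simp only: mult_ac)
      also have "\<dots> = G + \<phi> t * (1/2)" by (simp add: exp_add[symmetric])
      finally have "\<phi> t \<le> G + \<phi> t * (1/2)" by (subst (1) \<phi>_def)
      thus ?thesis by (simp add: C_def)
    qed
    hence "\<phi> T \<le> C" using t(2)[of T] that by simp
    hence "\<phi> T * exp (\<sigma> * T) \<le> C * exp (\<sigma> * T)" by (intro mult_right_mono) auto
    thus ?thesis by (simp add: \<phi>_def mult.assoc exp_add[symmetric])
  qed
  moreover have "C \<ge> 0" using G by (simp add: C_def)
  ultimately show ?thesis using that \<sigma>(2) by blast
qed

lemma exp_integrable:
  assumes "s > (0::real)"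
  shows "integrable lborel (\<lambda>t. indicator {0<..} t * exp (- s * t))"
  using frac_kernel_laplace[of 1 s] assms by (simp add: frac_kernel_1 has_bochner_integral_iff)

lemma laplace_integrable:
  fixes x :: "real \<Rightarrow> real"
  assumes c: "continuous_on {0..} x" and b: "\<And>t. t \<ge> 0 \<Longrightarrow> \<bar>x t\<bar> \<le> C * exp (\<sigma> * t)" and s: "s > \<sigma>"
  shows "integrable lborel (\<lambda>t. indicator {0<..} t * x t * exp (- s * t))"
proof (rule Bochner_Integration.integrable_bound)
  show "integrable lborel (\<lambda>t. C * (indicator {0<..} t * exp (- (s - \<sigma>) * t)))"
    by (rule integrable_mult_right, rule exp_integrable) (use s in simp)
  have [measurable]: "(\<lambda>t. indicator {0<..} t * x t) \<in> borel_measurable borel"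
    using loc_integrable_continuous[OF c] by (simp add: loc_integrable_def)
  show "(\<lambda>t. indicator {0<..} t * x t * exp (- s * t)) \<in> borel_measurable lborel" by measurable
  have C: "C \<ge> 0" using b[of 0] by simp
  show "AE t in lborel. norm (indicator {0<..} t * x t * exp (- s * t)) \<le> norm (C * (indicator {0<..} t * exp (- (s - \<sigma>) * t)))"
  proof (rule AE_I2)
    fix t
    have "\<bar>x t\<bar> * exp (- s * t) \<le> C * exp (\<sigma> * t) * exp (- s * t)" if "t > 0"
      using b[of t] that by (intro mult_right_mono) auto
    also have "C * exp (\<sigma> * t) * exp (- s * t) = C * exp (- (s - \<sigma>) * t)"
      by (simp add: mult.assoc exp_add[symmetric] algebra_simps)
    finally show "norm (indicator {0<..} t * x t * exp (- s * t)) \<le> norm (C * (indicator {0<..} t * exp (- (s - \<sigma>) * t)))"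
      using C by (auto simp: indicator_def abs_mult)
  qed
qed

text \<open>The coefficient of x'(0) in the transform of the Caputo derivative of order r, which is present
  only if that derivative involves x''.\<close>
definition slope_order :: "real \<Rightarrow> real \<Rightarrow> real" where
  "slope_order r s = (if r > 1 then s powr (r - 2) else 0)"

text \<open>The Volterra form is transformed instead of the equation, since the growth bound
  concerns x and not its derivatives. Multiplication by s^q then restores the characteristic
  function.\<close>

lemma solution_laplace:
  assumes par: "0 < q1" "q1 < q2" "q2 < q" "q \<le> 2"
    and sol: "is_solution \<alpha> \<beta> \<gamma> q1 q2 q x"
  obtains C \<sigma> where "\<sigma> \<ge> 3" "C \<ge> 0" "\<And>t. t \<ge> 0 \<Longrightarrow> \<bar>x t\<bar> \<le> C * exp (\<sigma> * t)"
    "\<And>s. s > \<sigma> \<Longrightarrow> laplace x s * (s powr q + \<alpha> * s powr q1 + \<beta> * s powr q2 + \<gamma>) =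
       x 0 * (s powr (q - 1) + \<alpha> * s powr (q1 - 1) + \<beta> * s powr (q2 - 1)) +
       hderiv 1 x 0 * (slope_order q s + \<alpha> * slope_order q1 s + \<beta> * slope_order q2 s)"
proof -
  have q: "0 < q" using par by simp
  have reg: "caputo_regular (nat \<lceil>q\<rceil>) x" using sol by (simp add: is_solution_iff)
  note rc = regular_continuous[OF q par(4) reg]
  note sv = solution_volterra[OF par sol]
  define e where "e = (\<lambda>r::real. if r > 1 then hderiv 1 x 0 else (0::real))"
  \<comment> \<open>The initial data seen by order r. Its transform has the exponents -(q - r + 1)
    and -(q - r + 2), which become r - 1 and r - 2 after multiplication by s^q.\<close>
  define H where "H = (\<lambda>r t. x 0 * frac_kernel (q - r + 1) t + e r * frac_kernel (q - r + 2) t)"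
  define B where "B = (\<lambda>r. \<bar>x 0\<bar> * (1 / Gamma (q - r + 1)) + \<bar>e r\<bar> * (1 / Gamma (q - r + 2)))"
  have B0: "B r \<ge> 0" if "r \<le> q" for r unfolding B_def using that
    by (intro add_nonneg_nonneg mult_nonneg_nonneg) auto
  have vt: "volterra_term q x r t = frac_int (q - r) x t - H r t" for r t
    by (simp add: volterra_term_def H_def e_def)
  have Hb: "\<bar>H r t\<bar> \<le> B r * exp (3 * t)" if "0 < r" "r \<le> q" "t > 0" for r t
  proof -
    have "\<bar>H r t\<bar> \<le> \<bar>x 0\<bar> * frac_kernel (q - r + 1) t + \<bar>e r\<bar> * frac_kernel (q - r + 2) t"
      unfolding H_def using that by (intro order.trans[OF abs_triangle_ineq] add_mono) (auto simp: abs_mult)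
    also have "\<dots> \<le> \<bar>x 0\<bar> * (1 / Gamma (q - r + 1) * exp (3 * t)) + \<bar>e r\<bar> * (1 / Gamma (q - r + 2) * exp (3 * t))"
      using that par by (intro add_mono mult_left_mono frac_kernel_exp_bound) auto
    finally show ?thesis by (simp add: B_def algebra_simps)
  qed
  define G where "G = B q + \<bar>\<alpha>\<bar> * B q1 + \<bar>\<beta>\<bar> * B q2"
  have G: "G \<ge> 0" unfolding G_def using par B0 by (intro add_nonneg_nonneg mult_nonneg_nonneg) auto
  have v: "x t + \<alpha> * frac_int (q - q1) x t + \<beta> * frac_int (q - q2) x t + \<gamma> * frac_int q x t = H q t + \<alpha> * H q1 t + \<beta> * H q2 t"
    if "t > 0" for t
  proof -
    have "frac_int (q - q) x t = x t" by (simp add: frac_int_def)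
    thus ?thesis using sv[OF that] unfolding vt by (simp add: algebra_simps)
  qed
  have vb: "\<bar>x t + \<alpha> * frac_int (q - q1) x t + \<beta> * frac_int (q - q2) x t + \<gamma> * frac_int q x t\<bar> \<le> G * exp (3 * t)" if "t > 0" for t
  proof -
    have "\<bar>H q t + \<alpha> * H q1 t + \<beta> * H q2 t\<bar> \<le> \<bar>H q t\<bar> + \<bar>\<alpha>\<bar> * \<bar>H q1 t\<bar> + \<bar>\<beta>\<bar> * \<bar>H q2 t\<bar>"
      unfolding abs_mult[symmetric] by linarith
    also have "\<dots> \<le> B q * exp (3 * t) + \<bar>\<alpha>\<bar> * (B q1 * exp (3 * t)) + \<bar>\<beta>\<bar> * (B q2 * exp (3 * t))"
      using Hb[of q t] Hb[of q1 t] Hb[of q2 t] par that by (intro add_mono mult_left_mono) auto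
    finally show ?thesis unfolding v[OF that] by (simp add: G_def algebra_simps)
  qed
  obtain C \<sigma> where C: "\<sigma> \<ge> 3" "C \<ge> 0" "\<And>t. t \<ge> 0 \<Longrightarrow> \<bar>x t\<bar> \<le> C * exp (\<sigma> * t)"
    by (rule volterra_exponential_bound[OF rc _ _ _ G vb]) (use par in auto)
  have "laplace x s * (s powr q + \<alpha> * s powr q1 + \<beta> * s powr q2 + \<gamma>) =
       x 0 * (s powr (q - 1) + \<alpha> * s powr (q1 - 1) + \<beta> * s powr (q2 - 1)) +
       hderiv 1 x 0 * (slope_order q s + \<alpha> * slope_order q1 s + \<beta> * slope_order q2 s)" if s: "s > \<sigma>" for s
  proof -
    have s0: "s > 0" using C s by simp
    let ?L = "\<lambda>f t. indicator {0<..} t * f t * exp (- s * t)"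
    have ix: "integrable lborel (?L x)" using laplace_integrable[OF rc C(3) s] .
    have fi: "integrable lborel (?L (frac_int r x))" "(LINT t|lborel. ?L (frac_int r x) t) = s powr (- r) * laplace x s" if "r \<ge> 0" for r
      using frac_int_laplace[OF that s0 ix] by (auto simp: laplace_def)
    have LH: "has_bochner_integral lborel (?L (H r)) (x 0 * s powr (- (q - r + 1)) + e r * s powr (- (q - r + 2)))" if "r \<le> q" for r
    proof -
      have "?L (H r) = (\<lambda>t. x 0 * (frac_kernel (q - r + 1) t * exp (- s * t)) + e r * (frac_kernel (q - r + 2) t * exp (- s * t)))"
        by (auto simp: fun_eq_iff H_def indicator_def algebra_simps)
      moreover have "has_bochner_integral lborel (\<lambda>t. x 0 * (frac_kernel (q - r + 1) t * exp (- s * t)) + e r * (frac_kernel (q - r + 2) t * exp (- s * t)))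
          (x 0 * s powr (- (q - r + 1)) + e r * s powr (- (q - r + 2)))"
        using that s0 by (intro has_bochner_integral_add has_bochner_integral_mult_right frac_kernel_laplace) linarith+
      ultimately show ?thesis by (simp only:)
    qed
    note LH' = LH[THEN has_bochner_integral_integral_eq] LH[unfolded has_bochner_integral_iff, THEN conjunct1]
    have "(LINT t|lborel. ?L x t + \<alpha> * ?L (frac_int (q - q1) x) t + \<beta> * ?L (frac_int (q - q2) x) t + \<gamma> * ?L (frac_int q x) t)
       = (LINT t|lborel. ?L (H q) t + \<alpha> * ?L (H q1) t + \<beta> * ?L (H q2) t)"
    proof (rule Bochner_Integration.integral_cong)
      fix t :: real
      have "?L x t + \<alpha> * ?L (frac_int (q - q1) x) t + \<beta> * ?L (frac_int (q - q2) x) t + \<gamma> * ?L (frac_int q x) t =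
        indicator {0<..} t * (x t + \<alpha> * frac_int (q - q1) x t + \<beta> * frac_int (q - q2) x t + \<gamma> * frac_int q x t) * exp (- s * t)"
        by (simp add: algebra_simps)
      also have "\<dots> = indicator {0<..} t * (H q t + \<alpha> * H q1 t + \<beta> * H q2 t) * exp (- s * t)"
        using v[of t] by (auto simp: indicator_def)
      also have "\<dots> = ?L (H q) t + \<alpha> * ?L (H q1) t + \<beta> * ?L (H q2) t" by (simp add: algebra_simps)
      finally show "?L x t + \<alpha> * ?L (frac_int (q - q1) x) t + \<beta> * ?L (frac_int (q - q2) x) t + \<gamma> * ?L (frac_int q x) t =
         ?L (H q) t + \<alpha> * ?L (H q1) t + \<beta> * ?L (H q2) t" .
    qed simp
    also have "(LINT t|lborel. ?L x t + \<alpha> * ?L (frac_int (q - q1) x) t + \<beta> * ?L (frac_int (q - q2) x) t + \<gamma> * ?L (frac_int q x) t)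
       = laplace x s + \<alpha> * (s powr (- (q - q1)) * laplace x s) + \<beta> * (s powr (- (q - q2)) * laplace x s) + \<gamma> * (s powr (- q) * laplace x s)"
      using ix fi[of "q - q1"] fi[of "q - q2"] fi[of q] par by (simp add: laplace_def)
    also have "(LINT t|lborel. ?L (H q) t + \<alpha> * ?L (H q1) t + \<beta> * ?L (H q2) t) =
      (x 0 * s powr (- (q - q + 1)) + e q * s powr (- (q - q + 2))) +
      \<alpha> * (x 0 * s powr (- (q - q1 + 1)) + e q1 * s powr (- (q - q1 + 2))) +
      \<beta> * (x 0 * s powr (- (q - q2 + 1)) + e q2 * s powr (- (q - q2 + 2)))"
      using LH'[of q] LH'[of q1] LH'[of q2] par by simp
    finally have "s powr q * (laplace x s + \<alpha> * (s powr (- (q - q1)) * laplace x s) + \<beta> * (s powr (- (q - q2)) * laplace x s) + \<gamma> * (s powr (- q) * laplace x s)) =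
      s powr q * ((x 0 * s powr (- (q - q + 1)) + e q * s powr (- (q - q + 2))) +
      \<alpha> * (x 0 * s powr (- (q - q1 + 1)) + e q1 * s powr (- (q - q1 + 2))) +
      \<beta> * (x 0 * s powr (- (q - q2 + 1)) + e q2 * s powr (- (q - q2 + 2))))" by simp
    moreover have p: "s powr (- (q - r)) * s powr q = s powr r" "s powr (- (q - r + 1)) * s powr q = s powr (r - 1)"
       "s powr (- (q - r + 2)) * s powr q = s powr (r - 2)" "s powr (- q) * s powr q = 1" for r
      using s0 by (simp_all add: powr_add[symmetric])
    have "s powr q * (laplace x s + \<alpha> * (s powr (- (q - q1)) * laplace x s) + \<beta> * (s powr (- (q - q2)) * laplace x s) + \<gamma> * (s powr (- q) * laplace x s))
       = laplace x s * (s powr q + \<alpha> * (s powr (- (q - q1)) * s powr q) + \<beta> * (s powr (- (q - q2)) * s powr q) + \<gamma> * (s powr (- q) * s powr q))"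
      by algebra
    moreover have "s powr q * ((x 0 * s powr (- (q - q + 1)) + e q * s powr (- (q - q + 2))) +
      \<alpha> * (x 0 * s powr (- (q - q1 + 1)) + e q1 * s powr (- (q - q1 + 2))) +
      \<beta> * (x 0 * s powr (- (q - q2 + 1)) + e q2 * s powr (- (q - q2 + 2)))) =
      x 0 * (s powr (- (q - q + 1)) * s powr q + \<alpha> * (s powr (- (q - q1 + 1)) * s powr q) + \<beta> * (s powr (- (q - q2 + 1)) * s powr q)) +
      (e q * (s powr (- (q - q + 2)) * s powr q) + \<alpha> * (e q1 * (s powr (- (q - q1 + 2)) * s powr q)) + \<beta> * (e q2 * (s powr (- (q - q2 + 2)) * s powr q)))"
      by algebra
    moreover have "e r * s powr (r - 2) = hderiv 1 x 0 * slope_order r s" for r by (simp add: e_def slope_order_def)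
    ultimately show ?thesis unfolding p by (simp add: distrib_left mult.left_commute)
  qed
  with C that show ?thesis by blast
qed

section \<open>Existence of a solution\<close>

text \<open>Euler's integral is restricted to [X + 1, X + 2], where t^(e - b) \<ge> X^(e - b), t^(b
  - 1) \<ge> 1 / (X + 2) and exp t \<le> exp(X + 2). The denominator does not depend on e, so Gamma
  outgrows every geometric progression.\<close>

lemma Gamma_lower_bound:
  fixes b e X :: real
  assumes "0 < b" "b \<le> e" "X > 0"
  shows "Gamma e \<ge> X powr (e - b) / ((X + 2) * exp (X + 2))"
proof -
  have I: "((\<lambda>t. t powr (e - 1) / exp t) has_integral Gamma e) {0..}"
    using assms by (intro Gamma_integral_real) auto
  have "((\<lambda>t. X powr (e - b) / ((X + 2) * exp (X + 2))) has_integral (X powr (e - b) / ((X + 2) * exp (X + 2))) * ((X + 2) - (X + 1))) {X + 1..X + 2}"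
    using has_integral_const_real[of "X powr (e - b) / ((X + 2) * exp (X + 2))" "X + 1" "X + 2"] by simp
  moreover have "(\<lambda>t. t powr (e - 1) / exp t) integrable_on {X + 1..X + 2}"
    using assms by (intro integrable_continuous_interval continuous_intros) auto
  moreover have "X powr (e - b) / ((X + 2) * exp (X + 2)) \<le> t powr (e - 1) / exp t" if "t \<in> {X + 1..X + 2}" for t
  proof -
    have t: "t \<ge> 1" "t \<ge> X" "t \<le> X + 2" using that assms by auto
    have "1 / (X + 2) \<le> 1 / t" using t assms by (intro divide_left_mono) auto
    also have "\<dots> \<le> t powr (b - 1)"
      using t assms powr_mono[of "-1" "b - 1" t] by (simp add: powr_minus_divide)
    finally have "X powr (e - b) * (1 / (X + 2)) \<le> t powr (e - b) * t powr (b - 1)"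
      using t assms by (intro mult_mono powr_mono2) auto
    hence "X powr (e - b) / (X + 2) \<le> t powr (e - 1)" using t by (simp add: powr_add[symmetric])
    hence "X powr (e - b) / (X + 2) / exp (X + 2) \<le> t powr (e - 1) / exp t"
      using t by (intro frac_le) auto
    thus ?thesis by simp
  qed
  ultimately have "X powr (e - b) / ((X + 2) * exp (X + 2)) * ((X + 2) - (X + 1)) \<le> integral {X + 1..X + 2} (\<lambda>t. t powr (e - 1) / exp t)"
    by (intro has_integral_le[OF _ integrable_integral])
  hence "X powr (e - b) / ((X + 2) * exp (X + 2)) \<le> integral {X + 1..X + 2} (\<lambda>t. t powr (e - 1) / exp t)"
    by simp
  also have "\<dots> \<le> integral {0..} (\<lambda>t. t powr (e - 1) / exp t)"
    using assms I \<open>(\<lambda>t. t powr (e - 1) / exp t) integrable_on {X + 1..X + 2}\<close>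
    by (intro integral_subset_le) auto
  also have "\<dots> = Gamma e" using I by (rule integral_unique)
  finally show ?thesis .
qed

text \<open>The lower bound for Gamma with X = s T: on (0, T] every unit of order beyond b gains a
  factor 1 / s, and s may be chosen freely.\<close>

lemma frac_kernel_geometric_bound:
  assumes "0 < b" "b \<le> e" "s > 0" "0 < t" "t \<le> T"
  shows "frac_kernel e t \<le> s powr (- (e - b)) * ((s * T + 2) * exp (s * T + 2) * t powr (b - 1))"
proof -
  define X where "X = s * T"
  have X: "X > 0" using assms by (simp add: X_def)
  define D where "D = (X + 2) * exp (X + 2)"
  have D: "D > 0" using X by (simp add: D_def)
  have "Gamma e > 0" using assms by auto
  have "X powr (e - b) \<le> D * Gamma e"
    using Gamma_lower_bound[OF assms(1,2) X] D unfolding D_def[symmetric] by (simp add: field_simps)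
  hence "(s * t) powr (e - b) \<le> D * Gamma e"
    using assms by (intro order.trans[OF powr_mono2 \<open>X powr (e - b) \<le> D * Gamma e\<close>]) (auto simp: X_def)
  hence "t powr (e - b) / Gamma e \<le> s powr (- (e - b)) * D"
    using assms \<open>Gamma e > 0\<close> unfolding powr_minus_divide[of s "e - b"] by (simp add: powr_mult field_simps)
  hence "t powr (e - b) / Gamma e * t powr (b - 1) \<le> s powr (- (e - b)) * D * t powr (b - 1)"
    by (intro mult_right_mono) auto
  moreover have "t powr (e - b) / Gamma e * t powr (b - 1) = frac_kernel e t"
    using assms by (simp add: frac_kernel_def powr_add[symmetric])
  ultimately show ?thesis by (simp add: D_def X_def mult_ac)
qed

lemma loc_integrable_add:
  assumes "loc_integrable f" "loc_integrable g"
  shows "loc_integrable (\<lambda>t. f t + g t)"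
proof -
  have "(\<lambda>t. indicat_real {0<..} t * f t + indicat_real {0<..} t * g t) \<in> borel_measurable borel"
    "integrable lborel (\<lambda>t. indicat_real {0<..T} t * f t + indicat_real {0<..T} t * g t)" for T
    using assms by (auto simp: loc_integrable_def)
  thus ?thesis by (simp add: loc_integrable_def distrib_left)
qed

lemma loc_integrable_cmult:
  assumes "loc_integrable f"
  shows "loc_integrable (\<lambda>t. c * f t)"
proof -
  have "(\<lambda>t. c * (indicat_real {0<..} t * f t)) \<in> borel_measurable borel"
    "integrable lborel (\<lambda>t. c * (indicat_real {0<..T} t * f t))" for T
    using assms by (auto simp: loc_integrable_def)
  thus ?thesis by (simp add: loc_integrable_def mult.left_commute)
qed

lemma frac_int_cmult: "frac_int a (\<lambda>t. c * f t) t = c * frac_int a f t"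
proof -
  have "(LINT \<tau>|lborel. c * (indicator {0<..} \<tau> * f \<tau> * frac_kernel a (t - \<tau>))) = c * (LINT \<tau>|lborel. indicator {0<..} \<tau> * f \<tau> * frac_kernel a (t - \<tau>))"
    by (rule integral_mult_right_zero)
  thus ?thesis by (simp add: frac_int_def mult_ac)
qed

lemma frac_int_add:
  assumes "loc_integrable f" "continuous_on {0<..} f" "loc_integrable g" "continuous_on {0<..} g" "a \<ge> 0" "t > 0"
  shows "frac_int a (\<lambda>t. f t + g t) t = frac_int a f t + frac_int a g t"
proof (cases "a = 0")
  case False
  thus ?thesis using frac_int_integrable[of f a t] frac_int_integrable[of g a t] assms
    by (simp add: frac_int_def distrib_left distrib_right)
qed (simp add: frac_int_def)

lemma frac_int_lincomb:
  assumes "loc_integrable f1" "continuous_on {0<..} f1" "loc_integrable f2" "continuous_on {0<..} f2"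
    "loc_integrable f3" "continuous_on {0<..} f3" "a \<ge> 0" "t > 0"
  shows "frac_int a (\<lambda>t. x * f1 t + y * f2 t + z * f3 t) t = x * frac_int a f1 t + y * frac_int a f2 t + z * frac_int a f3 t"
proof -
  have r: "loc_integrable (\<lambda>t. x * f1 t)" "loc_integrable (\<lambda>t. y * f2 t)" "loc_integrable (\<lambda>t. z * f3 t)"
    "continuous_on {0<..} (\<lambda>t. x * f1 t)" "continuous_on {0<..} (\<lambda>t. y * f2 t)" "continuous_on {0<..} (\<lambda>t. z * f3 t)"
    by (intro loc_integrable_cmult continuous_intros assms)+
  have "frac_int a (\<lambda>t. (x * f1 t + y * f2 t) + z * f3 t) t = frac_int a (\<lambda>t. x * f1 t + y * f2 t) t + frac_int a (\<lambda>t. z * f3 t) t"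
    by (intro frac_int_add loc_integrable_add continuous_on_add r assms)
  also have "frac_int a (\<lambda>t. x * f1 t + y * f2 t) t = frac_int a (\<lambda>t. x * f1 t) t + frac_int a (\<lambda>t. y * f2 t) t"
    by (intro frac_int_add r assms)
  finally show ?thesis by (simp only: frac_int_cmult)
qed

lemma continuous_on_frac_kernel: "b > 0 \<Longrightarrow> continuous_on {0<..} (frac_kernel b)"
  unfolding frac_kernel_def
  by (rule continuous_on_eq[of _ "\<lambda>t. t powr (b - 1) / Gamma b"])
     (auto intro!: continuous_intros simp: Gamma_eq_zero_iff nonpos_Ints_def)

lemma frac_kernel_has_derivative:
  assumes "b > 1" "t > 0"
  shows "(frac_kernel b has_real_derivative frac_kernel (b - 1) t) (at t)"
proof -
  have "b - 1 \<notin> \<int>\<^sub>\<le>\<^sub>0" using assms nonpos_Ints_nonpos[of "b - 1"] by linarith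
  hence "Gamma b = (b - 1) * Gamma (b - 1)" using Gamma_plus1[of "b - 1"] by simp
  moreover have "Gamma (b - 1) > 0" using assms by auto
  moreover have "((\<lambda>t. t powr (b - 1) / Gamma b) has_real_derivative ((b - 1) * t powr (b - 1 - 1)) / Gamma b) (at t)"
    using assms by (intro DERIV_cdivide has_real_derivative_powr)
  ultimately have "((\<lambda>t. t powr (b - 1) / Gamma b) has_real_derivative frac_kernel (b - 1) t) (at t)"
    using assms by (simp add: frac_kernel_def)
  thus ?thesis
    by (rule has_field_derivative_transform_within_open[of _ _ _ "{0<..}"]) (use assms in \<open>auto simp: frac_kernel_def\<close>)
qed

section \<open>The Neumann series of the Volterra equation and its regularity\<close>

context
  fixes c1 c2 c3 a1 a2 a3 :: real
  assumes a: "a1 > 0" "a2 > 0" "a3 > 0"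
begin

text \<open>All terms of the Neumann series are explicit, because fractional integration only raises the
  order of a kernel.\<close>

primrec neumann_term :: "nat \<Rightarrow> real \<Rightarrow> real \<Rightarrow> real" where
  "neumann_term 0 b = frac_kernel b"
| "neumann_term (Suc m) b = (\<lambda>t. - c1 * neumann_term m (b + a1) t + (- c2) * neumann_term m (b + a2) t + (- c3) * neumann_term m (b + a3) t)"

text \<open>Formally the function with Laplace transform s^-b / (1 + c1 s^-a1 + c2 s^-a2 + c3
  s^-a3), a power of t times a multivariate Mittag-Leffler function.\<close>

definition neumann_sum :: "real \<Rightarrow> real \<Rightarrow> real" where
  "neumann_sum b t = (\<Sum>m. neumann_term m b t)"

lemma neumann_term_nonpos: "t \<le> 0 \<Longrightarrow> neumann_term m b t = 0"
  by (induction m arbitrary: b) auto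

lemma neumann_term_regular: "b > 0 \<Longrightarrow> loc_integrable (neumann_term m b) \<and> continuous_on {0<..} (neumann_term m b)"
proof (induction m arbitrary: b)
  case (Suc m)
  have p: "b + a1 > 0" "b + a2 > 0" "b + a3 > 0" using Suc.prems a by auto
  note r = Suc.IH[OF p(1)] Suc.IH[OF p(2)] Suc.IH[OF p(3)]
  note r' = r[THEN conjunct1] r[THEN conjunct2]
  show ?case unfolding neumann_term.simps
    by (intro conjI loc_integrable_add loc_integrable_cmult continuous_intros r')
qed (auto intro: frac_kernel_loc_integrable continuous_on_frac_kernel)

lemma frac_int_neumann_term:
  assumes "b > 0" "c \<ge> 0" "t > 0"
  shows "frac_int c (neumann_term m b) t = neumann_term m (b + c) t"
  using assms(1)
proof (induction m arbitrary: b)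
  case 0
  thus ?case using frac_int_frac_kernel[of c b t] assms by (simp add: add.commute)
next
  case (Suc m)
  have p: "b + a1 > 0" "b + a2 > 0" "b + a3 > 0" using Suc.prems a by auto
  note r = neumann_term_regular[OF p(1)] neumann_term_regular[OF p(2)] neumann_term_regular[OF p(3)]
  note r' = r[THEN conjunct1] r[THEN conjunct2]
  show ?case unfolding neumann_term.simps
    by (subst frac_int_lincomb) (use Suc.IH[OF p(1)] Suc.IH[OF p(2)] Suc.IH[OF p(3)] r' assms in \<open>simp_all add: add_ac\<close>)
qed

text \<open>Each recursion step multiplies the bound by the sum of the |ci| s^-ai, which is below
  1/2 once s is large. The factor t^(b - 1) keeps the behaviour at 0 that integrability and initial
  values depend on.\<close>

lemma neumann_term_bound:
  assumes "b > 0" "T > 0"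
  shows "\<exists>C\<ge>0. \<forall>m t. 0 < t \<longrightarrow> t \<le> T \<longrightarrow> \<bar>neumann_term m b t\<bar> \<le> (1/2) ^ m * (C * t powr (b - 1))"
proof -
  have "((\<lambda>s. \<bar>c1\<bar> * s powr (- a1) + \<bar>c2\<bar> * s powr (- a2) + \<bar>c3\<bar> * s powr (- a3)) \<longlongrightarrow> \<bar>c1\<bar> * 0 + \<bar>c2\<bar> * 0 + \<bar>c3\<bar> * 0) at_top"
    using a by (intro tendsto_intros tendsto_neg_powr filterlim_ident) auto
  hence "eventually (\<lambda>s. \<bar>c1\<bar> * s powr (- a1) + \<bar>c2\<bar> * s powr (- a2) + \<bar>c3\<bar> * s powr (- a3) < 1/2 \<and> s \<ge> 1) at_top"
    by (intro eventually_conj eventually_ge_at_top order_tendstoD) auto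
  then obtain s where s: "\<bar>c1\<bar> * s powr (- a1) + \<bar>c2\<bar> * s powr (- a2) + \<bar>c3\<bar> * s powr (- a3) < 1/2" "s \<ge> 1"
    by (auto simp: eventually_at_top_linorder)
  define C where "C = (s * T + 2) * exp (s * T + 2)"
  have C: "C \<ge> 0" using s assms by (simp add: C_def)
  \<comment> \<open>The recursion raises the order, so the induction covers all orders e \<ge> b at
    once; the power of s records how far e lies above b.\<close>
  have *: "\<bar>neumann_term m e t\<bar> \<le> (1/2) ^ m * (s powr (- (e - b)) * (C * t powr (b - 1)))"
    if "b \<le> e" "0 < t" "t \<le> T" for m e t
    using that(1)
  proof (induction m arbitrary: e)
    case 0
    thus ?case using frac_kernel_geometric_bound[of b e s t T] assms that s by (simp add: C_def)
  next
    case (Suc m)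
    let ?B = "(1/2) ^ m * (s powr (- (e - b)) * (C * t powr (b - 1)))"
    have B0: "?B \<ge> 0" using C by simp
    have p: "\<bar>neumann_term m (e + x) t\<bar> \<le> s powr (- x) * ?B" if "x > 0" for x
    proof -
      have "s powr (- (e + x - b)) = s powr (- x) * s powr (- (e - b))"
        by (simp add: powr_add[symmetric] algebra_simps)
      thus ?thesis using Suc.IH[of "e + x"] Suc.prems that by (simp add: mult_ac)
    qed
    have "\<bar>neumann_term (Suc m) e t\<bar> \<le> \<bar>c1\<bar> * \<bar>neumann_term m (e + a1) t\<bar> + \<bar>c2\<bar> * \<bar>neumann_term m (e + a2) t\<bar> + \<bar>c3\<bar> * \<bar>neumann_term m (e + a3) t\<bar>"
      unfolding abs_mult[symmetric] by simp
    also have "\<dots> \<le> \<bar>c1\<bar> * (s powr (- a1) * ?B) + \<bar>c2\<bar> * (s powr (- a2) * ?B) + \<bar>c3\<bar> * (s powr (- a3) * ?B)"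
      using a by (intro add_mono mult_left_mono p) auto
    also have "\<dots> = (\<bar>c1\<bar> * s powr (- a1) + \<bar>c2\<bar> * s powr (- a2) + \<bar>c3\<bar> * s powr (- a3)) * ?B"
      by (simp only: distrib_right mult.assoc)
    also have "\<dots> \<le> (1/2) * ?B" using s B0 by (intro mult_right_mono) auto
    finally show ?case by simp
  qed
  show ?thesis
  proof (intro exI[of _ C] conjI allI impI)
    show "\<bar>neumann_term m b t\<bar> \<le> (1/2) ^ m * (C * t powr (b - 1))" if "0 < t" "t \<le> T" for m t
      using *[of b t m] that s by simp
  qed (rule C)
qed

lemma neumann_summable:
  assumes "b > 0"
  shows "summable (\<lambda>m. neumann_term m b t)"
proof (cases "t > 0")
  case True
  obtain C where C': "C \<ge> 0" "\<forall>m s. 0 < s \<longrightarrow> s \<le> t \<longrightarrow> \<bar>neumann_term m b s\<bar> \<le> (1/2) ^ m * (C * s powr (b - 1))"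
    using neumann_term_bound[OF assms True] by blast
  note C = C'(1) C'(2)[rule_format]
  show ?thesis
    by (rule summable_comparison_test'[of "\<lambda>m. (1/2) ^ m * (C * t powr (b - 1))" 0])
       (use C True in \<open>auto intro!: summable_mult2\<close>)
qed (simp add: neumann_term_nonpos)

lemma neumann_sum_nonpos: "t \<le> 0 \<Longrightarrow> neumann_sum b t = 0"
  by (simp add: neumann_sum_def neumann_term_nonpos)

text \<open>The resolvent equation: split off the first term and sum the recursion.\<close>

lemma neumann_sum_unfold:
  assumes "b > 0"
  shows "neumann_sum b t = frac_kernel b t - c1 * neumann_sum (b + a1) t - c2 * neumann_sum (b + a2) t - c3 * neumann_sum (b + a3) t"
proof -
  have p: "b + a1 > 0" "b + a2 > 0" "b + a3 > 0" using assms a by auto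
  note s = neumann_summable[OF p(1), of t] neumann_summable[OF p(2), of t] neumann_summable[OF p(3), of t]
  have "neumann_sum b t = neumann_term 0 b t + (\<Sum>m. neumann_term (Suc m) b t)"
    unfolding neumann_sum_def using suminf_split_head[OF neumann_summable[OF assms, of t]] by simp
  also have "(\<Sum>m. neumann_term (Suc m) b t) = - c1 * neumann_sum (b + a1) t + (- c2) * neumann_sum (b + a2) t + (- c3) * neumann_sum (b + a3) t"
    unfolding neumann_sum_def neumann_term.simps
    by (simp only: suminf_add[symmetric] suminf_mult summable_add summable_mult s)
  finally show ?thesis by simp
qed

lemma neumann_sum_bound:
  assumes "b > 0" "T > 0"
  shows "\<exists>C\<ge>0. \<forall>t. 0 < t \<longrightarrow> t \<le> T \<longrightarrow> \<bar>neumann_sum b t\<bar> \<le> C * t powr (b - 1)"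
proof -
  obtain C where C': "C \<ge> 0" "\<forall>m t. 0 < t \<longrightarrow> t \<le> T \<longrightarrow> \<bar>neumann_term m b t\<bar> \<le> (1/2) ^ m * (C * t powr (b - 1))"
    using neumann_term_bound[OF assms] by blast
  note C = C'(1) C'(2)[rule_format]
  have "\<bar>neumann_sum b t\<bar> \<le> 2 * C * t powr (b - 1)" if "0 < t" "t \<le> T" for t
  proof -
    have g: "(\<lambda>m. (1/2::real) ^ m * (C * t powr (b - 1))) sums (2 * (C * t powr (b - 1)))"
      using geometric_sums[of "1/2::real"] by (intro sums_mult2) simp
    have "norm (neumann_sum b t) \<le> (\<Sum>m. (1/2::real) ^ m * (C * t powr (b - 1)))"
      unfolding neumann_sum_def
      by (rule norm_suminf_le) (use C that g in \<open>auto simp: sums_iff\<close>)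
    thus ?thesis using g by (simp add: sums_iff)
  qed
  thus ?thesis using C by (intro exI[of _ "2 * C"]) auto
qed

text \<open>The interval stays away from 0 because for b < 1 the terms are unbounded there.\<close>

lemma neumann_uniform_limit:
  assumes "b > 0" "0 < d" "d \<le> T"
  shows "uniform_limit {d..T} (\<lambda>n t. \<Sum>m<n. neumann_term m b t) (neumann_sum b) sequentially"
proof -
  obtain C where C': "C \<ge> 0" "\<forall>m t. 0 < t \<longrightarrow> t \<le> T \<longrightarrow> \<bar>neumann_term m b t\<bar> \<le> (1/2) ^ m * (C * t powr (b - 1))"
    using neumann_term_bound[OF assms(1) order.strict_trans2[OF assms(2,3)]] by blast
  note C = C'(1) C'(2)[rule_format]
  define D where "D = max (d powr (b - 1)) (T powr (b - 1))"
  have D: "t powr (b - 1) \<le> D" if "t \<in> {d..T}" for t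
  proof (cases "b \<ge> 1")
    case True
    thus ?thesis using that assms powr_mono2[of "b - 1" t T] by (simp add: D_def le_max_iff_disj)
  next
    case False
    thus ?thesis using that assms powr_mono2'[of "b - 1" d t] by (simp add: D_def le_max_iff_disj)
  qed
  have "uniform_limit {d..T} (\<lambda>n t. \<Sum>m<n. neumann_term m b t) (\<lambda>t. \<Sum>m. neumann_term m b t) sequentially"
  proof (rule Weierstrass_m_test)
    show "norm (neumann_term m b t) \<le> (1/2) ^ m * (C * D)" if "t \<in> {d..T}" for m t
    proof -
      have "norm (neumann_term m b t) \<le> (1/2) ^ m * (C * t powr (b - 1))" using C that assms by auto
      also have "\<dots> \<le> (1/2) ^ m * (C * D)" using C D[OF that] by (intro mult_left_mono) auto
      finally show ?thesis .
    qed
    show "summable (\<lambda>m. (1/2::real) ^ m * (C * D))" by (intro summable_mult2) simp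
  qed
  thus ?thesis by (simp add: neumann_sum_def[abs_def])
qed

lemma neumann_sum_continuous:
  assumes "b > 0"
  shows "continuous_on {0<..} (neumann_sum b)"
proof (rule continuous_at_imp_continuous_on, rule ballI)
  fix t :: real assume "t \<in> {0<..}"
  hence t: "t > 0" by simp
  have "continuous_on {t/2..2*t} (neumann_sum b)"
  proof (rule uniform_limit_theorem)
    show "uniform_limit {t/2..2*t} (\<lambda>n t. \<Sum>m<n. neumann_term m b t) (neumann_sum b) sequentially"
      using t assms by (intro neumann_uniform_limit) auto
    show "\<forall>\<^sub>F n in sequentially. continuous_on {t/2..2*t} (\<lambda>t. \<Sum>m<n. neumann_term m b t)"
      using t by (intro always_eventually allI continuous_on_sum
        continuous_on_subset[OF conjunct2[OF neumann_term_regular[OF assms]]]) auto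
  qed auto
  hence "continuous_on {t/2<..<2*t} (neumann_sum b)" by (rule continuous_on_subset) auto
  thus "isCont (neumann_sum b) t"
    using t by (subst (asm) continuous_on_eq_continuous_at) auto
qed

text \<open>Termwise differentiation: differentiating a kernel lowers its order by 1, and the series
  of order b - 1 > 0 converges uniformly near t.\<close>

lemma neumann_sum_has_derivative:
  assumes "b > 1" "t > 0"
  shows "(neumann_sum b has_real_derivative neumann_sum (b - 1) t) (at t)"
proof -
  have d: "(neumann_term m b has_real_derivative neumann_term m (b - 1) t) (at t)" if "t > 0" "b > 1" for m t b
    using that(2)
  proof (induction m arbitrary: b)
    case 0
    thus ?case using frac_kernel_has_derivative that by simp
  next
    case (Suc m)
    have "(neumann_term m (b + x) has_real_derivative neumann_term m (b - 1 + x) t) (at t)" if "x > 0" for x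
      using Suc.IH[of "b + x"] Suc.prems that by (simp add: algebra_simps)
    from this[OF a(1)] this[OF a(2)] this[OF a(3)] show ?case
      unfolding neumann_term.simps by (intro DERIV_add DERIV_cmult)
  qed
  have "\<exists>g. \<forall>x\<in>{t/2..2*t}. (\<lambda>m. neumann_term m b x) sums g x \<and> (g has_field_derivative neumann_sum (b - 1) x) (at x within {t/2..2*t})"
  proof (rule has_field_derivative_series)
    show "uniform_limit {t/2..2*t} (\<lambda>n t. \<Sum>m<n. neumann_term m (b - 1) t) (neumann_sum (b - 1)) sequentially"
      using assms by (intro neumann_uniform_limit) auto
    show "(neumann_term m b has_real_derivative neumann_term m (b - 1) x) (at x within {t/2..2*t})" if "x \<in> {t/2..2*t}" for m x
      using d[of x b m] that assms by (auto intro: has_field_derivative_at_within)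
    show "summable (\<lambda>m. neumann_term m b t)" using assms by (intro neumann_summable) auto
  qed (use assms in auto)
  then obtain g where g: "\<And>x. x \<in> {t/2..2*t} \<Longrightarrow> (\<lambda>m. neumann_term m b x) sums g x"
    "\<And>x. x \<in> {t/2..2*t} \<Longrightarrow> (g has_field_derivative neumann_sum (b - 1) x) (at x within {t/2..2*t})" by blast
  have "g x = neumann_sum b x" if "x \<in> {t/2..2*t}" for x using g(1)[OF that] by (simp add: neumann_sum_def sums_iff)
  hence "(neumann_sum b has_field_derivative neumann_sum (b - 1) t) (at t within {t/2..2*t})"
    using g(2)[of t] assms by (intro has_field_derivative_transform_within[OF g(2), of t 1]) auto
  moreover have "at t within {t/2..2*t} = at t" using assms by (intro at_within_interior) auto
  ultimately show ?thesis by simp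
qed

text \<open>On (0, T] the sum is dominated by a multiple of the integrable kernel of the same
  order.\<close>

lemma neumann_sum_loc_integrable:
  assumes "b > 0"
  shows "loc_integrable (neumann_sum b)"
proof -
  have m [measurable]: "(\<lambda>t. indicator {0<..} t * neumann_sum b t) \<in> borel_measurable borel"
    using borel_measurable_continuous_on_indicator[OF _ neumann_sum_continuous[OF assms]] by simp
  have "integrable lborel (\<lambda>t. indicator {0<..T} t * neumann_sum b t)" for T
  proof -
    obtain C where C: "C \<ge> 0" "\<And>t. 0 < t \<Longrightarrow> t \<le> max T 1 \<Longrightarrow> \<bar>neumann_sum b t\<bar> \<le> C * t powr (b - 1)"
    proof -
      have "max T 1 > 0" by simp
      from neumann_sum_bound[OF assms this] show ?thesis using that by blast
    qed
    have "Gamma b > 0" using assms by auto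
    show ?thesis
    proof (rule Bochner_Integration.integrable_bound)
      show "integrable lborel (\<lambda>t. C * Gamma b * (indicator {0<..T} t * frac_kernel b t))"
        using frac_kernel_loc_integrable[OF assms] by (intro integrable_mult_right) (auto simp: loc_integrable_def)
      have "(\<lambda>t. indicator {0<..T} t * (indicator {0<..} t * neumann_sum b t)) \<in> borel_measurable lborel" by measurable
      thus "(\<lambda>t. indicator {0<..T} t * neumann_sum b t) \<in> borel_measurable lborel"
        by (rule back_subst[of "\<lambda>g. g \<in> borel_measurable lborel"]) (auto simp: indicator_def)
      show "AE t in lborel. norm (indicator {0<..T} t * neumann_sum b t) \<le> norm (C * Gamma b * (indicator {0<..T} t * frac_kernel b t))"
      proof (rule AE_I2)
        fix t
        show "norm (indicator {0<..T} t * neumann_sum b t) \<le> norm (C * Gamma b * (indicator {0<..T} t * frac_kernel b t))"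
        proof (cases "t \<in> {0<..T}")
          case True
          hence "C * Gamma b * frac_kernel b t = C * t powr (b - 1)" using \<open>Gamma b > 0\<close> by (simp add: frac_kernel_def)
          moreover have "\<bar>neumann_sum b t\<bar> \<le> C * t powr (b - 1)" using True by (intro C(2)) auto
          ultimately have "\<bar>neumann_sum b t\<bar> \<le> \<bar>C * Gamma b * frac_kernel b t\<bar>" by linarith
          thus ?thesis using True by simp
        qed simp
      qed
    qed
  qed
  thus ?thesis using m by (simp add: loc_integrable_def)
qed

text \<open>Termwise integration. The majorants are geometric multiples of a product of two kernels,
  whose integral is known from their convolution.\<close>

lemma frac_int_neumann_sum:
  assumes "b > 0" "c \<ge> 0" "t > 0"
  shows "frac_int c (neumann_sum b) t = neumann_sum (b + c) t"
proof (cases "c = 0")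
  case True
  thus ?thesis by (simp add: frac_int_def)
next
  case False
  hence c: "c > 0" using assms by simp
  obtain C where C': "C \<ge> 0" "\<forall>m s. 0 < s \<longrightarrow> s \<le> t \<longrightarrow> \<bar>neumann_term m b s\<bar> \<le> (1/2) ^ m * (C * s powr (b - 1))"
    using neumann_term_bound[OF assms(1,3)] by blast
  note C = C'(1) C'(2)[rule_format]
  let ?f = "\<lambda>m \<tau>. indicator {0<..} \<tau> * neumann_term m b \<tau> * frac_kernel c (t - \<tau>)"
  have Gb: "Gamma b > 0" using assms by auto
  have int: "integrable lborel (?f m)" for m
    using neumann_term_regular[OF assms(1), of m] c assms by (intro frac_int_integrable) auto
  have fb: "norm (?f m \<tau>) \<le> (1/2) ^ m * (C * Gamma b * (frac_kernel b (\<tau> - 0) * frac_kernel c (t - \<tau>)))" for m \<tau>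
  proof (cases "0 < \<tau> \<and> \<tau> < t")
    case True
    have "norm (?f m \<tau>) = \<bar>neumann_term m b \<tau>\<bar> * frac_kernel c (t - \<tau>)" using True c by (simp add: abs_mult)
    also have "\<dots> \<le> (1/2) ^ m * (C * \<tau> powr (b - 1)) * frac_kernel c (t - \<tau>)"
      using C(2)[of \<tau> m] True c by (intro mult_right_mono) auto
    also have "\<tau> powr (b - 1) = Gamma b * frac_kernel b (\<tau> - 0)" using True Gb by (simp add: frac_kernel_def)
    finally show ?thesis by (simp add: mult_ac)
  next
    case F: False
    hence z: "?f m \<tau> = 0" by (auto simp: indicator_def not_less)
    moreover have "(1/2) ^ m * (C * Gamma b * (frac_kernel b (\<tau> - 0) * frac_kernel c (t - \<tau>))) \<ge> 0"
      using C c assms Gb by (intro mult_nonneg_nonneg) auto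
    ultimately show ?thesis by (simp only: z norm_zero)
  qed
  have "(LINT \<tau>|lborel. (\<Sum>m. ?f m \<tau>)) = (\<Sum>m. LINT \<tau>|lborel. ?f m \<tau>)"
  proof (rule integral_suminf[OF int])
    show "AE \<tau> in lborel. summable (\<lambda>m. norm (?f m \<tau>))"
    proof (rule AE_I2)
      fix \<tau>
      show "summable (\<lambda>m. norm (?f m \<tau>))"
        by (rule summable_comparison_test'[of "\<lambda>m. (1/2) ^ m * (C * Gamma b * (frac_kernel b (\<tau> - 0) * frac_kernel c (t - \<tau>)))" 0])
           (use fb in \<open>auto intro!: summable_mult2\<close>)
    qed
    show "summable (\<lambda>m. LINT \<tau>|lborel. norm (?f m \<tau>))"
    proof (rule summable_comparison_test'[of "\<lambda>m. (1/2) ^ m * (C * Gamma b * frac_kernel (c + b) (t - 0))" 0])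
      show "summable (\<lambda>m. (1/2::real) ^ m * (C * Gamma b * frac_kernel (c + b) (t - 0)))" by (intro summable_mult2) simp
      fix m :: nat
      have kc: "has_bochner_integral lborel (\<lambda>\<tau>. (1/2) ^ m * (C * Gamma b * (frac_kernel b (\<tau> - 0) * frac_kernel c (t - \<tau>))))
          ((1/2) ^ m * (C * Gamma b * frac_kernel (c + b) (t - 0)))"
        by (intro has_bochner_integral_mult_right frac_kernel_convolution c assms)
      have "(LINT \<tau>|lborel. norm (?f m \<tau>)) \<le> (LINT \<tau>|lborel. (1/2) ^ m * (C * Gamma b * (frac_kernel b (\<tau> - 0) * frac_kernel c (t - \<tau>))))"
        using int kc fb by (intro integral_mono) (auto simp: has_bochner_integral_iff)
      also have "\<dots> = (1/2) ^ m * (C * Gamma b * frac_kernel (c + b) (t - 0))"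
        using kc by (rule has_bochner_integral_integral_eq)
      finally show "norm (LINT \<tau>|lborel. norm (?f m \<tau>)) \<le> (1/2) ^ m * (C * Gamma b * frac_kernel (c + b) (t - 0))"
        by simp
    qed
  qed
  moreover have "(\<Sum>m. ?f m \<tau>) = indicator {0<..} \<tau> * neumann_sum b \<tau> * frac_kernel c (t - \<tau>)" for \<tau>
    unfolding neumann_sum_def using neumann_summable[OF assms(1), of \<tau>]
    by (simp add: suminf_mult suminf_mult2[symmetric] summable_mult)
  moreover have "(LINT \<tau>|lborel. ?f m \<tau>) = neumann_term m (b + c) t" for m
    using frac_int_neumann_term[OF assms, of m] c by (simp add: frac_int_def)
  ultimately show ?thesis using c by (simp add: frac_int_def neumann_sum_def)
qed

lemma neumann_sum_continuous_closed:
  assumes "b > 1"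
  shows "continuous_on {0..} (neumann_sum b)"
proof (rule continuous_on_eq_continuous_within[THEN iffD2], rule ballI)
  fix t :: real assume "t \<in> {0..}"
  hence "t > 0 \<or> t = 0" by auto
  thus "continuous (at t within {0..}) (neumann_sum b)"
  proof
    assume t: "t > 0"
    have "continuous_on {0<..} (neumann_sum b)" using assms by (intro neumann_sum_continuous) simp
    hence "isCont (neumann_sum b) t" using t by (simp add: continuous_on_eq_continuous_at)
    thus ?thesis by (rule continuous_at_imp_continuous_at_within)
  next
    assume t: "t = 0"
    obtain C where C: "C \<ge> 0" "\<forall>t. 0 < t \<longrightarrow> t \<le> 1 \<longrightarrow> \<bar>neumann_sum b t\<bar> \<le> C * t powr (b - 1)"
      using neumann_sum_bound[of b 1] assms by auto
    have "((\<lambda>t. C * t powr (b - 1)) \<longlongrightarrow> C * 0 powr (b - 1)) (at 0 within {0..})"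
      using assms by (intro tendsto_intros tendsto_powr') (auto simp: eventually_at_filter)
    hence "((\<lambda>t. C * t powr (b - 1)) \<longlongrightarrow> 0) (at 0 within {0..})" by simp
    moreover have "\<forall>\<^sub>F t in at 0 within {0..}. norm (neumann_sum b t) \<le> C * t powr (b - 1)"
      unfolding eventually_at using C by (intro exI[of _ 1]) (auto simp: dist_real_def)
    ultimately have "(neumann_sum b \<longlongrightarrow> 0) (at 0 within {0..})"
      by (metis Lim_null_comparison)
    thus ?thesis by (simp add: t continuous_within neumann_sum_nonpos)
  qed
qed

text \<open>The difference quotient at 0 is O(t^(b - 2)). This supplies the zero initial slope of
  the explicit solution.\<close>

lemma neumann_sum_has_derivative_0:
  assumes "b > 2"
  shows "(neumann_sum b has_real_derivative 0) (at 0 within {0..})"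
proof -
  obtain C where C: "C \<ge> 0" "\<forall>t. 0 < t \<longrightarrow> t \<le> 1 \<longrightarrow> \<bar>neumann_sum b t\<bar> \<le> C * t powr (b - 1)"
    using neumann_sum_bound[of b 1] assms by auto
  have "((\<lambda>t. C * t powr (b - 2)) \<longlongrightarrow> C * 0 powr (b - 2)) (at 0 within {0..})"
    using assms by (intro tendsto_intros tendsto_powr') (auto simp: eventually_at_filter)
  hence "((\<lambda>t. C * t powr (b - 2)) \<longlongrightarrow> 0) (at 0 within {0..})" by simp
  moreover have "\<forall>\<^sub>F t in at 0 within {0..}. norm ((neumann_sum b t - neumann_sum b 0) / (t - 0)) \<le> C * t powr (b - 2)"
    unfolding eventually_at
  proof (intro exI[of _ 1] conjI ballI impI)
    fix t :: real assume t: "t \<in> {0..}" "t \<noteq> 0 \<and> dist t 0 < 1"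
    hence t0: "0 < t" "t \<le> 1" by (auto simp: dist_real_def)
    have "\<bar>neumann_sum b t\<bar> / t \<le> C * t powr (b - 1) / t" using C t0 by (intro divide_right_mono) auto
    also have "\<dots> = C * t powr (b - 2)" using t0 powr_diff[of t "b - 1" 1] by simp
    finally show "norm ((neumann_sum b t - neumann_sum b 0) / (t - 0)) \<le> C * t powr (b - 2)"
      using t0 by (simp add: neumann_sum_nonpos)
  qed auto
  ultimately show ?thesis unfolding has_field_derivative_iff by (metis Lim_null_comparison)
qed

end

lemma hderiv_eq_at_pos:
  assumes "\<And>t. t > 0 \<Longrightarrow> hderiv k x t = f t" "(f has_vector_derivative D) (at t)" "t > 0"
  shows "hderiv (Suc k) x t = D" "(hderiv k x has_vector_derivative D) (at t)"
proof -
  show d: "(hderiv k x has_vector_derivative D) (at t)"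
    by (rule has_vector_derivative_transform_within_open[OF assms(2), of "{0<..}"]) (use assms in auto)
  thus "hderiv (Suc k) x t = D"
    by (intro hderiv_Suc_eqI) (use assms in \<open>auto simp: at_within_half_line\<close>)
qed

lemma absolutely_integrable_if_loc_integrable:
  assumes "loc_integrable f"
  shows "f absolutely_integrable_on {0..T}"
proof -
  have "set_integrable lborel {0<..T} f"
    using assms by (simp add: loc_integrable_def set_integrable_def)
  hence "f absolutely_integrable_on {0<..T}" unfolding set_integrable_def
    by (subst integrable_completion) auto
  moreover have "f absolutely_integrable_on {0<..T} \<longleftrightarrow> f absolutely_integrable_on {0..T}"
    by (rule absolutely_integrable_spike_set_eq) (auto intro: negligible_subset[of "{0}"])
  ultimately show ?thesis by simp
qed

section \<open>The explicit solution with value c and slope 0 at time 0\<close>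

context
  fixes \<alpha> \<beta> \<gamma> q1 q2 q :: real
  assumes par: "0 < q1" "q1 < q2" "q2 < q" "q \<le> 2"
begin

abbreviation (input) "nsum \<equiv> neumann_sum \<alpha> \<beta> \<gamma> (q - q1) (q - q2) q"

text \<open>Formally the transform of \<open>nsum (q + 1)\<close> is 1 / (s \<Delta>(s)), so this
  function has the transform c (\<Delta>(s) - \<gamma>) / (s \<Delta>(s)). Caputo derivatives
  annihilate the constant and act on the series only.\<close>

definition basic_solution :: "real \<Rightarrow> real \<Rightarrow> real" where
  "basic_solution c t = c * (1 - \<gamma> * nsum (q + 1) t)"

lemma order_gaps: "q - q1 > 0" "q - q2 > 0" "q > 0" using par by auto

lemma basic_solution_0: "basic_solution c 0 = c"
  by (simp add: basic_solution_def neumann_sum_nonpos[OF order_gaps])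

lemma nsum_vector_derivative:
  assumes "b > 1" "t > 0"
  shows "((\<lambda>t. - c * \<gamma> * nsum b t) has_vector_derivative - c * \<gamma> * nsum (b - 1) t) (at t)"
  using neumann_sum_has_derivative[OF order_gaps assms, of \<alpha> \<beta> \<gamma>]
  unfolding has_real_derivative_iff_has_vector_derivative[symmetric] by (intro DERIV_cmult)

lemma hderiv_1_basic:
  assumes "t > 0"
  shows "hderiv 1 (basic_solution c) t = - c * \<gamma> * nsum q t"
    and "(basic_solution c has_vector_derivative - c * \<gamma> * nsum q t) (at t)"
proof -
  have "((\<lambda>t. c + (- c * \<gamma> * nsum (q + 1) t)) has_vector_derivative 0 + - c * \<gamma> * nsum (q + 1 - 1) t) (at t)"
    using assms order_gaps by (intro has_vector_derivative_add has_vector_derivative_const nsum_vector_derivative) auto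
  also have "(\<lambda>t. c + (- c * \<gamma> * nsum (q + 1) t)) = basic_solution c"
    by (auto simp: fun_eq_iff basic_solution_def algebra_simps)
  finally show *: "(basic_solution c has_vector_derivative - c * \<gamma> * nsum q t) (at t)" by simp
  show "hderiv 1 (basic_solution c) t = - c * \<gamma> * nsum q t"
    using hderiv_eq_at_pos(1)[of 0 "basic_solution c" "basic_solution c", OF _ * assms] by (simp add: hderiv_0)
qed

text \<open>At 0 the one-sided derivative and \<open>nsum q\<close> both vanish, so one formula
  covers the closed half-line.\<close>

lemma basic_vector_derivative_closed:
  assumes "q > 1" "t \<ge> 0"
  shows "(basic_solution c has_vector_derivative - c * \<gamma> * nsum q t) (at t within {0..})"
proof (cases "t = 0")
  case True
  have "(nsum (q + 1) has_real_derivative 0) (at 0 within {0..})"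
    using assms by (intro neumann_sum_has_derivative_0[OF order_gaps]) auto
  hence "((\<lambda>t. c * (1 - \<gamma> * nsum (q + 1) t)) has_real_derivative 0) (at 0 within {0..})"
    by (auto intro!: derivative_eq_intros)
  hence "(basic_solution c has_real_derivative 0) (at 0 within {0..})"
    by (simp add: basic_solution_def[abs_def])
  moreover have "- c * \<gamma> * nsum q 0 = 0" by (simp add: neumann_sum_nonpos[OF order_gaps])
  ultimately show ?thesis using True by (simp only: has_real_derivative_iff_has_vector_derivative)
next
  case False
  hence "t > 0" using assms by simp
  thus ?thesis by (rule has_vector_derivative_at_within[OF hderiv_1_basic(2)])
qed

lemma hderiv_1_basic_closed:
  assumes "q > 1" "t \<ge> 0"
  shows "hderiv 1 (basic_solution c) t = - c * \<gamma> * nsum q t"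
  using hderiv_Suc_eqI[of 0 "basic_solution c", OF _ assms(2)] basic_vector_derivative_closed[OF assms]
  by (simp add: hderiv_0)

lemma hderiv_2_basic:
  assumes "q > 1" "t > 0"
  shows "hderiv 2 (basic_solution c) t = - c * \<gamma> * nsum (q - 1) t"
    and "(hderiv 1 (basic_solution c) has_vector_derivative - c * \<gamma> * nsum (q - 1) t) (at t)"
  using hderiv_eq_at_pos[of 1 "basic_solution c", OF hderiv_1_basic(1) nsum_vector_derivative[OF assms] assms(2)]
  by (simp_all add: numeral_2_eq_2)

lemma hderiv_basic:
  assumes "0 < r" "r \<le> q" "t > 0"
  shows "hderiv (nat \<lceil>r\<rceil>) (basic_solution c) t = - c * \<gamma> * nsum (q + 1 - real (nat \<lceil>r\<rceil>)) t"
proof (cases "r \<le> 1")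
  case True
  thus ?thesis using assms par hderiv_1_basic(1)[of t c] by (simp add: ceiling_order)
next
  case False
  thus ?thesis using assms par hderiv_2_basic(1)[of t c] by (simp add: ceiling_order)
qed

lemma order_pos: "0 < r \<Longrightarrow> r \<le> q \<Longrightarrow> q + 1 - real (nat \<lceil>r\<rceil>) > 0"
  using par by (auto simp: ceiling_order)

lemma caputo_regular_basic: "caputo_regular (nat \<lceil>q\<rceil>) (basic_solution c)"
proof -
  have y: "hderiv (nat \<lceil>q\<rceil>) (basic_solution c) t = - c * \<gamma> * nsum (q + 1 - real (nat \<lceil>q\<rceil>)) t" if "t > 0" for t
    using hderiv_basic[of q t c] that order_gaps by simp
  have p: "q + 1 - real (nat \<lceil>q\<rceil>) > 0" using order_pos[of q] order_gaps by simp
  have c1: "continuous_on {0<..} (hderiv (nat \<lceil>q\<rceil>) (basic_solution c))"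
    by (rule continuous_on_eq[of _ "\<lambda>t. - c * \<gamma> * nsum (q + 1 - real (nat \<lceil>q\<rceil>)) t"])
       (use y in \<open>auto intro!: continuous_intros neumann_sum_continuous[OF order_gaps p]\<close>)
  have c2: "hderiv (nat \<lceil>q\<rceil>) (basic_solution c) absolutely_integrable_on {0..T}" for T
  \<comment> \<open>The formula for the derivative is available for t > 0 only; the single point 0
    is negligible.\<close>
  proof (rule absolutely_integrable_spike[where S = "{0}" and f = "\<lambda>t. - c * \<gamma> * nsum (q + 1 - real (nat \<lceil>q\<rceil>)) t"])
    show "(\<lambda>t. - c * \<gamma> * nsum (q + 1 - real (nat \<lceil>q\<rceil>)) t) absolutely_integrable_on {0..T}"
      by (intro absolutely_integrable_if_loc_integrable loc_integrable_cmult neumann_sum_loc_integrable[OF order_gaps p])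
  qed (use y in auto)
  show ?thesis
  proof (cases "q \<le> 1")
    case True
    hence n: "nat \<lceil>q\<rceil> = 1" using par by (simp add: ceiling_order)
    have "continuous_on {0..} (basic_solution c)"
      unfolding basic_solution_def[abs_def] using order_gaps by (intro continuous_intros neumann_sum_continuous_closed[OF order_gaps]) auto
    moreover have "basic_solution c differentiable_on {0<..}"
      using hderiv_1_basic(2) unfolding differentiable_on_def
      by (metis greaterThan_iff differentiableI_vector differentiable_at_withinI)
    ultimately show ?thesis using c1 c2 unfolding caputo_regular_def n by (simp add: hderiv_0)
  next
    case False
    hence q1: "q > 1" by simp
    hence n: "nat \<lceil>q\<rceil> = 2" using par by (simp add: ceiling_order)
    have "basic_solution c differentiable_on {0..}"
      using basic_vector_derivative_closed[OF q1] unfolding differentiable_on_def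
      by (metis atLeast_iff differentiableI_vector)
    moreover have "continuous_on {0..} (hderiv 1 (basic_solution c))"
      by (rule continuous_on_eq[of _ "\<lambda>t. - c * \<gamma> * nsum q t"])
         (use hderiv_1_basic_closed[OF q1] in \<open>auto intro!: continuous_intros neumann_sum_continuous_closed[OF order_gaps q1]\<close>)
    moreover have "hderiv 1 (basic_solution c) differentiable_on {0<..}"
      using hderiv_2_basic(2)[OF q1] unfolding differentiable_on_def
      by (metis greaterThan_iff differentiableI_vector differentiable_at_withinI)
    ultimately show ?thesis using c1 c2 unfolding caputo_regular_def n by (auto simp: hderiv_0)
  qed
qed

text \<open>With m the ceiling of r, m derivatives lower the order of the series by m and
  integration of order m - r raises it again, a net loss of r.\<close>

lemma caputo_basic:
  assumes "0 < r" "r \<le> q" "t > 0"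
  shows "caputo r (basic_solution c) t = - c * \<gamma> * nsum (q + 1 - r) t"
proof -
  have "real (nat \<lceil>r\<rceil>) \<ge> r" using assms by linarith
  have "caputo r (basic_solution c) t = frac_int (real (nat \<lceil>r\<rceil>) - r) (hderiv (nat \<lceil>r\<rceil>) (basic_solution c)) t"
    using caputo_eq_frac_int[OF order_gaps(3) par(4) caputo_regular_basic assms] .
  also have "\<dots> = frac_int (real (nat \<lceil>r\<rceil>) - r) (\<lambda>t. (- c * \<gamma>) * nsum (q + 1 - real (nat \<lceil>r\<rceil>)) t) t"
    by (rule frac_int_cong) (use hderiv_basic assms in auto)
  also have "\<dots> = - c * \<gamma> * nsum (q + 1 - r) t"
    unfolding frac_int_cmult using \<open>real (nat \<lceil>r\<rceil>) \<ge> r\<close> assms order_pos[of r]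
    by (subst frac_int_neumann_sum[OF order_gaps]) (auto simp: algebra_simps)
  finally show ?thesis .
qed

lemma basic_solution_is_solution: "is_solution \<alpha> \<beta> \<gamma> q1 q2 q (basic_solution c)"
  unfolding is_solution_iff
proof (intro conjI allI impI caputo_regular_basic)
  fix t :: real assume t: "t > 0"
  \<comment> \<open>The Caputo derivative of order q leaves the series of order 1. The resolvent
    equation at this order is the differential equation, because the kernel of order 1 is the
    constant 1 that accompanies the series in \<open>basic_solution\<close>.\<close>
  have "nsum 1 t = frac_kernel 1 t - \<alpha> * nsum (1 + (q - q1)) t - \<beta> * nsum (1 + (q - q2)) t - \<gamma> * nsum (1 + q) t"
    by (rule neumann_sum_unfold[OF order_gaps]) simp
  hence u: "nsum 1 t = 1 - \<alpha> * nsum (q + 1 - q1) t - \<beta> * nsum (q + 1 - q2) t - \<gamma> * nsum (q + 1) t"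
    using t by (simp add: frac_kernel_1 algebra_simps)
  show "caputo q (basic_solution c) t + \<alpha> * caputo q1 (basic_solution c) t + \<beta> * caputo q2 (basic_solution c) t + \<gamma> * basic_solution c t = 0"
    using caputo_basic[of q t c] caputo_basic[of q1 t c] caputo_basic[of q2 t c] par t u
    by (simp add: basic_solution_def algebra_simps)
qed

lemma basic_solution_initial_norm: "initial_norm q (basic_solution c) = \<bar>c\<bar>"
  using hderiv_1_basic_closed[of 0 c]
  by (auto simp: initial_norm_def basic_solution_0 neumann_sum_nonpos[OF order_gaps] norm_Pair)

lemma basic_solution_slope: "q > 1 \<Longrightarrow> hderiv 1 (basic_solution c) 0 = 0"
  using hderiv_1_basic_closed[of 0 c] by (simp add: neumann_sum_nonpos[OF order_gaps])

end

section \<open>Instability\<close>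

lemma bigo_tendsto_0:
  fixes f g :: "real \<Rightarrow> real"
  assumes "f \<in> O[F](g)" "(g \<longlongrightarrow> 0) F"
  shows "(f \<longlongrightarrow> 0) F"
proof -
  obtain C where "\<forall>\<^sub>F x in F. norm (f x) \<le> C * norm (g x)" using assms(1) by (elim landau_o.bigE)
  moreover have "((\<lambda>x. C * norm (g x)) \<longlongrightarrow> 0) F"
    using tendsto_mult[OF tendsto_const[of C] tendsto_norm_zero[OF assms(2)]] by simp
  ultimately show ?thesis by (rule Lim_null_comparison)
qed

section \<open>The Laplace transform at complex frequencies\<close>

definition claplace :: "(real \<Rightarrow> real) \<Rightarrow> complex \<Rightarrow> complex" where
  "claplace x s = (LINT t|lborel. indicator {0<..} t *\<^sub>R (of_real (x t) * exp (- s * of_real t)))"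

lemma claplace_of_real:
  shows "claplace x (of_real s) = of_real (laplace x s)"
proof -
  have "claplace x (of_real s) = (LINT t|lborel. complex_of_real (indicator {0<..} t * x t * exp (- s * t)))"
    unfolding claplace_def by (intro Bochner_Integration.integral_cong)
      (auto simp: scaleR_conv_of_real exp_of_real[symmetric])
  thus ?thesis unfolding laplace_def by (simp only: integral_complex_of_real)
qed

context
  fixes x :: "real \<Rightarrow> real" and M :: real
  assumes c: "continuous_on {0..} x" and b: "\<And>t. t \<ge> 0 \<Longrightarrow> \<bar>x t\<bar> \<le> M"
begin

lemma claplace_measurable:
  "(\<lambda>t. indicator {0<..} t *\<^sub>R (complex_of_real (x t) * exp (- s * of_real t))) \<in> borel_measurable borel"
  by (intro borel_measurable_continuous_on_indicator)
     (auto intro!: continuous_intros continuous_on_subset[OF c])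

lemma claplace_integrable:
  assumes "Re s > 0"
  shows "integrable lborel (\<lambda>t. indicator {0<..} t *\<^sub>R (complex_of_real (x t) * exp (- s * of_real t)))"
proof (rule Bochner_Integration.integrable_bound)
  have "integrable lborel (\<lambda>t. indicator {0<..} t * exp (- Re s * t))"
    by (rule exp_integrable[OF assms])
  thus "integrable lborel (\<lambda>t. M * (indicator {0<..} t * exp (- Re s * t)))"
    by (rule integrable_mult_right)
  show "(\<lambda>t. indicator {0<..} t *\<^sub>R (complex_of_real (x t) * exp (- s * of_real t))) \<in> borel_measurable lborel"
    using claplace_measurable by simp
  show "AE t in lborel. norm (indicator {0<..} t *\<^sub>R (complex_of_real (x t) * exp (- s * of_real t))) \<le> norm (M * (indicator {0<..} t * exp (- Re s * t)))"
  proof (rule AE_I2)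
    fix t
    show "norm (indicator {0<..} t *\<^sub>R (complex_of_real (x t) * exp (- s * of_real t))) \<le> norm (M * (indicator {0<..} t * exp (- Re s * t)))"
    proof (cases "t > 0")
      case True
      have "\<bar>x t\<bar> * exp (- Re s * t) \<le> \<bar>M\<bar> * exp (- Re s * t)"
        using b[of t] True by (intro mult_right_mono) auto
      thus ?thesis using True by (simp add: norm_mult abs_mult)
    qed simp
  qed
qed

text \<open>Differentiation under the integral sign, on a bounded interval and with continuous
  integrands.\<close>

lemma claplace_truncated_holomorphic:
  "(\<lambda>s. integral (cbox 0 k) (\<lambda>t. complex_of_real (x t) * exp (- s * of_real t))) holomorphic_on {s. Re s > 0}"
proof (rule leibniz_rule_holomorphic)
  show "((\<lambda>s. complex_of_real (x t) * exp (- s * of_real t)) has_field_derivative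
      complex_of_real (x t) * (exp (- s * of_real t) * (- of_real t))) (at s within {s. Re s > 0})" for s t
    by (auto intro!: derivative_eq_intros)
  show "(\<lambda>t. complex_of_real (x t) * exp (- s * of_real t)) integrable_on cbox 0 k" for s
    by (intro integrable_continuous continuous_intros continuous_on_subset[OF c]) auto
  have cx: "continuous_on ({s. Re s > 0} \<times> cbox 0 k) (\<lambda>p. x (snd p))"
    by (intro continuous_on_compose2[OF c] continuous_on_snd continuous_on_id) auto
  show "continuous_on ({s. Re s > 0} \<times> cbox 0 k) (\<lambda>(s, t). complex_of_real (x t) * (exp (- s * of_real t) * (- of_real t)))"
    unfolding case_prod_unfold
    by (intro continuous_on_mult continuous_on_exp continuous_on_minus continuous_on_of_real cx continuous_on_fst continuous_on_snd continuous_on_id)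
qed (rule convex_halfspace_Re_gt)

lemma claplace_tail:
  assumes "\<delta> > 0" "Re s \<ge> \<delta>" "k \<ge> 0"
  shows "cmod (claplace x s - integral (cbox 0 k) (\<lambda>t. complex_of_real (x t) * exp (- s * of_real t))) \<le> M * (exp (- \<delta> * k) / \<delta>)"
proof -
  let ?f = "\<lambda>t. complex_of_real (x t) * exp (- s * of_real t)"
  have "set_integrable lborel {0..k} ?f"
    by (intro borel_integrable_atLeastAtMost' continuous_intros continuous_on_subset[OF c]) auto
  hence si: "set_integrable lborel {0<..k} ?f" by (rule set_integrable_subset) auto
  have "integral (cbox 0 k) ?f = integral {0<..k} ?f"
    by (rule integral_spike_set) (auto intro: negligible_subset[of "{0}"])
  also have "\<dots> = (LINT t|lborel. indicator {0<..k} t *\<^sub>R ?f t)"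
    using set_borel_integral_eq_integral(2)[OF si] by (simp add: set_lebesgue_integral_def)
  finally have "claplace x s - integral (cbox 0 k) ?f = (LINT t|lborel. indicator {0<..} t *\<^sub>R ?f t - indicator {0<..k} t *\<^sub>R ?f t)"
    unfolding claplace_def using claplace_integrable[of s] assms si by (simp add: set_integrable_def)
  \<comment> \<open>The shifted kernel of order 1 is the indicator of t > k, so the tail is bounded
    by a transform already computed.\<close>
  also have "cmod \<dots> \<le> (LINT t|lborel. M * (frac_kernel 1 (t - k) * exp (- \<delta> * t)))"
  proof (rule order.trans[OF integral_norm_bound integral_mono'])
    have K: "has_bochner_integral lborel (\<lambda>t. frac_kernel 1 (t - k) * exp (- \<delta> * t)) (exp (- \<delta> * k) * \<delta> powr - 1)"
      using assms by (intro frac_kernel_laplace_shift) auto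
    thus "integrable lborel (\<lambda>t. M * (frac_kernel 1 (t - k) * exp (- \<delta> * t)))"
      by (intro integrable_mult_right) (simp add: has_bochner_integral_iff)
    have M: "M \<ge> 0" using b[of 0] by simp
    fix t
    show "cmod (indicator {0<..} t *\<^sub>R ?f t - indicator {0<..k} t *\<^sub>R ?f t) \<le> M * (frac_kernel 1 (t - k) * exp (- \<delta> * t))"
    proof (cases "t > k")
      case True
      have "\<bar>x t\<bar> * exp (- Re s * t) \<le> M * exp (- \<delta> * t)"
        using b[of t] True assms by (intro mult_mono) (auto intro: mult_right_mono)
      thus ?thesis using True assms by (simp add: frac_kernel_1 norm_mult)
    next
      case False
      hence z: "indicator {0<..} t *\<^sub>R ?f t - indicator {0<..k} t *\<^sub>R ?f t = 0" by (auto simp: indicator_def)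
      show ?thesis unfolding z using M by (simp add: frac_kernel_1)
    qed
    show "0 \<le> M * (frac_kernel 1 (t - k) * exp (- \<delta> * t))" using M by simp
  qed
  also have "\<dots> = M * (exp (- \<delta> * k) / \<delta>)"
    using has_bochner_integral_integral_eq[OF frac_kernel_laplace_shift[of 1 \<delta> k]] assms
    by (simp add: powr_minus divide_inverse)
  finally show ?thesis .
qed

text \<open>By the tail estimate the truncated transforms converge uniformly on every disc at
  positive distance from the imaginary axis.\<close>

lemma claplace_holomorphic: "claplace x holomorphic_on {s. Re s > 0}"
proof (rule holomorphic_uniform_sequence)
  show "(\<lambda>s. integral (cbox 0 (real n)) (\<lambda>t. complex_of_real (x t) * exp (- s * of_real t))) holomorphic_on {s. Re s > 0}" for n
    by (rule claplace_truncated_holomorphic)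
  fix z assume z: "z \<in> {s. Re s > 0}"
  define \<delta> where "\<delta> = Re z / 2"
  have d: "\<delta> > 0" using z by (simp add: \<delta>_def)
  have Re: "Re s \<ge> \<delta>" if "s \<in> cball z \<delta>" for s
    using that abs_Re_le_cmod[of "z - s"] by (simp add: dist_norm \<delta>_def)
  show "\<exists>d>0. cball z d \<subseteq> {s. Re s > 0} \<and> uniform_limit (cball z d)
      (\<lambda>n s. integral (cbox 0 (real n)) (\<lambda>t. complex_of_real (x t) * exp (- s * of_real t))) (claplace x) sequentially"
  proof (intro exI[of _ \<delta>] conjI d uniform_limitI)
    show "cball z \<delta> \<subseteq> {s. Re s > 0}" using Re d by fastforce
    fix e :: real assume e: "e > 0"
    have "(\<lambda>n. M * (exp (- \<delta> * real n) / \<delta>)) \<longlonglongrightarrow> 0" using d by real_asymp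
    hence "\<forall>\<^sub>F n in sequentially. M * (exp (- \<delta> * real n) / \<delta>) < e" using e by (rule order_tendstoD)
    thus "\<forall>\<^sub>F n in sequentially. \<forall>s\<in>cball z \<delta>.
       dist (integral (cbox 0 (real n)) (\<lambda>t. complex_of_real (x t) * exp (- s * of_real t))) (claplace x s) < e"
    proof eventually_elim
      case (elim n)
      show ?case
      proof
        fix s assume "s \<in> cball z \<delta>"
        from claplace_tail[OF d Re[OF this], of "real n"] elim
        show "dist (integral (cbox 0 (real n)) (\<lambda>t. complex_of_real (x t) * exp (- s * of_real t))) (claplace x s) < e"
          by (simp add: dist_norm norm_minus_commute)
      qed
    qed
  qed
qed (rule open_halfspace_Re_gt)

text \<open>An Abelian estimate: up to a time T after which |x| < e / 2 the integral contributes at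
  most M T, and beyond it at most e / (2 \<sigma>). The factor \<sigma> makes the first part vanish
  and leaves e / 2 of the second.\<close>

lemma claplace_vanishing:
  assumes "(x \<longlongrightarrow> 0) at_top"
  shows "((\<lambda>\<sigma>. complex_of_real \<sigma> * claplace x (\<i> * of_real v + of_real \<sigma>)) \<longlongrightarrow> 0) (at_right 0)"
proof (rule tendstoI)
  fix e :: real assume e: "e > 0"
  have "\<forall>\<^sub>F t in at_top. \<bar>x t\<bar> < e / 2" using tendstoD[OF assms, of "e/2"] e by (simp add: dist_real_def)
  then obtain T0 where T0: "\<And>t. t \<ge> T0 \<Longrightarrow> \<bar>x t\<bar> < e / 2" by (auto simp: eventually_at_top_linorder)
  define T where "T = max T0 1"
  have T: "\<And>t. t \<ge> T \<Longrightarrow> \<bar>x t\<bar> < e / 2" "T > 0" using T0 by (auto simp: T_def)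
  have M: "M \<ge> 0" using b[of 0] by simp
  have bd: "cmod (of_real \<sigma> * claplace x (\<i> * of_real v + of_real \<sigma>)) \<le> M * T * \<sigma> + e / 2" if s: "\<sigma> > 0" for \<sigma>
  proof -
    let ?s = "\<i> * of_real v + complex_of_real \<sigma>"
    have K: "has_bochner_integral lborel (\<lambda>t. frac_kernel 1 t * exp (- \<sigma> * t)) (\<sigma> powr - 1)"
      using s by (intro frac_kernel_laplace) auto
    have I: "has_bochner_integral lborel (\<lambda>t. M * indicator {0<..T} t + e / 2 * (frac_kernel 1 t * exp (- \<sigma> * t))) (M * T + e / 2 * \<sigma> powr - 1)"
      using K T(2) by (intro has_bochner_integral_add has_bochner_integral_mult_right)
        (auto simp: has_bochner_integral_iff)
    have "cmod (claplace x ?s) \<le> (LINT t|lborel. M * indicator {0<..T} t + e / 2 * (frac_kernel 1 t * exp (- \<sigma> * t)))"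
      unfolding claplace_def
    proof (rule order.trans[OF integral_norm_bound integral_mono'])
      show "integrable lborel (\<lambda>t. M * indicator {0<..T} t + e / 2 * (frac_kernel 1 t * exp (- \<sigma> * t)))"
        using I by (simp add: has_bochner_integral_iff)
      fix t
      show "cmod (indicator {0<..} t *\<^sub>R (complex_of_real (x t) * exp (- ?s * of_real t))) \<le> M * indicator {0<..T} t + e / 2 * (frac_kernel 1 t * exp (- \<sigma> * t))"
      proof (cases "t > 0")
        case True
        have nrm: "cmod (indicator {0<..} t *\<^sub>R (complex_of_real (x t) * exp (- ?s * of_real t))) = \<bar>x t\<bar> * exp (- \<sigma> * t)"
          using True by (simp add: norm_mult)
        show ?thesis
        proof (cases "t \<le> T")
          case tT: True
          have "\<bar>x t\<bar> * exp (- \<sigma> * t) \<le> M * 1" using b[of t] True s M by (intro mult_mono) auto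
          moreover have "e / 2 * (frac_kernel 1 t * exp (- \<sigma> * t)) \<ge> 0" using e by simp
          ultimately show ?thesis unfolding nrm using True tT by simp
        next
          case False
          hence "\<bar>x t\<bar> * exp (- \<sigma> * t) \<le> e / 2 * exp (- \<sigma> * t)"
            using T(1)[of t] by (intro mult_right_mono) auto
          thus ?thesis unfolding nrm using True False by (simp add: frac_kernel_1)
        qed
      qed (use M e in auto)
      show "0 \<le> M * indicator {0<..T} t + e / 2 * (frac_kernel 1 t * exp (- \<sigma> * t))" using M e by simp
    qed
    also have "\<dots> = M * T + e / 2 * \<sigma> powr - 1" using I by (rule has_bochner_integral_integral_eq)
    finally have "\<sigma> * cmod (claplace x ?s) \<le> \<sigma> * (M * T + e / 2 * \<sigma> powr - 1)" using s by simp
    also have "\<dots> = M * T * \<sigma> + e / 2" using s by (simp add: powr_minus field_simps)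
    finally show ?thesis using s by (simp add: norm_mult)
  qed
  have "((\<lambda>\<sigma>. M * T * \<sigma> + e / 2) \<longlongrightarrow> M * T * 0 + e / 2) (at_right 0)" by (intro tendsto_intros)
  hence "\<forall>\<^sub>F \<sigma> in at_right 0. M * T * \<sigma> + e / 2 < e" by (rule order_tendstoD(2)) (use e in simp)
  moreover have "\<forall>\<^sub>F \<sigma> in at_right (0::real). \<sigma> > 0" by (simp add: eventually_at_right_less)
  ultimately show "\<forall>\<^sub>F \<sigma> in at_right 0. dist (complex_of_real \<sigma> * claplace x (\<i> * of_real v + of_real \<sigma>)) 0 < e"
  proof eventually_elim
    case (elim \<sigma>)
    thus ?case using bd[of \<sigma>] by simp
  qed
qed

end

section \<open>Roots of the characteristic function against stability\<close>

context
  fixes \<alpha> \<beta> \<gamma> q1 q2 q :: real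
  assumes par: "\<gamma> > 0" "0 < q1" "q1 < q2" "q2 < q" "q \<le> 2"
begin

abbreviation (input) "\<Delta> \<equiv> char_fun \<alpha> \<beta> \<gamma> q1 q2 q"
abbreviation (input) "u \<equiv> basic_solution \<alpha> \<beta> \<gamma> q1 q2 q"

lemma basic_solution_continuous: "continuous_on {0..} (u c)"
  using regular_continuous[of q "u c"] caputo_regular_basic[OF par(2-5)] par by simp

text \<open>For large real s this is the transformed equation multiplied by s. Boundedness makes
  both sides holomorphic on the whole half-plane, and the identity theorem extends the
  equality.\<close>

lemma basic_solution_transform:
  assumes bd: "\<And>t. t \<ge> 0 \<Longrightarrow> \<bar>u c t\<bar> \<le> M" and s: "Re s > 0"
  shows "claplace (u c) s * s * \<Delta> s = of_real c * (\<Delta> s - of_real \<gamma>)"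
proof -
  obtain C \<sigma> where sg: "\<sigma> \<ge> 3" and L: "\<And>s. s > \<sigma> \<Longrightarrow> laplace (u c) s * (s powr q + \<alpha> * s powr q1 + \<beta> * s powr q2 + \<gamma>) =
       u c 0 * (s powr (q - 1) + \<alpha> * s powr (q1 - 1) + \<beta> * s powr (q2 - 1)) +
       hderiv 1 (u c) 0 * (slope_order q s + \<alpha> * slope_order q1 s + \<beta> * slope_order q2 s)"
    using solution_laplace[OF par(2-5) basic_solution_is_solution[OF par(2-5)]] by metis
  \<comment> \<open>For q > 1 the solution has slope 0. For q \<le> 1 the one-sided derivative at 0
    is not under control, but then every \<open>slope_order\<close> vanishes.\<close>
  have sl: "hderiv 1 (u c) 0 * (slope_order q s + \<alpha> * slope_order q1 s + \<beta> * slope_order q2 s) = 0" for s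
    using basic_solution_slope[OF par(2-5)] par by (cases "q > 1") (auto simp: slope_order_def)
  define F where "F = (\<lambda>s. claplace (u c) s * s * \<Delta> s - of_real c * (\<Delta> s - of_real \<gamma>))"
  have F0: "F (of_real r) = 0" if "r > \<sigma>" for r
  proof -
    have r: "r > 0" using that sg by simp
    define d where "d = r powr q + \<alpha> * r powr q1 + \<beta> * r powr q2 + \<gamma>"
    have D: "\<Delta> (of_real r) = of_real d" using r by (simp add: char_fun_def powr_of_real d_def)
    have p: "r powr (e - 1) * r = r powr e" for e using r powr_add[of r "e - 1" 1] by simp
    have "laplace (u c) r * d * r = c * (r powr (q - 1) * r + \<alpha> * (r powr (q1 - 1) * r) + \<beta> * (r powr (q2 - 1) * r))"
      using L[OF that] unfolding sl by (simp add: d_def basic_solution_0[OF par(2-5)] algebra_simps)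
    also have "\<dots> = c * (d - \<gamma>)" unfolding p by (simp add: d_def)
    finally have "laplace (u c) r * r * d = c * (d - \<gamma>)" by (simp add: mult_ac)
    hence "complex_of_real (laplace (u c) r * r * d) = of_real (c * (d - \<gamma>))" by (simp only:)
    thus ?thesis unfolding F_def D claplace_of_real by simp
  qed
  have "F s = 0"
  proof (rule analytic_continuation[where S = "{s. Re s > 0}" and U = "of_real ` {\<sigma><..}" and \<xi> = "of_real (\<sigma> + 1)" and f = F])
    show "F holomorphic_on {s. Re s > 0}" unfolding F_def
      by (intro holomorphic_intros char_fun_holomorphic[OF par] claplace_holomorphic[OF basic_solution_continuous bd])
    show "open {s. Re s > 0}" by (rule open_halfspace_Re_gt)
    show "connected {s. Re s > 0}" by (intro convex_connected convex_halfspace_Re_gt)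
    have "(\<sigma> + 1) islimpt {\<sigma><..}" by (rule interior_limit_point) (simp add: interior_open)
    hence "\<And>e. e > 0 \<Longrightarrow> \<exists>y\<in>{\<sigma><..}. y \<noteq> \<sigma> + 1 \<and> dist y (\<sigma> + 1) < e" by (simp add: islimpt_approachable)
    thus "complex_of_real (\<sigma> + 1) islimpt of_real ` {\<sigma><..}"
      unfolding islimpt_approachable
      by (metis dist_of_real imageI of_real_eq_iff)
  qed (use F0 s sg in auto)
  thus ?thesis by (simp add: F_def)
qed

text \<open>At a root the transform identity reads 0 = - c \<gamma>, which fails for every c
  \<noteq> 0; the choice c = d / 2 is small enough for the stability bound to apply.\<close>

lemma not_stable_if_rhp_root:
  assumes "rhp_root \<gamma> q1 q2 q \<alpha> \<beta>"
  shows "\<not> stable \<alpha> \<beta> \<gamma> q1 q2 q"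
proof
  assume "stable \<alpha> \<beta> \<gamma> q1 q2 q"
  then obtain d where d: "d > 0" "\<And>x. is_solution \<alpha> \<beta> \<gamma> q1 q2 q x \<Longrightarrow> initial_norm q x < d \<Longrightarrow> (\<forall>t\<ge>0. \<bar>x t\<bar> \<le> 1)"
    unfolding stable_def by (meson zero_less_one)
  have "\<forall>t\<ge>0. \<bar>u (d/2) t\<bar> \<le> 1"
    using d basic_solution_is_solution[OF par(2-5)] basic_solution_initial_norm[OF par(2-5)] by (intro d(2)) auto
  moreover obtain s where s: "Re s > 0" "\<Delta> s = 0" using assms unfolding rhp_root_def[OF par] by auto
  ultimately have "of_real (d/2) * (0 - complex_of_real \<gamma>) = 0"
    using basic_solution_transform[of "d/2" 1 s] by simp
  thus False using d par by simp
qed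

lemma char_fun_derivative:
  assumes "s \<notin> \<real>\<^sub>\<le>\<^sub>0"
  shows "(\<Delta> has_field_derivative (of_real q * s powr (of_real q - 1) + of_real \<alpha> * (of_real q1 * s powr (of_real q1 - 1)) + of_real \<beta> * (of_real q2 * s powr (of_real q2 - 1)))) (at s)"
proof -
  have "((\<lambda>s. s powr of_real q + of_real \<alpha> * s powr of_real q1 + of_real \<beta> * s powr of_real q2 + of_real \<gamma>) has_field_derivative
     (of_real q * s powr (of_real q - 1) + of_real \<alpha> * (of_real q1 * s powr (of_real q1 - 1)) + of_real \<beta> * (of_real q2 * s powr (of_real q2 - 1)) + 0)) (at s)"
    by (intro DERIV_add DERIV_cmult has_field_derivative_powr DERIV_const assms)
  thus ?thesis by (simp add: char_fun_def[abs_def])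
qed

text \<open>With z = iv + \<sigma>, the quotient \<Delta>(z) / \<sigma> converges to the derivative
  of \<Delta> at iv, while \<sigma> X(z) tends to 0. The product of both with z equals c
  (\<Delta>(z) - \<gamma>), whose limit is - c \<gamma> \<noteq> 0.\<close>

lemma not_asymptotically_stable_if_imaginary_root:
  assumes v: "v > 0" "\<Delta> (\<i> * of_real v) = 0" and a: "a > 0"
  shows "\<not> O_asymptotically_stable a \<alpha> \<beta> \<gamma> q1 q2 q"
proof
  assume st: "O_asymptotically_stable a \<alpha> \<beta> \<gamma> q1 q2 q"
  then obtain d where d: "d > 0" "\<And>x. is_solution \<alpha> \<beta> \<gamma> q1 q2 q x \<Longrightarrow> initial_norm q x < d \<Longrightarrow> (\<forall>t\<ge>0. \<bar>x t\<bar> \<le> 1)"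
    unfolding O_asymptotically_stable_def stable_def by (meson zero_less_one)
  obtain r where r: "r > 0" "\<And>x. is_solution \<alpha> \<beta> \<gamma> q1 q2 q x \<Longrightarrow> initial_norm q x < r \<Longrightarrow> x \<in> O[at_top](\<lambda>t. t powr (- a))"
    using st unfolding O_asymptotically_stable_def by blast
  define c where "c = min (d/2) (r/2)"
  have c: "c > 0" "c < d" "c < r" using d r by (auto simp: c_def)
  note us = basic_solution_is_solution[OF par(2-5), of \<alpha> \<beta> \<gamma> c] and un = basic_solution_initial_norm[OF par(2-5), of \<alpha> \<beta> \<gamma> c]
  have bd: "\<bar>u c t\<bar> \<le> 1" if "t \<ge> 0" for t using d(2)[OF us] un c that by simp
  have "u c \<in> O[at_top](\<lambda>t. t powr (- a))" using r(2)[OF us] un c by simp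
  moreover have "((\<lambda>t. t powr (- a)) \<longlongrightarrow> 0) at_top" using a by (intro tendsto_neg_powr filterlim_ident) auto
  ultimately have lim: "(u c \<longlongrightarrow> 0) at_top" by (rule bigo_tendsto_0)
  let ?z = "\<lambda>\<sigma>. \<i> * of_real v + complex_of_real \<sigma>"
  have z0: "\<i> * complex_of_real v \<notin> \<real>\<^sub>\<le>\<^sub>0" using v by (auto simp: complex_nonpos_Reals_iff)
  obtain D where D: "(\<Delta> has_field_derivative D) (at (\<i> * of_real v))" using char_fun_derivative[OF z0] by blast
  have zl: "(?z \<longlongrightarrow> \<i> * of_real v + of_real 0) (at_right 0)" by (intro tendsto_intros)
  have Dl: "(\<Delta> \<longlongrightarrow> \<Delta> (\<i> * of_real v)) (at (\<i> * of_real v))" using DERIV_isCont[OF D] by (simp add: isCont_def)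
  have "filterlim ?z (at (\<i> * of_real v)) (at_right 0)"
    unfolding filterlim_at using zl by (auto simp: eventually_at_right_less intro: eventually_mono[OF eventually_at_right_less])
  note zf = this
  have l1: "((\<lambda>\<sigma>. \<Delta> (?z \<sigma>)) \<longlongrightarrow> 0) (at_right 0)"
    using filterlim_compose[OF Dl zf] v by simp
  have "((\<lambda>w. (\<Delta> w - \<Delta> (\<i> * of_real v)) / (w - \<i> * of_real v)) \<longlongrightarrow> D) (at (\<i> * of_real v))"
    using D unfolding has_field_derivative_iff by simp
  from filterlim_compose[OF this zf] have l2: "((\<lambda>\<sigma>. \<Delta> (?z \<sigma>) / of_real \<sigma>) \<longlongrightarrow> D) (at_right 0)" using v by simp
  note l3 = claplace_vanishing[OF basic_solution_continuous bd lim, of v]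
  have "((\<lambda>\<sigma>. of_real \<sigma> * claplace (u c) (?z \<sigma>) * ?z \<sigma> * (\<Delta> (?z \<sigma>) / of_real \<sigma>)) \<longlongrightarrow> 0 * (\<i> * of_real v + of_real 0) * D) (at_right 0)"
    by (intro tendsto_mult l2 l3 zl)
  moreover have "\<forall>\<^sub>F \<sigma> in at_right 0. of_real \<sigma> * claplace (u c) (?z \<sigma>) * ?z \<sigma> * (\<Delta> (?z \<sigma>) / of_real \<sigma>) = of_real c * (\<Delta> (?z \<sigma>) - of_real \<gamma>)"
    using eventually_at_right_less[of "0::real"]
  proof eventually_elim
    case (elim \<sigma>)
    have "Re (?z \<sigma>) > 0" using elim by simp
    from basic_solution_transform[OF bd this] show ?case using elim by (simp add: mult.assoc)
  qed
  ultimately have L1: "((\<lambda>\<sigma>. of_real c * (\<Delta> (?z \<sigma>) - of_real \<gamma>)) \<longlongrightarrow> 0 * (\<i> * of_real v + of_real 0) * D) (at_right 0)"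
    by (rule Lim_transform_eventually)
  have L2: "((\<lambda>\<sigma>. of_real c * (\<Delta> (?z \<sigma>) - of_real \<gamma>)) \<longlongrightarrow> of_real c * (0 - of_real \<gamma>)) (at_right 0)"
    by (intro tendsto_intros l1)
  have "complex_of_real c * (0 - of_real \<gamma>) = 0 * (\<i> * of_real v + of_real 0) * D"
    by (rule tendsto_unique[OF _ L2 L1]) simp
  thus False using c par by simp
qed

end

section \<open>Fourier integrals along the imaginary axis\<close>

text \<open>For 0 < a < 1 and \<eta> > 0 the first power is the smaller one up to r = 1 and the
  second beyond. So the weight is integrable at both ends, and it is decreasing, which lets bounds
  on the imaginary axis serve to the right of it.\<close>

definition decay_weight :: "real \<Rightarrow> real \<Rightarrow> real \<Rightarrow> real" where
  "decay_weight a \<eta> r = min (r powr (a - 1)) (r powr (- 1 - \<eta>))"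

lemma decay_weight_antimono:
  assumes "a < 1" "\<eta> > 0" "0 < r" "r \<le> r'"
  shows "decay_weight a \<eta> r' \<le> decay_weight a \<eta> r"
  unfolding decay_weight_def using assms by (intro min.mono powr_mono2') auto

lemma decay_weight_nonneg: "decay_weight a \<eta> r \<ge> 0"
  by (simp add: decay_weight_def)

lemma decay_weight_le: "decay_weight a \<eta> r \<le> r powr (a - 1)" "decay_weight a \<eta> r \<le> r powr (- 1 - \<eta>)"
  by (simp_all add: decay_weight_def)

lemma integrable_lborel_if_nonneg_integrable_on:
  fixes f :: "real \<Rightarrow> real"
  assumes "f integrable_on S" "\<And>x. x \<in> S \<Longrightarrow> f x \<ge> 0" "(\<lambda>x. indicator S x * f x) \<in> borel_measurable borel"
  shows "integrable lborel (\<lambda>x. indicator S x * f x)"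
proof -
  have "f absolutely_integrable_on S" using assms by (intro nonnegative_absolutely_integrable_1) auto
  hence "integrable lebesgue (\<lambda>x. indicator S x * f x)" by (simp add: set_integrable_def)
  thus ?thesis using assms(3) by (subst (asm) integrable_completion) auto
qed

lemma decay_weight_integrable:
  assumes "0 < a" "a < 1" "\<eta> > 0"
  shows "integrable lborel (\<lambda>\<omega>. decay_weight a \<eta> \<bar>\<omega>\<bar>)"
proof -
  have [measurable]: "decay_weight a \<eta> \<in> borel_measurable borel"
    unfolding decay_weight_def[abs_def] by measurable
  have 1: "integrable lborel (\<lambda>x. indicator {0..1} x * x powr (a - 1))"
    using has_integral_powr_from_0[of "a - 1" 1] assms
    by (intro integrable_lborel_if_nonneg_integrable_on) (auto simp: has_integral_integrable)
  have 2: "integrable lborel (\<lambda>x. indicator {1..} x * x powr (- 1 - \<eta>))"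
  proof -
    have "((\<lambda>x. x powr (- 1 - \<eta>)) has_integral - (1 powr (- 1 - \<eta> + 1)) / (- 1 - \<eta> + 1)) {1..}"
      using assms by (intro has_integral_powr_to_inf) auto
    hence "(\<lambda>x. x powr (- 1 - \<eta>)) integrable_on {1..}" by (rule has_integral_integrable)
    thus ?thesis by (intro integrable_lborel_if_nonneg_integrable_on) auto
  qed
  have 3: "integrable lborel (\<lambda>\<omega>. indicator {0<..} \<omega> * decay_weight a \<eta> \<omega>)"
  proof (rule Bochner_Integration.integrable_bound[OF Bochner_Integration.integrable_add[OF 1 2]])
    show "AE x in lborel. norm (indicator {0<..} x * decay_weight a \<eta> x) \<le> norm (indicator {0..1} x * x powr (a - 1) + indicator {1..} x * x powr (- 1 - \<eta>))"
      using decay_weight_le[of a \<eta>] decay_weight_nonneg[of a \<eta>]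
      by (intro AE_I2) (auto simp: indicator_def add_increasing add_increasing2)
  qed measurable
  have 4: "integrable lborel (\<lambda>\<omega>. indicator {0<..} (0 + (-1) * \<omega>) * decay_weight a \<eta> (0 + (-1) * \<omega>))"
    using lborel_integrable_real_affine[OF 3, of "-1" 0] by simp
  have "(\<lambda>\<omega>. indicator {0<..} \<omega> * decay_weight a \<eta> \<omega> + indicator {0<..} (0 + (-1) * \<omega>) * decay_weight a \<eta> (0 + (-1) * \<omega>)) = (\<lambda>\<omega>. decay_weight a \<eta> \<bar>\<omega>\<bar>)"
    by (auto simp: fun_eq_iff indicator_def decay_weight_def abs_if)
  with Bochner_Integration.integrable_add[OF 3 4] show ?thesis by simp
qed

text \<open>Split at \<open>\<omega> = 1 / \<bar>\<tau>\<bar>\<close>: below, bound the modulus; above, integrate by parts once.\<close>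
lemma oscillatory_integral_bound:
  fixes g g' :: "real \<Rightarrow> complex"
  assumes a: "0 < a" "a < 1" and \<tau>: "\<tau> \<noteq> 0" and C: "C \<ge> 0"
    and int: "set_integrable lborel {0<..} g"
    and d: "\<And>\<omega>. \<omega> > 0 \<Longrightarrow> (g has_vector_derivative g' \<omega>) (at \<omega>)"
    and b: "\<And>\<omega>. \<omega> > 0 \<Longrightarrow> cmod (g \<omega>) \<le> C * \<omega> powr (a - 1)"
    and b': "\<And>\<omega>. \<omega> > 0 \<Longrightarrow> cmod (g' \<omega>) \<le> C * \<omega> powr (a - 2)"
  shows "cmod (LINT \<omega>:{0<..}|lborel. g \<omega> * cis (\<omega> * \<tau>)) \<le> C * (1 / a + 2 + 1 / (1 - a)) * \<bar>\<tau>\<bar> powr (- a)"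
proof -
  define \<delta> where "\<delta> = 1 / \<bar>\<tau>\<bar>"
  have \<delta>: "\<delta> > 0" using \<tau> by (simp add: \<delta>_def)
  define h where "h = (\<lambda>\<omega>. g \<omega> * cis (\<omega> * \<tau>))"
  have [measurable]: "(\<lambda>\<omega>. indicator {0<..} \<omega> *\<^sub>R g \<omega>) \<in> borel_measurable borel"
    using int by (auto simp: set_integrable_def)
  have cism: "(\<lambda>\<omega>. cis (\<omega> * \<tau>)) \<in> borel_measurable borel"
    by (intro borel_measurable_continuous_onI continuous_intros)
  have "integrable lborel (\<lambda>\<omega>. indicator {0<..} \<omega> *\<^sub>R h \<omega>)"
  proof (rule Bochner_Integration.integrable_bound[of _ "\<lambda>\<omega>. indicator {0<..} \<omega> *\<^sub>R g \<omega>"])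
    have "(\<lambda>\<omega>. (indicator {0<..} \<omega> *\<^sub>R g \<omega>) * cis (\<omega> * \<tau>)) \<in> borel_measurable lborel"
      using cism by measurable
    thus "(\<lambda>\<omega>. indicator {0<..} \<omega> *\<^sub>R h \<omega>) \<in> borel_measurable lborel" by (simp add: h_def)
  qed (use int in \<open>auto simp: set_integrable_def h_def norm_mult\<close>)
  hence hint: "set_integrable lborel {0<..} h" by (simp add: set_integrable_def)
  have hI: "set_integrable lborel S h" if "S \<subseteq> {0<..}" "S \<in> sets borel" for S
    using set_integrable_subset[OF hint] that by auto
  define B where "B = C * (1 / a + 2 + 1 / (1 - a)) * \<bar>\<tau>\<bar> powr (- a)"
  have near: "h integrable_on {0..\<delta>}" "cmod (integral {0..\<delta>} h) \<le> C * (\<delta> powr a / a)"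
  proof -
    have "h integrable_on {0<..\<delta>}"
      by (intro set_borel_integral_eq_integral(1) hI) auto
    thus hi: "h integrable_on {0..\<delta>}"
      by (rule integrable_spike_set) (auto intro: negligible_subset[of "{0}"])
    have P: "((\<lambda>\<omega>. C * \<omega> powr (a - 1)) has_integral C * (\<delta> powr (a - 1 + 1) / (a - 1 + 1))) {0..\<delta>}"
      using a \<delta> by (intro has_integral_mult_right has_integral_powr_from_0) auto
    \<comment> \<open>The bound on g concerns positive arguments only, so the majorant is altered at
      0 to dominate whatever value h has there.\<close>
    have P': "((\<lambda>\<omega>. C * (if \<omega> = 0 then cmod (h 0) else \<omega> powr (a - 1)) + (if \<omega> = 0 then cmod (h 0) else 0)) has_integral C * (\<delta> powr (a - 1 + 1) / (a - 1 + 1))) {0..\<delta>}"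
      by (rule has_integral_spike[OF _ _ P, of "{0}"]) auto
    have "cmod (integral {0..\<delta>} h) \<le> integral {0..\<delta>} (\<lambda>\<omega>. C * (if \<omega> = 0 then cmod (h 0) else \<omega> powr (a - 1)) + (if \<omega> = 0 then cmod (h 0) else 0))"
      using b C by (intro integral_norm_bound_integral hi has_integral_integrable[OF P']) (auto simp: h_def norm_mult)
    also have "\<dots> = C * (\<delta> powr a / a)" using integral_unique[OF P'] by simp
    finally show "cmod (integral {0..\<delta>} h) \<le> C * (\<delta> powr a / a)" .
  qed
  have far: "h integrable_on {\<delta>..N}" "cmod (integral {\<delta>..N} h) \<le> C * (2 + 1 / (1 - a)) * \<bar>\<tau>\<bar> powr (- a)" if N: "N \<ge> \<delta>" for N
  proof -
    have "set_integrable lborel {\<delta>..N} h" using \<delta> by (intro hI) auto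
    thus hi: "h integrable_on {\<delta>..N}" by (rule set_borel_integral_eq_integral(1))
    \<comment> \<open>Integration by parts: the derivative of F is k + h, where k carries the
      derivative of g and a factor 1 / \<tau>.\<close>
    define F where "F = (\<lambda>\<omega>. h \<omega> / (\<i> * of_real \<tau>))"
    define k where "k = (\<lambda>\<omega>. g' \<omega> * cis (\<omega> * \<tau>) / (\<i> * of_real \<tau>))"
    have dF: "(F has_vector_derivative k \<omega> + h \<omega>) (at \<omega>)" if "\<omega> > 0" for \<omega>
    proof -
      have "((\<lambda>\<omega>. cis (\<omega> * \<tau>)) has_vector_derivative (\<i> * of_real \<tau>) * cis (\<omega> * \<tau>)) (at \<omega>)"
        unfolding has_vector_derivative_complex_iff by (auto intro!: derivative_eq_intros)
      from has_vector_derivative_mult[OF d[OF that] this]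
      have "(h has_vector_derivative g \<omega> * ((\<i> * of_real \<tau>) * cis (\<omega> * \<tau>)) + g' \<omega> * cis (\<omega> * \<tau>)) (at \<omega>)"
        by (simp add: h_def)
      from has_vector_derivative_mult_right[OF this, of "1 / (\<i> * of_real \<tau>)"]
      show ?thesis unfolding F_def k_def h_def using \<tau> by (simp add: field_simps)
    qed
    have FT: "((\<lambda>\<omega>. k \<omega> + h \<omega>) has_integral (F N - F \<delta>)) {\<delta>..N}"
      using N \<delta> by (intro fundamental_theorem_of_calculus has_vector_derivative_at_within[OF dF]) auto
    have ki: "(k has_integral (F N - F \<delta> - integral {\<delta>..N} h)) {\<delta>..N}"
      using has_integral_diff[OF FT integrable_integral[OF hi]] by simp
    have P: "((\<lambda>\<omega>. C / \<bar>\<tau>\<bar> * \<omega> powr (a - 2)) has_integral (C / \<bar>\<tau>\<bar> * (N powr (a - 1) / (a - 1)) - C / \<bar>\<tau>\<bar> * (\<delta> powr (a - 1) / (a - 1)))) {\<delta>..N}"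
    proof (rule fundamental_theorem_of_calculus[OF N])
      fix \<omega> assume "\<omega> \<in> {\<delta>..N}"
      hence "\<omega> > 0" using \<delta> by simp
      hence "((\<lambda>\<omega>. C / \<bar>\<tau>\<bar> * (\<omega> powr (a - 1) / (a - 1))) has_real_derivative C / \<bar>\<tau>\<bar> * (((a - 1) * \<omega> powr (a - 1 - 1)) / (a - 1))) (at \<omega>)"
        by (intro DERIV_cmult DERIV_cdivide has_real_derivative_powr)
      thus "((\<lambda>\<omega>. C / \<bar>\<tau>\<bar> * (\<omega> powr (a - 1) / (a - 1))) has_vector_derivative C / \<bar>\<tau>\<bar> * \<omega> powr (a - 2)) (at \<omega> within {\<delta>..N})"
        using a unfolding has_real_derivative_iff_has_vector_derivative[symmetric]
        by (simp add: has_field_derivative_at_within)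
    qed
    have "cmod (integral {\<delta>..N} k) \<le> integral {\<delta>..N} (\<lambda>\<omega>. C / \<bar>\<tau>\<bar> * \<omega> powr (a - 2))"
    proof (rule integral_norm_bound_integral)
      show "k integrable_on {\<delta>..N}" using ki by (rule has_integral_integrable)
      show "(\<lambda>\<omega>. C / \<bar>\<tau>\<bar> * \<omega> powr (a - 2)) integrable_on {\<delta>..N}" using P by (rule has_integral_integrable)
      show "cmod (k \<omega>) \<le> C / \<bar>\<tau>\<bar> * \<omega> powr (a - 2)" if "\<omega> \<in> {\<delta>..N}" for \<omega>
        using b'[of \<omega>] that \<delta> \<tau> by (simp add: k_def norm_mult norm_divide divide_right_mono)
    qed
    also have "\<dots> = C / \<bar>\<tau>\<bar> * ((\<delta> powr (a - 1) - N powr (a - 1)) / (1 - a))"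
    proof -
      have "x / (a - 1) = - (x / (1 - a))" for x by (metis minus_diff_eq minus_divide_right)
      thus ?thesis unfolding integral_unique[OF P] by (simp add: right_diff_distrib diff_divide_distrib)
    qed
    also have "\<dots> \<le> C / \<bar>\<tau>\<bar> * (\<delta> powr (a - 1) / (1 - a))"
      using a C by (intro mult_left_mono divide_right_mono) auto
    finally have k1: "cmod (integral {\<delta>..N} k) \<le> C / \<bar>\<tau>\<bar> * (\<delta> powr (a - 1) / (1 - a))" .
    have F1: "cmod (F \<omega>) \<le> C * \<delta> powr (a - 1) / \<bar>\<tau>\<bar>" if "\<omega> \<ge> \<delta>" for \<omega>
    proof -
      have "cmod (F \<omega>) = cmod (g \<omega>) / \<bar>\<tau>\<bar>" by (simp add: F_def h_def norm_divide norm_mult)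
      also have "\<dots> \<le> C * \<omega> powr (a - 1) / \<bar>\<tau>\<bar>" using b[of \<omega>] that \<delta> by (intro divide_right_mono) auto
      also have "\<dots> \<le> C * \<delta> powr (a - 1) / \<bar>\<tau>\<bar>"
        using that \<delta> a C by (intro divide_right_mono mult_left_mono powr_mono2') auto
      finally show ?thesis .
    qed
    \<comment> \<open>With this \<delta> the boundary terms, the remaining integral and the part
      near 0 all scale with the same power of |\<tau>|.\<close>
    have td: "\<delta> powr (a - 1) / \<bar>\<tau>\<bar> = \<bar>\<tau>\<bar> powr (- a)"
      using \<tau> by (simp add: \<delta>_def powr_divide powr_diff powr_minus field_simps)
    have "integral {\<delta>..N} h = F N - F \<delta> - integral {\<delta>..N} k" using integral_unique[OF ki] by simp
    also have "cmod \<dots> \<le> cmod (F N) + cmod (F \<delta>) + cmod (integral {\<delta>..N} k)"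
      by (meson add_mono norm_triangle_ineq4 order.refl order.trans)
    also have "\<dots> \<le> C * \<delta> powr (a - 1) / \<bar>\<tau>\<bar> + C * \<delta> powr (a - 1) / \<bar>\<tau>\<bar> + C / \<bar>\<tau>\<bar> * (\<delta> powr (a - 1) / (1 - a))"
      using F1 N k1 by (intro add_mono) auto
    also have "\<dots> = C * (2 + 1 / (1 - a)) * (\<delta> powr (a - 1) / \<bar>\<tau>\<bar>)" by (simp add: algebra_simps)
    finally show "cmod (integral {\<delta>..N} h) \<le> C * (2 + 1 / (1 - a)) * \<bar>\<tau>\<bar> powr (- a)" by (simp only: td)
  qed
  have part: "cmod (LINT \<omega>|lborel. indicator {0<..real n} \<omega> *\<^sub>R h \<omega>) \<le> B" if n: "real n \<ge> \<delta>" for n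
  proof -
    have "(LINT \<omega>|lborel. indicator {0<..real n} \<omega> *\<^sub>R h \<omega>) = integral {0<..real n} h"
      using set_borel_integral_eq_integral(2)[OF hI[of "{0<..real n}"]] by (simp add: set_lebesgue_integral_def subset_eq)
    also have "\<dots> = integral {0..real n} h"
      by (rule integral_spike_set) (auto intro: negligible_subset[of "{0}"])
    also have "\<dots> = integral {0..\<delta>} h + integral {\<delta>..real n} h"
    proof -
      have "h integrable_on {0..real n}"
        by (rule Henstock_Kurzweil_Integration.integrable_combine[OF _ _ near(1) far(1)[OF n]]) (use \<delta> n in auto)
      thus ?thesis using \<delta> n by (intro Henstock_Kurzweil_Integration.integral_combine[symmetric]) auto
    qed
    also have "cmod \<dots> \<le> C * (\<delta> powr a / a) + C * (2 + 1 / (1 - a)) * \<bar>\<tau>\<bar> powr (- a)"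
      by (rule order.trans[OF norm_triangle_ineq add_mono[OF near(2) far(2)[OF n]]])
    also have "\<delta> powr a = \<bar>\<tau>\<bar> powr (- a)" using \<tau> by (simp add: \<delta>_def powr_divide powr_minus_divide)
    finally show ?thesis by (simp add: B_def algebra_simps)
  qed
  \<comment> \<open>The estimates do not depend on the upper limit, so dominated convergence carries
    them to the half-line.\<close>
  have "(\<lambda>n. LINT \<omega>|lborel. indicator {0<..real n} \<omega> *\<^sub>R h \<omega>) \<longlonglongrightarrow> (LINT \<omega>|lborel. indicator {0<..} \<omega> *\<^sub>R h \<omega>)"
  proof (rule integral_dominated_convergence[where w = "\<lambda>\<omega>. norm (indicator {0<..} \<omega> *\<^sub>R h \<omega>)"])
    show "(\<lambda>\<omega>. indicator {0<..} \<omega> *\<^sub>R h \<omega>) \<in> borel_measurable lborel"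
      using hint by (auto simp: set_integrable_def)
    show "(\<lambda>\<omega>. indicator {0<..real n} \<omega> *\<^sub>R h \<omega>) \<in> borel_measurable lborel" for n
      using hI[of "{0<..real n}"] by (auto simp: set_integrable_def subset_eq)
    show "integrable lborel (\<lambda>\<omega>. norm (indicator {0<..} \<omega> *\<^sub>R h \<omega>))"
      using hint by (auto simp: set_integrable_def simp del: norm_scaleR)
    show "AE \<omega> in lborel. (\<lambda>n. indicator {0<..real n} \<omega> *\<^sub>R h \<omega>) \<longlonglongrightarrow> indicator {0<..} \<omega> *\<^sub>R h \<omega>"
    proof (rule AE_I2)
      fix \<omega> :: real
      obtain m where m: "real m \<ge> \<omega>" using real_arch_simple by blast
      have "\<forall>\<^sub>F n in sequentially. indicator {0<..real n} \<omega> *\<^sub>R h \<omega> = indicator {0<..} \<omega> *\<^sub>R h \<omega>"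
        using eventually_ge_at_top[of m]
      proof eventually_elim
        case (elim n)
        hence "\<omega> \<le> real n" using m by linarith
        thus ?case by (simp add: indicator_def)
      qed
      thus "(\<lambda>n. indicator {0<..real n} \<omega> *\<^sub>R h \<omega>) \<longlonglongrightarrow> indicator {0<..} \<omega> *\<^sub>R h \<omega>"
        by (rule tendsto_eventually)
    qed
    show "AE \<omega> in lborel. norm (indicator {0<..real n} \<omega> *\<^sub>R h \<omega>) \<le> norm (indicator {0<..} \<omega> *\<^sub>R h \<omega>)" for n
      by (intro AE_I2) (simp add: indicator_def)
  qed
  hence lim: "(\<lambda>n. cmod (LINT \<omega>|lborel. indicator {0<..real n} \<omega> *\<^sub>R h \<omega>)) \<longlonglongrightarrow> cmod (LINT \<omega>|lborel. indicator {0<..} \<omega> *\<^sub>R h \<omega>)"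
    by (rule tendsto_norm)
  obtain m where m: "real m \<ge> \<delta>" using real_arch_simple by blast
  have "cmod (LINT \<omega>|lborel. indicator {0<..} \<omega> *\<^sub>R h \<omega>) \<le> B"
    by (rule LIMSEQ_le_const2[OF lim]) (use m part in \<open>auto intro!: exI[of _ m]\<close>)
  thus ?thesis by (simp add: B_def h_def set_lebesgue_integral_def)
qed

section \<open>Inversion of Laplace transforms along the imaginary axis\<close>

lemma exp_laplace_complex:
  assumes "Re z > 0"
  shows "(LINT t|lborel. indicator {0<..} t *\<^sub>R exp (- z * of_real t)) = 1 / z"
proof -
  have z0: "z \<noteq> 0" using assms by auto
  have e: "claplace (\<lambda>_. 1) z = (LINT t|lborel. indicator {0<..} t *\<^sub>R exp (- z * of_real t))"
    by (simp add: claplace_def)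
  have I: "integral (cbox 0 (real n)) (\<lambda>t. complex_of_real 1 * exp (- z * of_real t)) = (1 - exp (- z * of_real (real n))) / z" for n
  proof -
    have "((\<lambda>t. exp (- z * of_real t)) has_integral (- exp (- z * of_real (real n)) / z - (- exp (- z * of_real 0) / z))) {0..real n}"
    proof (rule fundamental_theorem_of_calculus)
      fix t
      have "((\<lambda>w. - exp (- z * w) / z) has_field_derivative exp (- z * of_real t)) (at (of_real t))"
        using z0 by (auto intro!: derivative_eq_intros)
      from has_vector_derivative_real_field[OF this]
      show "((\<lambda>t. - exp (- z * of_real t) / z) has_vector_derivative exp (- z * of_real t)) (at t within {0..real n})"
        by (simp add: has_vector_derivative_at_within)
    qed simp
    thus ?thesis by (simp add: integral_unique diff_divide_distrib)
  qed
  have b: "cmod (claplace (\<lambda>_. 1) z - (1 - exp (- z * of_real (real n))) / z) \<le> exp (- Re z * real n) / Re z" for n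
    using claplace_tail[of "\<lambda>_. 1" 1 "Re z" z "real n"] assms unfolding I by simp
  have "(\<lambda>n. exp (- Re z * real n) / Re z) \<longlonglongrightarrow> 0" using assms by real_asymp
  hence "(\<lambda>n. claplace (\<lambda>_. 1) z - (1 - exp (- z * of_real (real n))) / z) \<longlonglongrightarrow> 0"
    by (rule Lim_null_comparison[OF always_eventually[OF allI[OF b]]])
  moreover have "(\<lambda>n. exp (- z * of_real (real n))) \<longlonglongrightarrow> 0"
  proof (rule tendsto_norm_zero_cancel)
    have "(\<lambda>n. exp (- Re z * real n)) \<longlonglongrightarrow> 0" using assms by real_asymp
    thus "(\<lambda>n. cmod (exp (- z * of_real (real n)))) \<longlonglongrightarrow> 0" by simp
  qed
  hence "(\<lambda>n. claplace (\<lambda>_. 1) z - (1 - exp (- z * of_real (real n))) / z) \<longlonglongrightarrow> claplace (\<lambda>_. 1) z - (1 - 0) / z"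
    by (intro tendsto_intros z0)
  ultimately have "claplace (\<lambda>_. 1) z - (1 - 0) / z = 0" by (rule LIMSEQ_unique[rotated])
  thus ?thesis by (simp add: e)
qed

text \<open>A class of Mikhlin type: z f'(z) obeys the same bound as f(z), which is what a single
  integration by parts consumes. Differentiability is demanded on the imaginary axis too, except at
  0, where the powers branch.\<close>

definition symbol_class :: "real \<Rightarrow> real \<Rightarrow> (complex \<Rightarrow> complex) \<Rightarrow> bool" where
  "symbol_class a \<eta> f \<longleftrightarrow> (\<exists>f' C. C \<ge> 0 \<and> (\<forall>z. Re z \<ge> 0 \<and> z \<noteq> 0 \<longrightarrow>
     (f has_field_derivative f' z) (at z) \<and> cmod (f z) \<le> C * decay_weight a \<eta> (cmod z) \<and>
     cmod z * cmod (f' z) \<le> C * decay_weight a \<eta> (cmod z)))"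

text \<open>The Bromwich integral on the line of real part 0, without the point 0, where symbols may
  be singular.\<close>

definition boundary_inverse :: "(complex \<Rightarrow> complex) \<Rightarrow> real \<Rightarrow> complex" where
  "boundary_inverse f t = 1 / (2 * pi) * (LINT \<omega>:-{0}|lborel. f (\<i> * of_real \<omega>) * cis (\<omega> * t))"

context
  fixes f f' :: "complex \<Rightarrow> complex" and a \<eta> C :: real
  assumes a: "0 < a" "a < 1" and eta: "\<eta> > 0" and C: "C \<ge> 0"
    and fd: "\<And>z. Re z \<ge> 0 \<Longrightarrow> z \<noteq> 0 \<Longrightarrow> (f has_field_derivative f' z) (at z)"
    and fb: "\<And>z. Re z \<ge> 0 \<Longrightarrow> z \<noteq> 0 \<Longrightarrow> cmod (f z) \<le> C * decay_weight a \<eta> (cmod z)"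
    and fb': "\<And>z. Re z \<ge> 0 \<Longrightarrow> z \<noteq> 0 \<Longrightarrow> cmod z * cmod (f' z) \<le> C * decay_weight a \<eta> (cmod z)"
begin

lemma boundary_derivative:
  assumes "\<omega> \<noteq> 0"
  shows "((\<lambda>\<omega>. f (\<i> * of_real \<omega>)) has_vector_derivative \<i> * f' (\<i> * of_real \<omega>)) (at \<omega>)"
proof -
  have "((\<lambda>\<omega>. \<i> * complex_of_real \<omega>) has_vector_derivative \<i> * of_real 1) (at \<omega>)"
    by (auto intro!: derivative_eq_intros has_vector_derivative_mult_right has_vector_derivative_of_real)
  from field_vector_diff_chain_at[OF this fd[of "\<i> * of_real \<omega>"]] show ?thesis
    using assms by (simp add: o_def)
qed

lemma shifted_continuous:
  assumes "e \<ge> 0"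
  shows "continuous_on (if e = 0 then -{0} else UNIV) (\<lambda>\<omega>. f (of_real e + \<i> * of_real \<omega>))"
proof (rule continuous_at_imp_continuous_on, rule ballI)
  fix \<omega> :: real assume w: "\<omega> \<in> (if e = 0 then -{0} else UNIV)"
  have "of_real e + \<i> * complex_of_real \<omega> \<noteq> 0" using w by (auto simp: complex_eq_iff split: if_splits)
  hence "isCont f (of_real e + \<i> * complex_of_real \<omega>)" using fd assms by (intro DERIV_isCont[OF fd]) auto
  moreover have "isCont (\<lambda>\<omega>. of_real e + \<i> * complex_of_real \<omega>) \<omega>"
    by (intro continuous_intros)
  ultimately show "isCont (\<lambda>\<omega>. f (of_real e + \<i> * of_real \<omega>)) \<omega>"
    by (rule isCont_o2[rotated])
qed

lemma shifted_measurable: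
  assumes "e \<ge> 0"
  shows "(\<lambda>\<omega>. indicator (-{0}) \<omega> *\<^sub>R f (of_real e + \<i> * of_real \<omega>)) \<in> borel_measurable borel"
  by (intro borel_measurable_continuous_on_indicator continuous_on_subset[OF shifted_continuous[OF assms]]) auto

lemma boundary_measurable [measurable]:
  "(\<lambda>\<omega>. indicator (-{0}) \<omega> *\<^sub>R f (\<i> * of_real \<omega>)) \<in> borel_measurable borel"
  using shifted_measurable[of 0] by simp

text \<open>Moving to the right increases the modulus and the weight is decreasing, so one
  integrable majorant serves all vertical lines.\<close>

lemma shifted_bound:
  assumes "e \<ge> 0" "\<omega> \<noteq> 0"
  shows "cmod (f (of_real e + \<i> * of_real \<omega>)) \<le> C * decay_weight a \<eta> \<bar>\<omega>\<bar>"
proof -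
  have z: "of_real e + \<i> * complex_of_real \<omega> \<noteq> 0" using assms by (auto simp: complex_eq_iff)
  have "cmod (f (of_real e + \<i> * of_real \<omega>)) \<le> C * decay_weight a \<eta> (cmod (of_real e + \<i> * of_real \<omega>))"
    using z assms by (intro fb) auto
  also have "\<dots> \<le> C * decay_weight a \<eta> \<bar>\<omega>\<bar>"
    using assms abs_Im_le_cmod[of "of_real e + \<i> * of_real \<omega>"] a eta C
    by (intro mult_left_mono decay_weight_antimono) auto
  finally show ?thesis .
qed

lemma boundary_bound: "\<omega> \<noteq> 0 \<Longrightarrow> cmod (f (\<i> * of_real \<omega>)) \<le> C * decay_weight a \<eta> \<bar>\<omega>\<bar>"
  using shifted_bound[of 0] by simp

lemma weight_integrable: "integrable lborel (\<lambda>\<omega>. C * decay_weight a \<eta> \<bar>\<omega>\<bar>)"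
  by (intro integrable_mult_right decay_weight_integrable a eta)

lemma boundary_indicator_bound: "norm (indicator (-{0}) \<omega> *\<^sub>R f (\<i> * of_real \<omega>)) \<le> C * decay_weight a \<eta> \<bar>\<omega>\<bar>"
  using boundary_bound[of \<omega>] C by (cases "\<omega> = 0") (auto simp: decay_weight_nonneg)

lemma boundary_integrable: "integrable lborel (\<lambda>\<omega>. indicator (-{0}) \<omega> *\<^sub>R f (\<i> * of_real \<omega>))"
  by (rule Bochner_Integration.integrable_bound[OF weight_integrable])
     (use boundary_indicator_bound in \<open>auto intro!: AE_I2 order.trans[OF _ abs_ge_self]\<close>)

lemma cis_measurable: "(\<lambda>\<omega>. cis (\<omega> * t)) \<in> borel_measurable borel"
  by (intro borel_measurable_continuous_onI continuous_intros)

lemma boundary_inverse_integrable: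
  "integrable lborel (\<lambda>\<omega>. indicator (-{0}) \<omega> *\<^sub>R (f (\<i> * of_real \<omega>) * cis (\<omega> * t)))"
proof (rule Bochner_Integration.integrable_bound[OF boundary_integrable])
  have "(\<lambda>\<omega>. (indicator (-{0}) \<omega> *\<^sub>R f (\<i> * of_real \<omega>)) * cis (\<omega> * t)) \<in> borel_measurable lborel"
    using cis_measurable by measurable
  thus "(\<lambda>\<omega>. indicator (-{0}) \<omega> *\<^sub>R (f (\<i> * of_real \<omega>) * cis (\<omega> * t))) \<in> borel_measurable lborel" by simp
qed (auto simp: norm_mult)

lemma boundary_inverse_bounded: "cmod (boundary_inverse f t) \<le> 1 / (2 * pi) * (LINT \<omega>|lborel. C * decay_weight a \<eta> \<bar>\<omega>\<bar>)"
proof -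
  have "cmod (LINT \<omega>:-{0}|lborel. f (\<i> * of_real \<omega>) * cis (\<omega> * t)) \<le> (LINT \<omega>|lborel. C * decay_weight a \<eta> \<bar>\<omega>\<bar>)"
    unfolding set_lebesgue_integral_def
    using boundary_indicator_bound C
    by (intro order.trans[OF integral_norm_bound integral_mono'] weight_integrable) (auto simp: norm_mult decay_weight_nonneg)
  hence "1 / (2 * pi) * cmod (LINT \<omega>:-{0}|lborel. f (\<i> * of_real \<omega>) * cis (\<omega> * t)) \<le> 1 / (2 * pi) * (LINT \<omega>|lborel. C * decay_weight a \<eta> \<bar>\<omega>\<bar>)"
    by (intro mult_left_mono) auto
  thus ?thesis by (simp add: boundary_inverse_def norm_mult norm_divide)
qed

lemma boundary_inverse_continuous: "continuous_on S (boundary_inverse f)"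
proof (rule continuous_at_imp_continuous_on, rule ballI)
  fix t
  show "isCont (boundary_inverse f) t"
    unfolding continuous_at_sequentially o_def
  proof (intro allI impI)
    fix X assume X: "X \<longlonglongrightarrow> t"
    have "(\<lambda>n. LINT \<omega>|lborel. indicator (-{0}) \<omega> *\<^sub>R (f (\<i> * of_real \<omega>) * cis (\<omega> * X n))) \<longlonglongrightarrow>
       (LINT \<omega>|lborel. indicator (-{0}) \<omega> *\<^sub>R (f (\<i> * of_real \<omega>) * cis (\<omega> * t)))"
    proof (rule integral_dominated_convergence[OF _ _ weight_integrable])
      show "AE \<omega> in lborel. (\<lambda>n. indicator (-{0}) \<omega> *\<^sub>R (f (\<i> * of_real \<omega>) * cis (\<omega> * X n))) \<longlonglongrightarrow>
           indicator (-{0}) \<omega> *\<^sub>R (f (\<i> * of_real \<omega>) * cis (\<omega> * t))"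
        by (intro AE_I2 tendsto_intros X)
      show "AE \<omega> in lborel. norm (indicator (-{0}) \<omega> *\<^sub>R (f (\<i> * of_real \<omega>) * cis (\<omega> * X n))) \<le> C * decay_weight a \<eta> \<bar>\<omega>\<bar>" for n
        using boundary_indicator_bound by (intro AE_I2) (simp add: norm_mult)
    qed (use boundary_inverse_integrable in auto)
    thus "(\<lambda>n. boundary_inverse f (X n)) \<longlonglongrightarrow> boundary_inverse f t"
      unfolding boundary_inverse_def set_lebesgue_integral_def by (intro tendsto_mult tendsto_const)
  qed
qed

text \<open>The line is cut at 0; \<sigma> = -1 encodes the reflection of the negative half, and
  \<open>oscillatory_integral_bound\<close> applies to both halves.\<close>

lemma boundary_inverse_decay:
  assumes t: "t > 0"
  shows "cmod (boundary_inverse f t) \<le> C * (1 / a + 2 + 1 / (1 - a)) * t powr (- a)"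
proof -
  let ?B = "C * (1 / a + 2 + 1 / (1 - a)) * t powr (- a)"
  have half: "cmod (LINT \<omega>:{0<..}|lborel. f (\<i> * of_real (\<sigma> * \<omega>)) * cis (\<omega> * (\<sigma> * t))) \<le> ?B" if s: "\<sigma> \<in> {-1, 1}" for \<sigma>
  proof -
    have I1: "set_integrable lborel {0<..} (\<lambda>\<omega>. f (\<i> * of_real (\<sigma> * \<omega>)) * cis (\<omega> * (\<sigma> * r)))" for r
    proof -
      have "integrable lborel (\<lambda>\<omega>. indicator (-{0}) (0 + \<sigma> * \<omega>) *\<^sub>R (f (\<i> * of_real (0 + \<sigma> * \<omega>)) * cis ((0 + \<sigma> * \<omega>) * r)))"
        using s by (intro lborel_integrable_real_affine boundary_inverse_integrable) auto
      hence "set_integrable lborel (-{0}) (\<lambda>\<omega>. f (\<i> * of_real (\<sigma> * \<omega>)) * cis (\<omega> * (\<sigma> * r)))"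
        unfolding set_integrable_def by (rule back_subst[of "integrable lborel"]) (use s in \<open>auto simp: indicator_def mult_ac\<close>)
      thus ?thesis by (rule set_integrable_subset) auto
    qed
    have "cmod (LINT \<omega>:{0<..}|lborel. f (\<i> * of_real (\<sigma> * \<omega>)) * cis (\<omega> * (\<sigma> * t))) \<le> C * (1 / a + 2 + 1 / (1 - a)) * \<bar>\<sigma> * t\<bar> powr (- a)"
    proof (rule oscillatory_integral_bound[OF a _ C, where g' = "\<lambda>\<omega>. of_real \<sigma> * (\<i> * f' (\<i> * of_real (\<sigma> * \<omega>)))"])
      show "\<sigma> * t \<noteq> 0" using s t by auto
      show "set_integrable lborel {0<..} (\<lambda>\<omega>. f (\<i> * of_real (\<sigma> * \<omega>)))" using I1[of 0] by simp
      fix \<omega> :: real assume w: "\<omega> > 0"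
      have nz: "\<sigma> * \<omega> \<noteq> 0" using s w by auto
      have "((\<lambda>\<omega>. \<sigma> * \<omega>) has_vector_derivative \<sigma>) (at \<omega>)"
        unfolding has_real_derivative_iff_has_vector_derivative[symmetric] by (auto intro!: derivative_eq_intros)
      from vector_diff_chain_at[OF this boundary_derivative[OF nz]]
      show "((\<lambda>\<omega>. f (\<i> * of_real (\<sigma> * \<omega>))) has_vector_derivative of_real \<sigma> * (\<i> * f' (\<i> * of_real (\<sigma> * \<omega>)))) (at \<omega>)"
        by (simp add: o_def scaleR_conv_of_real)
      have ab: "\<bar>\<sigma> * \<omega>\<bar> = \<omega>" "\<bar>\<sigma>\<bar> = 1" using s w by auto
      have "cmod (f (\<i> * of_real (\<sigma> * \<omega>))) \<le> C * decay_weight a \<eta> \<omega>" using boundary_bound[OF nz] unfolding ab .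
      also have "\<dots> \<le> C * \<omega> powr (a - 1)" by (intro mult_left_mono decay_weight_le C)
      finally show "cmod (f (\<i> * of_real (\<sigma> * \<omega>))) \<le> C * \<omega> powr (a - 1)" .
      have "\<omega> * cmod (f' (\<i> * of_real (\<sigma> * \<omega>))) \<le> C * decay_weight a \<eta> \<omega>"
        using fb'[of "\<i> * of_real (\<sigma> * \<omega>)"] nz ab by (simp add: norm_mult abs_mult)
      also have "\<dots> \<le> C * \<omega> powr (a - 1)" by (intro mult_left_mono decay_weight_le C)
      finally have "cmod (f' (\<i> * of_real (\<sigma> * \<omega>))) \<le> C * \<omega> powr (a - 1) / \<omega>" using w by (simp add: field_simps)
      also have "\<dots> = C * \<omega> powr (a - 2)" using w powr_diff[of \<omega> "a - 1" 1] by simp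
      finally show "cmod (of_real \<sigma> * (\<i> * f' (\<i> * of_real (\<sigma> * \<omega>)))) \<le> C * \<omega> powr (a - 2)"
        using ab by (simp add: norm_mult)
    qed
    moreover have "\<bar>\<sigma> * t\<bar> = t" using s t by auto
    ultimately show ?thesis by simp
  qed
  have e: "(LINT \<omega>:{..<0}|lborel. f (\<i> * of_real \<omega>) * cis (\<omega> * t)) =
     (LINT \<omega>:{0<..}|lborel. f (\<i> * of_real (-1 * \<omega>)) * cis (\<omega> * (-1 * t)))"
    unfolding set_lebesgue_integral_def
    by (subst lborel_integral_real_affine[of "-1" _ 0])
       (auto intro!: Bochner_Integration.integral_cong simp: indicator_def)
  have i: "set_integrable lborel (-{0}) (\<lambda>\<omega>. f (\<i> * of_real \<omega>) * cis (\<omega> * t))"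
    using boundary_inverse_integrable by (simp add: set_integrable_def)
  have U: "-{0} = {0<..} \<union> {..<0::real}" by auto
  have i1: "set_integrable lborel {0<..} (\<lambda>\<omega>. f (\<i> * of_real \<omega>) * cis (\<omega> * t))"
    and i2: "set_integrable lborel {..<0} (\<lambda>\<omega>. f (\<i> * of_real \<omega>) * cis (\<omega> * t))"
    by (rule set_integrable_subset[OF i]; auto)+
  have split: "(LINT \<omega>:-{0}|lborel. f (\<i> * of_real \<omega>) * cis (\<omega> * t)) =
    (LINT \<omega>:{0<..}|lborel. f (\<i> * of_real (1 * \<omega>)) * cis (\<omega> * (1 * t))) + (LINT \<omega>:{0<..}|lborel. f (\<i> * of_real (-1 * \<omega>)) * cis (\<omega> * (-1 * t)))"
    unfolding e[symmetric] U using set_integral_Un[OF _ i1 i2] by (simp add: disjoint_iff)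
  have "cmod (LINT \<omega>:-{0}|lborel. f (\<i> * of_real \<omega>) * cis (\<omega> * t)) \<le> ?B + ?B"
    unfolding split by (rule order.trans[OF norm_triangle_ineq add_mono[OF half half]]) auto
  hence "1 / (2 * pi) * cmod (LINT \<omega>:-{0}|lborel. f (\<i> * of_real \<omega>) * cis (\<omega> * t)) \<le> 1 / (2 * pi) * (?B + ?B)"
    by (intro mult_left_mono) auto
  also have "\<dots> = (1 / pi) * ?B" by (simp add: field_simps)
  also have "\<dots> \<le> 1 * ?B" using a C pi_gt3 by (intro mult_right_mono mult_nonneg_nonneg add_nonneg_nonneg) auto
  finally show ?thesis by (simp add: boundary_inverse_def norm_mult norm_divide)
qed

text \<open>Cauchy's formula for f(w + e) / (w - s) on the rectangle with opposite corners -iM and M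
  + iM. The shift e > 0 keeps the singularity of f off the contour. Each of the three outer sides
  has length at most 2 M and integrand at most 2 C / M^2, whence 12 C / M.\<close>

lemma shifted_rectangle_Cauchy:
  assumes s: "s > 0" and e: "e > 0" and M: "M \<ge> 1" "M \<ge> 2 * s"
  shows "cmod ((LINT \<omega>:{-M..M}|lborel. f (of_real e + \<i> * of_real \<omega>) / (of_real s - \<i> * of_real \<omega>)) - 2 * pi * f (of_real (s + e))) \<le> 12 * C / M"
proof -
  define k where "k = (\<lambda>w. f (w + of_real e) / (w - of_real s))"
  define a1 where "a1 = Complex 0 (- M)"
  define a2 where "a2 = Complex M (- M)"
  define a3 where "a3 = Complex M M"
  define a4 where "a4 = Complex 0 M"
  note ad = a1_def a2_def a3_def a4_def
  define S where "S = {z. Re z > - e}"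
  have S: "convex S" "open S" unfolding S_def by (rule convex_halfspace_Re_gt, rule open_halfspace_Re_gt)
  have hol: "(\<lambda>w. f (w + of_real e)) holomorphic_on S"
    unfolding holomorphic_on_def field_differentiable_def
  proof (intro ballI exI)
    fix z assume "z \<in> S"
    hence "Re (z + of_real e) > 0" by (simp add: S_def)
    moreover from this have "z + of_real e \<noteq> 0" by (auto simp: complex_eq_iff)
    ultimately have "(f has_field_derivative f' (z + of_real e)) (at (z + of_real e))" by (intro fd) auto
    thus "((\<lambda>w. f (w + of_real e)) has_field_derivative f' (z + of_real e)) (at z within S)"
      by (auto simp: DERIV_shift intro: has_field_derivative_at_within)
  qed
  have sbox: "of_real s \<in> box a1 a3" using s M by (auto simp: in_box_complex_iff ad)
  have pi: "path_image (rectpath a1 a3) \<subseteq> S - {of_real s}"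
  proof -
    have "path_image (rectpath a1 a3) = cbox a1 a3 - box a1 a3"
      using M by (intro path_image_rectpath_cbox_minus_box) (auto simp: ad)
    moreover have "cbox a1 a3 \<subseteq> S" using e by (auto simp: in_cbox_complex_iff ad S_def)
    ultimately show ?thesis using sbox by auto
  qed
  have "(k has_contour_integral (2 * pi * \<i> * winding_number (rectpath a1 a3) (of_real s) * f (of_real s + of_real e))) (rectpath a1 a3)"
    unfolding k_def
    using Cauchy_integral_formula_convex_simple[OF S(1) hol, of "of_real s" "rectpath a1 a3"] pi s e S
    by (auto simp: interior_open S_def)
  hence CI: "contour_integral (rectpath a1 a3) k = 2 * pi * \<i> * f (of_real (s + e))"
    using winding_number_rectpath[OF sbox] by (simp add: contour_integral_unique)
  have kc: "continuous_on (S - {of_real s}) k" unfolding k_def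
    by (intro continuous_intros continuous_on_subset[OF holomorphic_on_imp_continuous_on[OF hol]]) auto
  have pieq: "path_image (rectpath a1 a3) = closed_segment a1 a2 \<union> closed_segment a2 a3 \<union> closed_segment a3 a4 \<union> closed_segment a4 a1"
    unfolding rectpath_def Let_def by (simp add: path_image_join Un_assoc ad)
  have seg: "continuous_on (closed_segment a1 a2) k" "continuous_on (closed_segment a2 a3) k"
     "continuous_on (closed_segment a3 a4) k" "continuous_on (closed_segment a4 a1) k"
    using pi unfolding pieq by (auto intro!: continuous_on_subset[OF kc])
  note ci = contour_integrable_continuous_linepath[OF seg(1)] contour_integrable_continuous_linepath[OF seg(2)]
    contour_integrable_continuous_linepath[OF seg(3)] contour_integrable_continuous_linepath[OF seg(4)]
  have "rectpath a1 a3 = linepath a1 a2 +++ linepath a2 a3 +++ linepath a3 a4 +++ linepath a4 a1"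
    by (simp add: rectpath_def Let_def ad)
  hence sum: "contour_integral (rectpath a1 a3) k = contour_integral (linepath a1 a2) k + (contour_integral (linepath a2 a3) k +
      (contour_integral (linepath a3 a4) k + contour_integral (linepath a4 a1) k))"
    using ci by (simp add: contour_integrable_joinI)
  \<comment> \<open>At modulus M or more, f is at most C / M; and |w - s| \<ge> M / 2, which is the
    purpose of M \<ge> 2 s.\<close>
  have kb: "cmod (k w) \<le> 2 * C / M\<^sup>2" if w: "Re w \<ge> 0" "M \<le> \<bar>Im w\<bar> \<or> M \<le> Re w" for w
  proof -
    have w1: "cmod (w + of_real e) \<ge> M" using w e abs_Im_le_cmod[of "w + of_real e"] abs_Re_le_cmod[of "w + of_real e"] by auto
    have w2: "cmod (w - of_real s) \<ge> M / 2" using w M abs_Im_le_cmod[of "w - of_real s"] abs_Re_le_cmod[of "w - of_real s"] by auto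
    have "w + of_real e \<noteq> 0" using w1 M by auto
    hence "cmod (f (w + of_real e)) \<le> C * decay_weight a \<eta> (cmod (w + of_real e))" using w e by (intro fb) auto
    also have "\<dots> \<le> C * decay_weight a \<eta> M" using w1 M a eta C by (intro mult_left_mono decay_weight_antimono) auto
    also have "\<dots> \<le> C * M powr (- 1 - \<eta>)" by (intro mult_left_mono decay_weight_le C)
    also have "\<dots> \<le> C * M powr (- 1)" using M eta C by (intro mult_left_mono powr_mono) auto
    also have "\<dots> = C / M" using M by (simp add: powr_minus_divide)
    finally have "cmod (k w) \<le> (C / M) / (M / 2)"
      unfolding k_def norm_divide using w2 M C by (intro frac_le) auto
    thus ?thesis using M by (simp add: power2_eq_square field_simps)
  qed
  have B0: "0 \<le> 2 * C / M\<^sup>2" using C by simp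
  have E1: "cmod (contour_integral (linepath a1 a2) k) \<le> 2 * C / M\<^sup>2 * cmod (a2 - a1)"
    using M by (intro contour_integral_bound_linepath ci B0 kb) (auto simp: closed_segment_same_Im closed_segment_eq_real_ivl ad split: if_splits)
  have E2: "cmod (contour_integral (linepath a2 a3) k) \<le> 2 * C / M\<^sup>2 * cmod (a3 - a2)"
    using M by (intro contour_integral_bound_linepath ci B0 kb) (auto simp: closed_segment_same_Re ad)
  have E3: "cmod (contour_integral (linepath a3 a4) k) \<le> 2 * C / M\<^sup>2 * cmod (a4 - a3)"
    using M by (intro contour_integral_bound_linepath ci B0 kb) (auto simp: closed_segment_same_Im closed_segment_eq_real_ivl ad split: if_splits)
  have len: "cmod (a2 - a1) \<le> 2 * M" "cmod (a3 - a2) \<le> 2 * M" "cmod (a4 - a3) \<le> 2 * M"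
    using M cmod_le[of "a2 - a1"] cmod_le[of "a3 - a2"] cmod_le[of "a4 - a3"] by (auto simp: ad)
  let ?E = "contour_integral (linepath a1 a2) k + contour_integral (linepath a2 a3) k + contour_integral (linepath a3 a4) k"
  have E: "cmod ?E \<le> 12 * C / M"
  proof -
    have "cmod ?E \<le> 2 * C / M\<^sup>2 * (2 * M) + 2 * C / M\<^sup>2 * (2 * M) + 2 * C / M\<^sup>2 * (2 * M)"
      by (intro order.trans[OF norm_add3_le] add_mono order.trans[OF E1] order.trans[OF E2] order.trans[OF E3] mult_left_mono len B0)
    also have "\<dots> = 12 * C / M" using M by (simp add: power2_eq_square field_simps)
    finally show ?thesis .
  qed
  let ?J = "LINT \<omega>:{-M..M}|lborel. f (of_real e + \<i> * of_real \<omega>) / (of_real s - \<i> * of_real \<omega>)"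
  have Jc: "continuous_on {-M..M} (\<lambda>\<omega>. f (of_real e + \<i> * of_real \<omega>) / (of_real s - \<i> * of_real \<omega>))"
  proof (intro continuous_intros)
    show "continuous_on {-M..M} (\<lambda>\<omega>. f (of_real e + \<i> * of_real \<omega>))"
      using shifted_continuous[of e] e by (auto elim: continuous_on_subset)
    show "\<forall>\<omega>\<in>{-M..M}. complex_of_real s - \<i> * of_real \<omega> \<noteq> 0" using s by (auto simp: complex_eq_iff)
  qed
  \<comment> \<open>The left side runs downwards, and 1 / (i\<omega> - s) = - 1 / (s - i\<omega>).
    The two signs cancel, so this side contributes i times the wanted integral.\<close>
  have "contour_integral (linepath a4 a1) k = - contour_integral (linepath a1 a4) k"
    by (rule contour_integral_reverse_linepath[OF seg(4)])
  also have "contour_integral (linepath a1 a4) k = \<i> * integral {-M..M} (\<lambda>x. k (Complex 0 x))"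
    using M by (intro contour_integral_linepath_same_Re) (auto simp: ad)
  also have "integral {-M..M} (\<lambda>x. k (Complex 0 x)) = integral {-M..M} (\<lambda>\<omega>. - (f (of_real e + \<i> * of_real \<omega>) / (of_real s - \<i> * of_real \<omega>)))"
  proof (rule Henstock_Kurzweil_Integration.integral_cong)
    fix x
    have "Complex 0 x = \<i> * of_real x" by (simp add: complex_eq_iff)
    thus "k (Complex 0 x) = - (f (of_real e + \<i> * of_real x) / (of_real s - \<i> * of_real x))"
      unfolding k_def by (metis add.commute minus_diff_eq minus_divide_right)
  qed
  also have "\<dots> = - ?J"
    using set_borel_integral_eq_integral(2)[OF borel_integrable_atLeastAtMost'[OF Jc]] by simp
  finally have "2 * pi * \<i> * f (of_real (s + e)) = ?E + \<i> * ?J" using CI sum by (simp add: add.assoc)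
  hence "\<i> * (?J - 2 * pi * f (of_real (s + e))) = - ?E" by (simp add: algebra_simps)
  hence "cmod (\<i> * (?J - 2 * pi * f (of_real (s + e)))) = cmod ?E" by (simp only: norm_minus_cancel)
  hence "cmod (?J - 2 * pi * f (of_real (s + e))) = cmod ?E" by (simp only: norm_mult norm_ii mult_1)
  thus ?thesis using E by simp
qed

text \<open>In the rectangle formula M = n + 1 and e = 1 / (n + 1) go to their limits together; the
  majorant of \<open>shifted_bound\<close> divided by s permits dominated convergence.\<close>

lemma half_plane_Cauchy:
  assumes s: "s > 0"
  shows "(LINT \<omega>:-{0}|lborel. f (\<i> * of_real \<omega>) / (of_real s - \<i> * of_real \<omega>)) = 2 * pi * f (of_real s)"
proof -
  let ?g = "\<lambda>e \<omega>. f (of_real e + \<i> * of_real \<omega>) / (of_real s - \<i> * of_real \<omega>)"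
  let ?e = "\<lambda>n. inverse (real (Suc n))"
  let ?J = "\<lambda>n. LINT \<omega>:{- real (Suc n)..real (Suc n)}|lborel. ?g (?e n) \<omega>"
  have nz: "complex_of_real s - \<i> * of_real \<omega> \<noteq> 0" for \<omega> using s by (auto simp: complex_eq_iff)
  have md: "(\<lambda>\<omega>. 1 / (complex_of_real s - \<i> * of_real \<omega>)) \<in> borel_measurable borel"
    by (intro borel_measurable_continuous_onI continuous_intros) (use nz in auto)
  have den: "cmod (1 / (complex_of_real s - \<i> * of_real \<omega>)) \<le> 1 / s" for \<omega>
    using abs_Re_le_cmod[of "complex_of_real s - \<i> * of_real \<omega>"] s by (simp add: norm_divide frac_le)
  have gb: "cmod (?g e \<omega>) \<le> 1 / s * (C * decay_weight a \<eta> \<bar>\<omega>\<bar>)" if "e \<ge> 0" "\<omega> \<noteq> 0" for e \<omega>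
  proof -
    have "cmod (?g e \<omega>) = cmod (1 / (complex_of_real s - \<i> * of_real \<omega>)) * cmod (f (of_real e + \<i> * of_real \<omega>))"
      by (simp add: norm_divide)
    also have "\<dots> \<le> 1 / s * (C * decay_weight a \<eta> \<bar>\<omega>\<bar>)"
      using shifted_bound[OF that] s by (intro mult_mono den) auto
    finally show ?thesis .
  qed
  have m: "(\<lambda>\<omega>. indicator (-{0}) \<omega> *\<^sub>R ?g e \<omega>) \<in> borel_measurable lborel" if "e \<ge> 0" for e
  proof -
    have "(\<lambda>\<omega>. (indicator (-{0}) \<omega> *\<^sub>R f (of_real e + \<i> * of_real \<omega>)) * (1 / (of_real s - \<i> * of_real \<omega>))) \<in> borel_measurable borel"
      by (intro borel_measurable_times md shifted_measurable[OF that])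
    thus ?thesis by (simp add: scaleR_conv_of_real)
  qed
  have m': "(\<lambda>\<omega>. indicator {- real (Suc n)..real (Suc n)} \<omega> *\<^sub>R ?g (?e n) \<omega>) \<in> borel_measurable lborel" for n
  proof -
    have "continuous_on UNIV (\<lambda>\<omega>. f (of_real (?e n) + \<i> * of_real \<omega>))"
      using shifted_continuous[of "?e n"] by simp
    hence "continuous_on UNIV (?g (?e n))" using nz by (intro continuous_intros) auto
    hence "?g (?e n) \<in> borel_measurable borel" by (rule borel_measurable_continuous_onI)
    hence "(\<lambda>\<omega>. indicator {- real (Suc n)..real (Suc n)} \<omega> *\<^sub>R ?g (?e n) \<omega>) \<in> borel_measurable borel"
      by (intro borel_measurable_scaleR borel_measurable_indicator) auto
    thus ?thesis by simp
  qed
  have lim1: "?J \<longlonglongrightarrow> (LINT \<omega>:-{0}|lborel. ?g 0 \<omega>)"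
    unfolding set_lebesgue_integral_def
  proof (rule integral_dominated_convergence[where w = "\<lambda>\<omega>. 1 / s * (C * decay_weight a \<eta> \<bar>\<omega>\<bar>)"])
    show "(\<lambda>\<omega>. indicator (-{0}) \<omega> *\<^sub>R ?g 0 \<omega>) \<in> borel_measurable lborel" by (rule m) simp
    show "integrable lborel (\<lambda>\<omega>. 1 / s * (C * decay_weight a \<eta> \<bar>\<omega>\<bar>))"
      by (intro integrable_mult_right decay_weight_integrable a eta)
    show "AE \<omega> in lborel. norm (indicator {- real (Suc n)..real (Suc n)} \<omega> *\<^sub>R ?g (?e n) \<omega>) \<le> 1 / s * (C * decay_weight a \<eta> \<bar>\<omega>\<bar>)" for n
      using AE_lborel_singleton[of 0]
    proof eventually_elim
      case (elim \<omega>)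
      have "0 \<le> 1 / s * (C * decay_weight a \<eta> \<bar>\<omega>\<bar>)" using s C by (simp add: decay_weight_nonneg)
      thus ?case using gb[of "?e n" \<omega>] elim by (simp add: indicator_def)
    qed
    show "AE \<omega> in lborel. (\<lambda>n. indicator {- real (Suc n)..real (Suc n)} \<omega> *\<^sub>R ?g (?e n) \<omega>) \<longlonglongrightarrow> indicator (-{0}) \<omega> *\<^sub>R ?g 0 \<omega>"
      using AE_lborel_singleton[of 0]
    proof eventually_elim
      case (elim \<omega>)
      have "isCont f (of_real 0 + \<i> * of_real \<omega>)" using elim by (intro DERIV_isCont[OF fd]) auto
      moreover have "(\<lambda>n. complex_of_real (?e n) + \<i> * of_real \<omega>) \<longlonglongrightarrow> of_real 0 + \<i> * of_real \<omega>"
        by (intro tendsto_intros LIMSEQ_inverse_real_of_nat)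
      ultimately have "(\<lambda>n. f (of_real (?e n) + \<i> * of_real \<omega>)) \<longlonglongrightarrow> f (of_real 0 + \<i> * of_real \<omega>)"
        by (rule isCont_tendsto_compose)
      hence "(\<lambda>n. ?g (?e n) \<omega>) \<longlonglongrightarrow> ?g 0 \<omega>" by (intro tendsto_divide tendsto_const nz)
      moreover have "(\<lambda>n. indicat_real {- real (Suc n)..real (Suc n)} \<omega>) \<longlonglongrightarrow> 1"
      proof (rule tendsto_eventually)
        obtain m where m: "real m \<ge> \<bar>\<omega>\<bar>" using real_arch_simple by blast
        show "\<forall>\<^sub>F n in sequentially. indicat_real {- real (Suc n)..real (Suc n)} \<omega> = 1"
          using eventually_ge_at_top[of m] by eventually_elim (use m in \<open>auto simp: indicator_def\<close>)
      qed
      ultimately have "(\<lambda>n. indicator {- real (Suc n)..real (Suc n)} \<omega> *\<^sub>R ?g (?e n) \<omega>) \<longlonglongrightarrow> 1 *\<^sub>R ?g 0 \<omega>"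
        by (intro tendsto_scaleR)
      thus ?case using elim by simp
    qed
  qed (rule m')
  have "isCont f (of_real (s + 0))" using s by (intro DERIV_isCont[OF fd]) auto
  moreover have "(\<lambda>n. complex_of_real (s + ?e n)) \<longlonglongrightarrow> of_real (s + 0)"
    by (intro tendsto_intros LIMSEQ_inverse_real_of_nat)
  ultimately have "(\<lambda>n. f (of_real (s + ?e n))) \<longlonglongrightarrow> f (of_real (s + 0))" by (rule isCont_tendsto_compose)
  hence lim2: "(\<lambda>n. 2 * pi * f (of_real (s + ?e n))) \<longlonglongrightarrow> 2 * pi * f (of_real (s + 0))" by (intro tendsto_intros)
  have "\<forall>\<^sub>F n in sequentially. cmod (?J n - 2 * pi * f (of_real (s + ?e n))) \<le> 12 * C / real (Suc n)"
  proof -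
    obtain m where m: "real m \<ge> 2 * s" using real_arch_simple by blast
    show ?thesis using eventually_ge_at_top[of m]
    proof eventually_elim
      case (elim n)
      show ?case using m elim by (intro shifted_rectangle_Cauchy s) auto
    qed
  qed
  moreover have "(\<lambda>n. 12 * C / real (Suc n)) \<longlonglongrightarrow> 0" by real_asymp
  ultimately have "(\<lambda>n. ?J n - 2 * pi * f (of_real (s + ?e n))) \<longlonglongrightarrow> 0" by (rule Lim_null_comparison)
  moreover have "(\<lambda>n. ?J n - 2 * pi * f (of_real (s + ?e n))) \<longlonglongrightarrow> (LINT \<omega>:-{0}|lborel. ?g 0 \<omega>) - 2 * pi * f (of_real (s + 0))"
    by (intro tendsto_diff lim1 lim2)
  ultimately have "(LINT \<omega>:-{0}|lborel. ?g 0 \<omega>) - 2 * pi * f (of_real (s + 0)) = 0"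
    by (rule LIMSEQ_unique[rotated])
  thus ?thesis by simp
qed

text \<open>After exchanging the integrals the inner one over t is 1 / (s - i\<omega>), and the rest
  is \<open>half_plane_Cauchy\<close>.\<close>

lemma boundary_inverse_laplace:
  assumes s: "s > 0"
  shows "(LINT t|lborel. indicator {0<..} t *\<^sub>R (boundary_inverse f t * of_real (exp (- s * t)))) = f (of_real s)"
proof -
  define F where "F = (\<lambda>\<omega>. indicator (-{0}) \<omega> *\<^sub>R f (\<i> * of_real \<omega>))"
  have [measurable]: "F \<in> borel_measurable borel" unfolding F_def by (rule boundary_measurable)
  have Fi: "integrable lborel F" unfolding F_def by (rule boundary_integrable)
  let ?z = "\<lambda>\<omega>. complex_of_real s - \<i> * of_real \<omega>"
  let ?G = "\<lambda>\<omega> t. F \<omega> * (indicator {0<..} t *\<^sub>R exp (- ?z \<omega> * of_real t))"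
  \<comment> \<open>The modulus does not depend on \<omega>, so the double integral converges
    absolutely as a product.\<close>
  have ge: "cmod (indicator {0<..} t *\<^sub>R exp (- ?z \<omega> * of_real t)) = indicator {0<..} t * exp (- s * t)" for t \<omega>
    by (simp add: indicator_def)
  have zm: "(\<lambda>t. indicator {0<..} t *\<^sub>R exp (- ?z \<omega> * of_real t)) \<in> borel_measurable borel" for \<omega>
    by (intro borel_measurable_continuous_on_indicator continuous_intros) auto
  have zi: "integrable lborel (\<lambda>t. indicator {0<..} t *\<^sub>R exp (- ?z \<omega> * of_real t))" for \<omega>
    by (rule Bochner_Integration.integrable_bound[OF exp_integrable[OF s]]) (use zm in \<open>auto simp: ge intro!: AE_I2\<close>)
  have *: "integrable (lborel \<Otimes>\<^sub>M lborel) (case_prod ?G)"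
  proof (rule lborel_pair.Fubini_integrable)
    show "case_prod ?G \<in> borel_measurable (lborel \<Otimes>\<^sub>M lborel)" by measurable
    have "(LINT t|lborel. norm (case_prod ?G (\<omega>, t))) = cmod (F \<omega>) * (LINT t|lborel. indicator {0<..} t * exp (- s * t))" for \<omega>
      unfolding prod.case norm_mult ge by (rule integral_mult_right_zero)
    thus "integrable lborel (\<lambda>\<omega>. LINT t|lborel. norm (case_prod ?G (\<omega>, t)))"
      using Fi by simp
    show "AE \<omega> in lborel. integrable lborel (\<lambda>t. case_prod ?G (\<omega>, t))"
      unfolding prod.case by (intro AE_I2 integrable_mult_right zi)
  qed
  have i1: "(LINT t|lborel. ?G \<omega> t) = indicator (-{0}) \<omega> *\<^sub>R (f (\<i> * of_real \<omega>) / ?z \<omega>)" for \<omega>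
  proof -
    have "(LINT t|lborel. ?G \<omega> t) = F \<omega> * (LINT t|lborel. indicator {0<..} t *\<^sub>R exp (- ?z \<omega> * of_real t))"
      by (rule integral_mult_right_zero)
    also have "\<dots> = F \<omega> * (1 / ?z \<omega>)" by (subst exp_laplace_complex) (use s in auto)
    finally show ?thesis by (simp add: F_def scaleR_conv_of_real)
  qed
  have i2: "(LINT \<omega>|lborel. ?G \<omega> t) = 2 * pi * (indicator {0<..} t *\<^sub>R (boundary_inverse f t * of_real (exp (- s * t))))" for t
  proof -
    have "?G \<omega> t = (indicator {0<..} t *\<^sub>R of_real (exp (- s * t))) * (indicator (-{0}) \<omega> *\<^sub>R (f (\<i> * of_real \<omega>) * cis (\<omega> * t)))" for \<omega>
      by (simp add: F_def cis_conv_exp exp_of_real[symmetric] exp_add[symmetric] algebra_simps)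
    hence "(LINT \<omega>|lborel. ?G \<omega> t) = (indicator {0<..} t *\<^sub>R of_real (exp (- s * t))) * (LINT \<omega>|lborel. indicator (-{0}) \<omega> *\<^sub>R (f (\<i> * of_real \<omega>) * cis (\<omega> * t)))"
      by (simp only: integral_mult_right_zero)
    moreover have "(LINT \<omega>|lborel. indicator (-{0}) \<omega> *\<^sub>R (f (\<i> * of_real \<omega>) * cis (\<omega> * t))) = 2 * pi * boundary_inverse f t"
      by (simp add: boundary_inverse_def set_lebesgue_integral_def)
    ultimately show ?thesis by (simp only: scaleR_conv_of_real mult_ac)
  qed
  have "2 * pi * (LINT t|lborel. indicator {0<..} t *\<^sub>R (boundary_inverse f t * of_real (exp (- s * t)))) = (LINT t|lborel. LINT \<omega>|lborel. ?G \<omega> t)"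
    unfolding i2 by (rule integral_mult_right_zero[symmetric])
  also have "\<dots> = (LINT \<omega>|lborel. LINT t|lborel. ?G \<omega> t)" by (rule lborel_pair.Fubini_integral[OF *])
  also have "\<dots> = 2 * pi * f (of_real s)" unfolding i1 using half_plane_Cauchy[OF s] by (simp add: set_lebesgue_integral_def)
  finally show ?thesis by simp
qed

end

text \<open>Lerch's theorem. In the variable \<tau> = exp(-t) the transform at s = c + 2 + k is the
  k-th moment of a continuous function on [0, 1]. So all moments vanish, and by Weierstrass that
  function is orthogonal to itself.\<close>

lemma laplace_unique:
  fixes d :: "real \<Rightarrow> real"
  assumes dc: "continuous_on {0..} d" and db: "\<And>t. t \<ge> 0 \<Longrightarrow> \<bar>d t\<bar> \<le> C * exp (c * t)"
    and L: "\<And>s. s > c \<Longrightarrow> laplace d s = 0" and t: "t \<ge> 0"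
  shows "d t = 0"
proof -
  \<comment> \<open>The factor exp(-(c + 1) t) leaves a decay like exp(-t), which makes p continuous
    at \<tau> = 0.\<close>
  define \<phi> where "\<phi> = (\<lambda>t. d t * exp (- (c + 1) * t))"
  define p where "p = (\<lambda>\<tau>. if \<tau> = 0 then 0 else \<phi> (- ln \<tau>))"
  have C: "C \<ge> 0" using db[of 0] by simp
  have \<phi>c: "continuous_on {0..} \<phi>" unfolding \<phi>_def by (intro continuous_intros dc)
  have \<phi>b: "\<bar>\<phi> t\<bar> \<le> C * exp (- t)" if "t \<ge> 0" for t
  proof -
    have "\<bar>\<phi> t\<bar> \<le> C * exp (c * t) * exp (- (c + 1) * t)"
      unfolding \<phi>_def abs_mult using db[OF that] by (simp add: mult_right_mono)
    also have "\<dots> = C * exp (- t)" by (simp add: mult.assoc exp_add[symmetric] algebra_simps)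
    finally show ?thesis .
  qed
  have pe: "p (exp (- t)) = \<phi> t" for t by (simp add: p_def)
  have pb: "\<bar>p \<tau>\<bar> \<le> C * \<tau>" if "0 \<le> \<tau>" "\<tau> \<le> 1" for \<tau>
    using that \<phi>b[of "- ln \<tau>"] C by (auto simp: p_def)
  have pc: "continuous_on {0..1} p"
  proof (rule continuous_on_eq_continuous_within[THEN iffD2], rule ballI)
    fix \<tau> :: real assume tau: "\<tau> \<in> {0..1}"
    show "continuous (at \<tau> within {0..1}) p"
    proof (cases "\<tau> = 0")
      case True
      have "((\<lambda>\<tau>. C * \<tau>) \<longlongrightarrow> C * 0) (at 0 within {0..1})" by (intro tendsto_intros)
      moreover have "\<forall>\<^sub>F \<tau> in at 0 within {0..1}. norm (p \<tau>) \<le> C * \<tau>"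
        using pb by (auto simp: eventually_at_filter)
      ultimately have "(p \<longlongrightarrow> 0) (at 0 within {0..1})" by (metis Lim_null_comparison mult_zero_right)
      thus ?thesis using True by (simp add: continuous_within p_def)
    next
      case False
      hence t0: "\<tau> > 0" using tau by simp
      have "continuous_on {0<..1} (\<lambda>\<tau>. \<phi> (- ln \<tau>))"
        by (intro continuous_on_compose2[OF \<phi>c] continuous_intros) auto
      hence "continuous_on {0<..1} p"
        by (rule continuous_on_eq) (auto simp: p_def)
      hence "continuous (at \<tau> within {0<..1}) p" using t0 tau by (simp add: continuous_on_eq_continuous_within)
      moreover have "at \<tau> within {0<..1} = at \<tau> within {0..1}"
        using t0 by (intro at_within_nhd[of _ "{0<..}"]) auto
      ultimately show ?thesis by (simp add: continuous_within)
    qed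
  qed
  have I: "integrable lborel (\<lambda>t. indicator {0<..} t * d t * exp (- s * t))" if "s > c" for s
    by (rule laplace_integrable[OF dc db that])
  let ?w = "\<lambda>t. indicator {0<..} t * (\<phi> t * exp (- t))"
  have we: "?w t * exp (- t) ^ k = indicator {0<..} t * d t * exp (- (c + 2 + real k) * t)" for t k
    by (simp add: \<phi>_def exp_of_nat_mult[symmetric] mult.assoc exp_add[symmetric] algebra_simps)
  have wI: "integrable lborel (\<lambda>t. ?w t * exp (- t) ^ k)" "(LINT t|lborel. ?w t * exp (- t) ^ k) = 0" for k
    unfolding we using I[of "c + 2 + real k"] L[of "c + 2 + real k"] by (auto simp: laplace_def)
  have w0: "integrable lborel ?w" using wI(1)[of 0] by simp
  have sq: "integrable lborel (\<lambda>t. ?w t * \<phi> t)"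
  proof (rule Bochner_Integration.integrable_bound[OF integrable_mult_right[OF w0, of C]])
    have [measurable]: "(\<lambda>t. indicator {0<..} t * \<phi> t) \<in> borel_measurable borel"
      using loc_integrable_continuous[OF \<phi>c] by (simp add: loc_integrable_def)
    have "(\<lambda>t. (indicator {0<..} t * \<phi> t) * (indicator {0<..} t * \<phi> t) * exp (- t)) \<in> borel_measurable lborel" by measurable
    thus "(\<lambda>t. ?w t * \<phi> t) \<in> borel_measurable lborel"
      by (rule back_subst[of "\<lambda>g. g \<in> borel_measurable lborel"]) (auto simp: indicator_def)
    have "\<bar>\<phi> t\<bar> \<le> C" if "t > 0" for t
    proof -
      have "\<bar>\<phi> t\<bar> \<le> C * exp (- t)" using \<phi>b that by simp
      also have "\<dots> \<le> C * 1" using C that by (intro mult_left_mono) auto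
      finally show ?thesis by simp
    qed
    thus "AE t in lborel. norm (?w t * \<phi> t) \<le> norm (C * ?w t)"
      using C by (intro AE_I2) (auto simp: indicator_def abs_mult mult.commute intro!: mult_right_mono)
  qed
  \<comment> \<open>Since \<phi>(t) = p(exp(-t)), a polynomial in exp(-t) approximates it within e,
    and this polynomial integrates to 0 against the weight.\<close>
  have small: "(LINT t|lborel. ?w t * \<phi> t) \<le> e * (LINT t|lborel. \<bar>?w t\<bar>)" if e: "e > 0" for e
  proof -
    obtain g where g: "real_polynomial_function g" "\<And>x. x \<in> {0..1} \<Longrightarrow> \<bar>p x - g x\<bar> < e"
      using Stone_Weierstrass_real_polynomial_function[OF compact_Icc pc e] by blast
    obtain b n where gs: "g = (\<lambda>x. \<Sum>i\<le>n. b i * x ^ i)"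
      using g(1) unfolding real_polynomial_function_iff_sum by blast
    have wg: "?w t * g (exp (- t)) = (\<Sum>i\<le>n. b i * (?w t * exp (- t) ^ i))" for t
      unfolding gs sum_distrib_left by (intro sum.cong) auto
    have gi: "integrable lborel (\<lambda>t. ?w t * g (exp (- t)))" unfolding wg
      by (intro Bochner_Integration.integrable_sum integrable_mult_right wI)
    have "(LINT t|lborel. ?w t * g (exp (- t))) = (\<Sum>i\<le>n. b i * (LINT t|lborel. ?w t * exp (- t) ^ i))"
      unfolding wg by (subst Bochner_Integration.integral_sum) (auto intro!: integrable_mult_right wI simp del: mult_eq_0_iff)
    hence g0: "(LINT t|lborel. ?w t * g (exp (- t))) = 0" unfolding wI(2) by simp
    have "(LINT t|lborel. ?w t * \<phi> t) = (LINT t|lborel. ?w t * \<phi> t - ?w t * g (exp (- t)))"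
      using sq gi g0 by simp
    also have "\<dots> \<le> (LINT t|lborel. e * \<bar>?w t\<bar>)"
    proof (rule integral_mono)
      fix t
      show "?w t * \<phi> t - ?w t * g (exp (- t)) \<le> e * \<bar>?w t\<bar>"
      proof (cases "t > 0")
        case True
        have "?w t * \<phi> t - ?w t * g (exp (- t)) = ?w t * (p (exp (- t)) - g (exp (- t)))"
          by (simp add: pe right_diff_distrib)
        also have "\<dots> \<le> \<bar>?w t\<bar> * \<bar>p (exp (- t)) - g (exp (- t))\<bar>" by (metis abs_ge_self abs_mult)
        also have "\<dots> \<le> \<bar>?w t\<bar> * e" using g(2)[of "exp (- t)"] True by (intro mult_left_mono) auto
        finally show ?thesis by (simp add: mult.commute)
      qed simp
    qed (use sq gi w0 in auto)
    also have "\<dots> = e * (LINT t|lborel. \<bar>?w t\<bar>)" by simp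
    finally show ?thesis .
  qed
  have "(LINT t|lborel. ?w t * \<phi> t) \<le> 0"
  proof (rule field_le_epsilon)
    fix e :: real assume e: "e > 0"
    define A where "A = (LINT t|lborel. \<bar>?w t\<bar>)"
    have A: "A \<ge> 0" unfolding A_def by (intro integral_nonneg_AE) simp
    have "(LINT t|lborel. ?w t * \<phi> t) \<le> e / (A + 1) * A"
      by (rule small[folded A_def]) (use e A in simp)
    also have "\<dots> \<le> e" using e A by (simp add: field_simps)
    finally show "(LINT t|lborel. ?w t * \<phi> t) \<le> 0 + e" by simp
  qed
  hence sq0: "(LINT t|lborel. ?w t * \<phi> t) \<le> 0" .
  have nn: "0 \<le> \<phi> t * exp (- t) * \<phi> t" for t
  proof -
    have sq: "\<phi> t * exp (- t) * \<phi> t = exp (- t) * (\<phi> t)\<^sup>2" by (simp add: power2_eq_square)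
    show ?thesis unfolding sq by simp
  qed
  \<comment> \<open>Beyond t, so that the interval is nondegenerate even for t = 0.\<close>
  define T where "T = t + 1"
  have cT: "continuous_on {0..T} (\<lambda>t. \<phi> t * exp (- t) * \<phi> t)"
    by (intro continuous_intros continuous_on_subset[OF \<phi>c]) auto
  have "integral {0..T} (\<lambda>t. \<phi> t * exp (- t) * \<phi> t) = integral {0<..T} (\<lambda>t. \<phi> t * exp (- t) * \<phi> t)"
    by (rule integral_spike_set) (auto intro: negligible_subset[of "{0}"])
  also have "\<dots> = (LINT t:{0<..T}|lborel. \<phi> t * exp (- t) * \<phi> t)"
  proof (rule set_borel_integral_eq_integral(2)[symmetric])
    show "set_integrable lborel {0<..T} (\<lambda>t. \<phi> t * exp (- t) * \<phi> t)"
      by (rule set_integrable_subset[OF borel_integrable_atLeastAtMost'[OF cT]]) auto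
  qed
  also have "\<dots> \<le> (LINT t|lborel. ?w t * \<phi> t)"
    unfolding set_lebesgue_integral_def
    using nn by (intro integral_mono'[OF sq]) (auto simp: indicator_def)
  finally have "integral {0..T} (\<lambda>t. \<phi> t * exp (- t) * \<phi> t) \<le> 0" using sq0 by simp
  moreover have "integral {0..T} (\<lambda>t. \<phi> t * exp (- t) * \<phi> t) \<ge> 0"
    by (intro Henstock_Kurzweil_Integration.integral_nonneg integrable_continuous_interval cT nn)
  ultimately have z: "integral {0..T} (\<lambda>t. \<phi> t * exp (- t) * \<phi> t) = 0" by simp
  have "\<phi> t * exp (- t) * \<phi> t = 0"
    using integral_eq_0_iff[OF cT _ nn] z t by (auto simp: T_def)
  thus ?thesis by (simp add: \<phi>_def)
qed

section \<open>Asymptotic stability\<close>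

lemma symbol_class_cmult:
  assumes "symbol_class a \<eta> f"
  shows "symbol_class a \<eta> (\<lambda>z. c * f z)"
proof -
  obtain f' C where f: "C \<ge> 0" "\<And>z. Re z \<ge> 0 \<and> z \<noteq> 0 \<Longrightarrow> (f has_field_derivative f' z) (at z) \<and>
      cmod (f z) \<le> C * decay_weight a \<eta> (cmod z) \<and> cmod z * cmod (f' z) \<le> C * decay_weight a \<eta> (cmod z)"
    using assms unfolding symbol_class_def by metis
  show ?thesis unfolding symbol_class_def
  proof (intro exI[of _ "\<lambda>z. c * f' z"] exI[of _ "cmod c * C"] conjI allI impI)
    fix z assume z: "Re z \<ge> 0 \<and> z \<noteq> 0"
    note fz = f(2)[OF z]
    show "((\<lambda>z. c * f z) has_field_derivative c * f' z) (at z)" using fz by (intro DERIV_cmult) simp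
    have "cmod c * cmod (f z) \<le> cmod c * (C * decay_weight a \<eta> (cmod z))" using fz by (intro mult_left_mono) auto
    thus "cmod (c * f z) \<le> cmod c * C * decay_weight a \<eta> (cmod z)" by (simp add: norm_mult mult.assoc)
    have "cmod c * (cmod z * cmod (f' z)) \<le> cmod c * (C * decay_weight a \<eta> (cmod z))" using fz by (intro mult_left_mono) auto
    thus "cmod z * cmod (c * f' z) \<le> cmod c * C * decay_weight a \<eta> (cmod z)" by (simp add: norm_mult mult.assoc mult.left_commute)
  qed (use f in auto)
qed

lemma symbol_class_add:
  assumes "symbol_class a \<eta> f" "symbol_class a \<eta> g"
  shows "symbol_class a \<eta> (\<lambda>z. f z + g z)"
proof -
  obtain f' C where f: "C \<ge> 0" "\<And>z. Re z \<ge> 0 \<and> z \<noteq> 0 \<Longrightarrow> (f has_field_derivative f' z) (at z) \<and>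
      cmod (f z) \<le> C * decay_weight a \<eta> (cmod z) \<and> cmod z * cmod (f' z) \<le> C * decay_weight a \<eta> (cmod z)"
    using assms(1) unfolding symbol_class_def by metis
  obtain g' D where g: "D \<ge> 0" "\<And>z. Re z \<ge> 0 \<and> z \<noteq> 0 \<Longrightarrow> (g has_field_derivative g' z) (at z) \<and>
      cmod (g z) \<le> D * decay_weight a \<eta> (cmod z) \<and> cmod z * cmod (g' z) \<le> D * decay_weight a \<eta> (cmod z)"
    using assms(2) unfolding symbol_class_def by metis
  show ?thesis unfolding symbol_class_def
  proof (intro exI[of _ "\<lambda>z. f' z + g' z"] exI[of _ "C + D"] conjI allI impI)
    fix z assume z: "Re z \<ge> 0 \<and> z \<noteq> 0"
    note fz = f(2)[OF z] and gz = g(2)[OF z]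
    show "((\<lambda>z. f z + g z) has_field_derivative f' z + g' z) (at z)" using fz gz by (intro DERIV_add) auto
    have "cmod (f z + g z) \<le> C * decay_weight a \<eta> (cmod z) + D * decay_weight a \<eta> (cmod z)"
      using fz gz by (intro order.trans[OF norm_triangle_ineq] add_mono) auto
    thus "cmod (f z + g z) \<le> (C + D) * decay_weight a \<eta> (cmod z)" by (simp only: distrib_right)
    have "cmod z * cmod (f' z + g' z) \<le> cmod z * (cmod (f' z) + cmod (g' z))"
      by (intro mult_left_mono norm_triangle_ineq) auto
    also have "\<dots> \<le> C * decay_weight a \<eta> (cmod z) + D * decay_weight a \<eta> (cmod z)"
      unfolding distrib_left using fz gz by (intro add_mono) auto
    finally show "cmod z * cmod (f' z + g' z) \<le> (C + D) * decay_weight a \<eta> (cmod z)" by (simp only: distrib_right)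
  qed (use f g in auto)
qed

lemma symbol_class_0: "symbol_class a \<eta> (\<lambda>z. 0)"
  unfolding symbol_class_def by (intro exI[of _ "\<lambda>z. 0"] exI[of _ 0]) auto

text \<open>The denominator is at least 1, which is used up to r = 1, and at least r^d, which is
  used beyond. In each range a - 1 \<ge> -1 - \<eta> tells which power is the minimum.\<close>

lemma powr_quotient_le_decay_weight:
  assumes "r > 0" "p \<ge> a - 1" "p - d \<le> - 1 - \<eta>" "a - 1 \<ge> - 1 - \<eta>"
  shows "r powr p / (1 + r powr d) \<le> decay_weight a \<eta> r"
proof (cases "r \<le> 1")
  case True
  have "r powr p / (1 + r powr d) \<le> r powr p / 1" by (intro divide_left_mono) (auto simp: add_pos_nonneg)
  also have "\<dots> \<le> r powr (a - 1)" using assms True by (simp add: powr_mono')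
  finally have 1: "r powr p / (1 + r powr d) \<le> r powr (a - 1)" .
  moreover have "r powr (a - 1) \<le> r powr (- 1 - \<eta>)" using assms True by (intro powr_mono') auto
  ultimately show ?thesis by (simp add: decay_weight_def)
next
  case False
  have "r powr p / (1 + r powr d) \<le> r powr p / r powr d" using assms by (intro divide_left_mono) (auto simp: add_pos_nonneg)
  also have "\<dots> = r powr (p - d)" by (simp add: powr_diff)
  also have "\<dots> \<le> r powr (- 1 - \<eta>)" using assms False by (intro powr_mono) auto
  finally have 1: "r powr p / (1 + r powr d) \<le> r powr (- 1 - \<eta>)" .
  moreover have "r powr (- 1 - \<eta>) \<le> r powr (a - 1)" using assms False by (intro powr_mono) auto
  ultimately show ?thesis by (simp add: decay_weight_def)
qed

text \<open>For f = z^p / D the logarithmic derivative gives z f' = f (p - z D' / D), where |f| is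
  at most 1 / m times the weight and the bracket at most |p| + K / m. The constant covers both
  bounds.\<close>

lemma symbol_class_powr_quotient:
  fixes D D' :: "complex \<Rightarrow> complex"
  assumes m: "m > 0" and K: "K \<ge> 0"
    and dD: "\<And>z. Re z \<ge> 0 \<Longrightarrow> z \<noteq> 0 \<Longrightarrow> (D has_field_derivative D' z) (at z)"
    and bD: "\<And>z. Re z \<ge> 0 \<Longrightarrow> z \<noteq> 0 \<Longrightarrow> m * (1 + cmod z powr d) \<le> cmod (D z)"
    and bD': "\<And>z. Re z \<ge> 0 \<Longrightarrow> z \<noteq> 0 \<Longrightarrow> cmod z * cmod (D' z) \<le> K * (1 + cmod z powr d)"
    and p: "p \<ge> a - 1" "p - d \<le> - 1 - \<eta>" "a - 1 \<ge> - 1 - \<eta>"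
  shows "symbol_class a \<eta> (\<lambda>z. z powr of_real p / D z)"
  unfolding symbol_class_def
proof (intro exI[of _ "\<lambda>z. ((of_real p * z powr (of_real p - 1)) * D z - z powr of_real p * D' z) / (D z * D z)"]
      exI[of _ "(1 + \<bar>p\<bar>) / m + K / m\<^sup>2"] conjI allI impI)
  show "0 \<le> (1 + \<bar>p\<bar>) / m + K / m\<^sup>2" using m K by simp
  fix z :: complex assume z': "Re z \<ge> 0 \<and> z \<noteq> 0"
  hence z: "Re z \<ge> 0" "z \<noteq> 0" by auto
  define r where "r = cmod z"
  define w where "w = 1 + r powr d"
  have r: "r > 0" using z by (simp add: r_def)
  have w: "w > 0" by (simp add: w_def add_pos_nonneg)
  have Dz: "m * w \<le> cmod (D z)" using bD[OF z] by (simp add: w_def r_def)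
  have mw: "m * w > 0" using m w by simp
  have Dn: "D z \<noteq> 0" using Dz mw by auto
  have zn: "z \<notin> \<real>\<^sub>\<le>\<^sub>0" using z by (auto simp: complex_nonpos_Reals_iff complex_eq_iff)
  show "((\<lambda>z. z powr of_real p / D z) has_field_derivative
      ((of_real p * z powr (of_real p - 1)) * D z - z powr of_real p * D' z) / (D z * D z)) (at z)"
    by (intro DERIV_divide has_field_derivative_powr zn dD z Dn)
  have wt: "r powr p / w \<le> decay_weight a \<eta> r"
    unfolding w_def by (rule powr_quotient_le_decay_weight[OF r p])
  have nz: "cmod (z powr of_real p) = r powr p" by (simp add: norm_powr_real_powr' r_def)
  have zp: "z powr (of_real p - 1) * z = z powr of_real p"
    using z by (simp add: powr_diff)
  have "cmod (z powr of_real p / D z) \<le> r powr p / (m * w)"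
    unfolding norm_divide nz using Dz mw by (intro divide_left_mono) (auto intro: mult_pos_pos less_le_trans)
  also have "\<dots> = (1 / m) * (r powr p / w)" by simp
  finally have b1: "cmod (z powr of_real p / D z) \<le> (1 / m) * (r powr p / w)" .
  also have "\<dots> \<le> ((1 + \<bar>p\<bar>) / m + K / m\<^sup>2) * (r powr p / w)"
    using m K w by (intro mult_right_mono) (auto simp: add_divide_distrib)
  also have "\<dots> \<le> ((1 + \<bar>p\<bar>) / m + K / m\<^sup>2) * decay_weight a \<eta> r"
    using m K by (intro mult_left_mono wt) auto
  finally show "cmod (z powr of_real p / D z) \<le> ((1 + \<bar>p\<bar>) / m + K / m\<^sup>2) * decay_weight a \<eta> (cmod z)"
    by (simp add: r_def)
  have "z * (((of_real p * z powr (of_real p - 1)) * D z - z powr of_real p * D' z) / (D z * D z)) =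
      of_real p * (z powr of_real p / D z) - (z powr of_real p / D z) * (z * D' z / D z)"
    unfolding zp[symmetric] using Dn by (simp add: field_simps)
  hence "cmod z * cmod (((of_real p * z powr (of_real p - 1)) * D z - z powr of_real p * D' z) / (D z * D z)) =
      cmod (of_real p * (z powr of_real p / D z) - (z powr of_real p / D z) * (z * D' z / D z))"
    by (metis norm_mult)
  also have "\<dots> \<le> \<bar>p\<bar> * cmod (z powr of_real p / D z) + cmod (z powr of_real p / D z) * cmod (z * D' z / D z)"
    using norm_triangle_ineq4[of "of_real p * (z powr of_real p / D z)" "(z powr of_real p / D z) * (z * D' z / D z)"]
    by (simp only: norm_mult norm_of_real)
  also have "\<dots> \<le> \<bar>p\<bar> * ((1 / m) * (r powr p / w)) + ((1 / m) * (r powr p / w)) * (K / m)"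
  proof (intro add_mono mult_left_mono mult_mono b1)
    have "cmod (z * D' z / D z) = cmod z * cmod (D' z) / cmod (D z)" by (simp add: norm_mult norm_divide)
    also have "\<dots> \<le> (K * w) / (m * w)"
      using bD'[OF z] Dz mw K w by (intro frac_le) (auto simp: w_def r_def)
    also have "\<dots> = K / m" using w by simp
    finally show "cmod (z * D' z / D z) \<le> K / m" .
  qed (use m w in auto)
  also have "\<dots> = (\<bar>p\<bar> / m + K / m\<^sup>2) * (r powr p / w)" using m w by (simp add: power2_eq_square field_simps)
  also have "\<dots> \<le> ((1 + \<bar>p\<bar>) / m + K / m\<^sup>2) * (r powr p / w)"
    using m w by (intro mult_right_mono) (auto simp: divide_right_mono)
  also have "\<dots> \<le> ((1 + \<bar>p\<bar>) / m + K / m\<^sup>2) * decay_weight a \<eta> r"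
    using m K by (intro mult_left_mono wt) auto
  finally show "cmod z * cmod (((of_real p * z powr (of_real p - 1)) * D z - z powr of_real p * D' z) / (D z * D z))
     \<le> ((1 + \<bar>p\<bar>) / m + K / m\<^sup>2) * decay_weight a \<eta> (cmod z)"
    by (simp add: r_def)
qed

text \<open>Solutions are real, so the real part of the boundary inverse is taken; at real s this
  commutes with the transform. One constant B serves the bound and the rate.\<close>

lemma symbol_class_inverse:
  assumes "0 < a" "a < 1" "\<eta> > 0" "symbol_class a \<eta> f"
  obtains w B where "B \<ge> 0" "\<And>t. \<bar>w t\<bar> \<le> B" "\<And>t. t > 0 \<Longrightarrow> \<bar>w t\<bar> \<le> B * t powr (- a)"
    "continuous_on {0..} w" "\<And>s. s > 0 \<Longrightarrow> laplace w s = Re (f (of_real s))"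
proof -
  obtain f' C where f: "C \<ge> 0" "\<And>z. Re z \<ge> 0 \<and> z \<noteq> 0 \<Longrightarrow> (f has_field_derivative f' z) (at z) \<and>
      cmod (f z) \<le> C * decay_weight a \<eta> (cmod z) \<and> cmod z * cmod (f' z) \<le> C * decay_weight a \<eta> (cmod z)"
    using assms(4) unfolding symbol_class_def by metis
  hence f2: "\<And>z. Re z \<ge> 0 \<Longrightarrow> z \<noteq> 0 \<Longrightarrow> (f has_field_derivative f' z) (at z)"
    "\<And>z. Re z \<ge> 0 \<Longrightarrow> z \<noteq> 0 \<Longrightarrow> cmod (f z) \<le> C * decay_weight a \<eta> (cmod z)"
    "\<And>z. Re z \<ge> 0 \<Longrightarrow> z \<noteq> 0 \<Longrightarrow> cmod z * cmod (f' z) \<le> C * decay_weight a \<eta> (cmod z)" by auto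
  note ctx = assms(1-3) f(1) f2
  define W where "W = boundary_inverse f"
  define w where "w = (\<lambda>t. Re (W t))"
  define B1 where "B1 = 1 / (2 * pi) * (LINT \<omega>|lborel. C * decay_weight a \<eta> \<bar>\<omega>\<bar>)"
  define B2 where "B2 = C * (1 / a + 2 + 1 / (1 - a))"
  have b1: "cmod (W t) \<le> B1" for t unfolding W_def B1_def by (rule boundary_inverse_bounded[OF ctx])
  have b2: "cmod (W t) \<le> B2 * t powr (- a)" if "t > 0" for t unfolding W_def B2_def by (rule boundary_inverse_decay[OF ctx that])
  have Wc: "continuous_on S W" for S unfolding W_def by (rule boundary_inverse_continuous[OF ctx])
  show ?thesis
  proof (rule that[of "max B1 B2" w])
    show "max B1 B2 \<ge> 0" using order.trans[OF norm_ge_zero b1[of 0]] by simp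
    show "\<bar>w t\<bar> \<le> max B1 B2" for t using abs_Re_le_cmod[of "W t"] b1[of t] by (simp add: w_def)
    show "\<bar>w t\<bar> \<le> max B1 B2 * t powr (- a)" if "t > 0" for t
    proof -
      have "\<bar>w t\<bar> \<le> B2 * t powr (- a)" using abs_Re_le_cmod[of "W t"] b2[OF that] by (simp add: w_def)
      also have "\<dots> \<le> max B1 B2 * t powr (- a)" by (intro mult_right_mono) auto
      finally show ?thesis .
    qed
    show "continuous_on {0..} w" unfolding w_def by (intro continuous_intros Wc)
    fix s :: real assume s: "s > 0"
    have m: "(\<lambda>t. indicator {0<..} t *\<^sub>R (W t * of_real (exp (- s * t)))) \<in> borel_measurable borel"
      by (intro borel_measurable_continuous_on_indicator continuous_intros Wc) auto
    have i: "integrable lborel (\<lambda>t. indicator {0<..} t *\<^sub>R (W t * of_real (exp (- s * t))))"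
    proof (rule Bochner_Integration.integrable_bound[OF integrable_mult_right[OF exp_integrable[OF s], of B1]])
      show "(\<lambda>t. indicator {0<..} t *\<^sub>R (W t * of_real (exp (- s * t)))) \<in> borel_measurable lborel" using m by simp
      show "AE t in lborel. norm (indicator {0<..} t *\<^sub>R (W t * of_real (exp (- s * t)))) \<le> norm (B1 * (indicator {0<..} t * exp (- s * t)))"
      proof (intro AE_I2)
        fix t
        have "cmod (W t) * exp (- s * t) \<le> \<bar>B1\<bar> * exp (- s * t)" using b1[of t] by (intro mult_right_mono) auto
        thus "norm (indicator {0<..} t *\<^sub>R (W t * of_real (exp (- s * t)))) \<le> norm (B1 * (indicator {0<..} t * exp (- s * t)))"
          by (simp add: norm_mult abs_mult indicator_def)
      qed
    qed
    have "laplace w s = (LINT t|lborel. Re (indicator {0<..} t *\<^sub>R (W t * of_real (exp (- s * t)))))"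
      unfolding laplace_def w_def by (intro Bochner_Integration.integral_cong) (auto simp: indicator_def)
    also have "\<dots> = Re (LINT t|lborel. indicator {0<..} t *\<^sub>R (W t * of_real (exp (- s * t))))"
      by (rule integral_Re[OF i])
    also have "\<dots> = Re (f (of_real s))" unfolding W_def by (rule arg_cong[OF boundary_inverse_laplace[OF ctx s]])
    finally show "laplace w s = Re (f (of_real s))" .
  qed
qed

section \<open>Symbols of the solutions and their decay\<close>

context
  fixes \<alpha> \<beta> \<gamma> q1 q2 q :: real
  assumes par: "\<gamma> > 0" "0 < q1" "q1 < q2" "q2 < q" "q \<le> 2"
    and nr: "\<And>z. Re z \<ge> 0 \<Longrightarrow> z \<noteq> 0 \<Longrightarrow> char_fun \<alpha> \<beta> \<gamma> q1 q2 q z \<noteq> 0"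
begin

abbreviation (input) "CF \<equiv> char_fun \<alpha> \<beta> \<gamma> q1 q2 q"

definition char_fun_deriv :: "complex \<Rightarrow> complex" where
  "char_fun_deriv s = of_real q * s powr (of_real q - 1) + of_real \<alpha> * (of_real q1 * s powr (of_real q1 - 1)) + of_real \<beta> * (of_real q2 * s powr (of_real q2 - 1))"

lemma closed_half_plane_slit: "Re z \<ge> 0 \<Longrightarrow> z \<noteq> 0 \<Longrightarrow> z \<notin> \<real>\<^sub>\<le>\<^sub>0"
  by (auto simp: complex_nonpos_Reals_iff complex_eq_iff)

lemma char_fun_has_derivative: "Re z \<ge> 0 \<Longrightarrow> z \<noteq> 0 \<Longrightarrow> (CF has_field_derivative char_fun_deriv z) (at z)"
  unfolding char_fun_deriv_def by (intro char_fun_derivative par closed_half_plane_slit)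

lemma powr_le_1_plus:
  fixes r e d :: real
  assumes "r > 0" "0 \<le> e" "e \<le> d"
  shows "r powr e \<le> 1 + r powr d"
proof (cases "r \<le> 1")
  case True
  have "r powr e \<le> 1" using assms True powr_mono2[of e r 1] by simp
  thus ?thesis by (simp add: add_increasing2)
next
  case False
  hence "r powr e \<le> r powr d" using assms by (intro powr_mono) auto
  thus ?thesis by simp
qed

text \<open>The modulus is at least \<gamma> / 2 near 0 and at least |z|^q / 2 far out. On the
  compact half-annulus between, the function is continuous without zeros, so a minimum is attained
  and positive.\<close>

lemma char_fun_lower_bound:
  obtains m where "m > 0" "\<And>z. Re z \<ge> 0 \<Longrightarrow> z \<noteq> 0 \<Longrightarrow> m * (1 + cmod z powr q) \<le> cmod (CF z)"
proof -
  define A where "A = 1 + \<bar>\<alpha>\<bar> + \<bar>\<beta>\<bar>"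
  define B where "B = \<bar>\<alpha>\<bar> + \<bar>\<beta>\<bar> + \<bar>\<gamma>\<bar>"
  have A: "A > 0" and B: "B > 0" using par by (auto simp: A_def B_def)
  \<comment> \<open>Up to this radius A |z|^q1 \<le> \<gamma> / 2; from the radius R on, B |z|^q2
    \<le> |z|^q / 2.\<close>
  define r0 where "r0 = min 1 ((\<gamma> / (2 * A)) powr (1 / q1))"
  define R where "R = max 1 ((2 * B) powr (1 / (q - q2)))"
  have r0: "r0 > 0" "r0 \<le> 1" using par A by (auto simp: r0_def)
  have near: "(\<gamma> / 4) * (1 + cmod z powr q) \<le> cmod (CF z)" if z: "cmod z \<le> r0" for z
  proof -
    have z1: "cmod z \<le> 1" using z r0 by simp
    have "cmod z powr q1 \<le> ((\<gamma> / (2 * A)) powr (1 / q1)) powr q1"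
      using z par by (intro powr_mono2) (auto simp: r0_def)
    also have "\<dots> = \<gamma> / (2 * A)" using par A by (simp add: powr_powr)
    finally have "A * cmod z powr q1 \<le> \<gamma> / 2" using A by (simp add: field_simps)
    hence "cmod (CF z - of_real \<gamma>) \<le> \<gamma> / 2"
      using char_fun_near_0[OF par(2-4) z1, of \<alpha> \<beta> \<gamma>] by (simp add: A_def)
    hence "cmod (CF z) \<ge> \<gamma> / 2"
      using norm_triangle_ineq2[of "of_real \<gamma>" "of_real \<gamma> - CF z"] par by (simp add: norm_minus_commute)
    moreover have "cmod z powr q \<le> 1" using z1 par powr_mono2[of q "cmod z" 1] by simp
    hence "(\<gamma> / 4) * (1 + cmod z powr q) \<le> (\<gamma> / 4) * (1 + 1)" using par by (intro mult_left_mono) auto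
    ultimately show ?thesis by simp
  qed
  have far: "(1 / 4) * (1 + cmod z powr q) \<le> cmod (CF z)" if z: "cmod z \<ge> R" for z
  proof -
    have z1: "cmod z \<ge> 1" using z by (simp add: R_def)
    have "2 * B = ((2 * B) powr (1 / (q - q2))) powr (q - q2)" using par B by (simp add: powr_powr)
    also have "\<dots> \<le> cmod z powr (q - q2)" using z par by (intro powr_mono2) (auto simp: R_def)
    finally have "2 * B * cmod z powr q2 \<le> cmod z powr (q - q2) * cmod z powr q2" by (intro mult_right_mono) auto
    also have "\<dots> = cmod z powr q" by (simp add: powr_add[symmetric])
    finally have "B * cmod z powr q2 \<le> cmod z powr q / 2" by simp
    hence "cmod (CF z - z powr of_real q) \<le> cmod z powr q / 2"
      using char_fun_near_infinity[OF par(2-4) z1, of \<alpha> \<beta> \<gamma>] by (simp add: B_def)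
    hence "cmod (CF z) \<ge> cmod z powr q / 2"
      using norm_triangle_ineq2[of "z powr of_real q" "z powr of_real q - CF z"]
      by (simp add: norm_minus_commute norm_powr_real_powr')
    moreover have "cmod z powr q \<ge> 1" using z1 par ge_one_powr_ge_zero[of "cmod z" q] by simp
    ultimately show ?thesis by simp
  qed
  define K where "K = {z. Re z \<ge> 0} \<inter> (cball 0 R - ball 0 r0)"
  have K: "compact K" unfolding K_def
    by (intro closed_Int_compact closed_halfspace_Re_ge compact_diff compact_cball open_ball)
  have Kz: "Re z \<ge> 0" "z \<noteq> 0" if "z \<in> K" for z using that r0 by (auto simp: K_def)
  have c: "continuous_on K (\<lambda>z. cmod (CF z) / (1 + cmod z powr q))"
  proof (intro continuous_on_divide continuous_on_norm continuous_on_add continuous_on_const continuous_on_powr' continuous_on_id)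
    show "continuous_on K CF"
      by (intro continuous_at_imp_continuous_on ballI DERIV_isCont[OF char_fun_has_derivative] Kz)
  qed (use Kz par in \<open>auto simp: add_nonneg_eq_0_iff\<close>)
  obtain m0 where m0: "m0 > 0" "\<And>z. z \<in> K \<Longrightarrow> m0 \<le> cmod (CF z) / (1 + cmod z powr q)"
  proof (cases "K = {}")
    case True
    thus ?thesis using that[of 1] by simp
  next
    case False
    obtain z0 where z0: "z0 \<in> K" "\<And>z. z \<in> K \<Longrightarrow> cmod (CF z0) / (1 + cmod z0 powr q) \<le> cmod (CF z) / (1 + cmod z powr q)"
      using continuous_attains_inf[OF K False c] by blast
    show ?thesis
    proof (rule that)
      show "cmod (CF z0) / (1 + cmod z0 powr q) > 0"
        using nr[OF Kz[OF z0(1)]] by (intro divide_pos_pos) (auto simp: add_pos_nonneg)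
    qed (use z0 in blast)
  qed
  \<comment> \<open>The quarters absorb 1 + |z|^q, which is at most 2 near 0 and at most 2 |z|^q far
    out.\<close>
  define m where "m = min m0 (min (\<gamma> / 4) (1 / 4))"
  show ?thesis
  proof (rule that[of m])
    show "m > 0" using m0 par by (simp add: m_def)
    fix z assume z: "Re z \<ge> 0" "z \<noteq> 0"
    have p: "1 + cmod z powr q > 0" by (simp add: add_pos_nonneg)
    have "cmod z \<le> r0 \<or> cmod z \<ge> R \<or> z \<in> K" using z unfolding K_def by auto
    then consider "cmod z \<le> r0" | "cmod z \<ge> R" | "z \<in> K" by blast
    thus "m * (1 + cmod z powr q) \<le> cmod (CF z)"
    proof cases
      case 1
      have "m * (1 + cmod z powr q) \<le> (\<gamma> / 4) * (1 + cmod z powr q)" using p by (intro mult_right_mono) (auto simp: m_def)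
      thus ?thesis using near[OF 1] by linarith
    next
      case 2
      have "m * (1 + cmod z powr q) \<le> (1 / 4) * (1 + cmod z powr q)" using p by (intro mult_right_mono) (auto simp: m_def)
      thus ?thesis using far[OF 2] by linarith
    next
      case 3
      have "m * (1 + cmod z powr q) \<le> m0 * (1 + cmod z powr q)" using p by (intro mult_right_mono) (auto simp: m_def)
      thus ?thesis using m0(2)[OF 3] p by (simp add: field_simps)
    qed
  qed
qed

lemma char_fun_upper_bounds:
  obtains K where "K \<ge> 0" "\<And>z. z \<noteq> 0 \<Longrightarrow> cmod (CF z) \<le> K * (1 + cmod z powr q)"
    "\<And>z. z \<noteq> 0 \<Longrightarrow> cmod z * cmod (char_fun_deriv z) \<le> K * (1 + cmod z powr q)"
proof -
  \<comment> \<open>The factor 2 bounds the orders that differentiation brings down, as q \<le>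
    2.\<close>
  define K where "K = 2 * (1 + \<bar>\<alpha>\<bar> + \<bar>\<beta>\<bar>) + \<gamma>"
  have le: "cmod z powr e \<le> 1 + cmod z powr q" if "z \<noteq> 0" "0 \<le> e" "e \<le> q" for z e
    using that by (intro powr_le_1_plus) auto
  show ?thesis
  proof (rule that[of K])
    show "K \<ge> 0" using par by (simp add: K_def)
    fix z :: complex assume z: "z \<noteq> 0"
    define X where "X = 1 + cmod z powr q"
    have X: "X \<ge> 1" by (simp add: X_def)
    note leX = le[OF z, folded X_def]
    have "cmod (CF z) \<le> cmod z powr q + \<bar>\<alpha>\<bar> * cmod z powr q1 + \<bar>\<beta>\<bar> * cmod z powr q2 + \<gamma>"
      using norm_add3_le[of "z powr of_real q" "of_real \<alpha> * z powr of_real q1" "of_real \<beta> * z powr of_real q2"]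
        norm_triangle_ineq[of "z powr of_real q + of_real \<alpha> * z powr of_real q1 + of_real \<beta> * z powr of_real q2" "of_real \<gamma>"] par
      by (simp add: char_fun_def norm_mult norm_powr_real_powr')
    also have "\<dots> \<le> 1 * X + \<bar>\<alpha>\<bar> * X + \<bar>\<beta>\<bar> * X + \<gamma> * X"
      using leX[of q] leX[of q1] leX[of q2] par X by (intro add_mono mult_left_mono) (auto simp: mult_le_cancel_left1)
    also have "\<dots> \<le> K * X" unfolding K_def using X by (simp add: algebra_simps add_nonneg_nonneg)
    finally show "cmod (CF z) \<le> K * (1 + cmod z powr q)" by (simp only: X_def)
    have zp: "cmod z * cmod (of_real r * z powr (of_real r - 1)) \<le> 2 * X" if "0 < r" "r \<le> q" for r
    proof -
      have "cmod z * cmod (z powr (of_real r - 1)) = cmod (z powr of_real r)"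
        using z by (simp add: powr_diff norm_divide)
      also have "\<dots> = cmod z powr r" by (simp add: norm_powr_real_powr')
      finally have "cmod z * cmod (of_real r * z powr (of_real r - 1)) = r * cmod z powr r"
        using that by (simp add: norm_mult mult.left_commute)
      also have "\<dots> \<le> 2 * X" using that par leX[of r] by (intro mult_mono) auto
      finally show ?thesis .
    qed
    have "cmod z * cmod (char_fun_deriv z) \<le> cmod z * (cmod (of_real q * z powr (of_real q - 1)) + cmod (of_real \<alpha> * (of_real q1 * z powr (of_real q1 - 1))) + cmod (of_real \<beta> * (of_real q2 * z powr (of_real q2 - 1))))"
      unfolding char_fun_deriv_def by (intro mult_left_mono norm_add3_le) auto
    also have "\<dots> = cmod z * cmod (of_real q * z powr (of_real q - 1)) + \<bar>\<alpha>\<bar> * (cmod z * cmod (of_real q1 * z powr (of_real q1 - 1))) + \<bar>\<beta>\<bar> * (cmod z * cmod (of_real q2 * z powr (of_real q2 - 1)))"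
      by (simp only: norm_mult[of "of_real \<alpha>"] norm_mult[of "of_real \<beta>"] norm_of_real distrib_left mult.left_commute)
    also have "\<dots> \<le> 2 * X + \<bar>\<alpha>\<bar> * (2 * X) + \<bar>\<beta>\<bar> * (2 * X)"
      using par by (intro add_mono mult_left_mono zp) auto
    also have "\<dots> \<le> K * X" unfolding K_def using X par by (simp add: algebra_simps)
    finally show "cmod z * cmod (char_fun_deriv z) \<le> K * (1 + cmod z powr q)" by (simp only: X_def)
  qed
qed

lemma char_fun_quotient_symbol:
  assumes "p \<ge> a - 1" "p - q \<le> - 1 - \<eta>" "a - 1 \<ge> - 1 - \<eta>"
  shows "symbol_class a \<eta> (\<lambda>z. z powr of_real p / CF z)"
proof -
  obtain m where m: "m > 0" "\<And>z. Re z \<ge> 0 \<Longrightarrow> z \<noteq> 0 \<Longrightarrow> m * (1 + cmod z powr q) \<le> cmod (CF z)"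
    by (rule char_fun_lower_bound) blast
  obtain K where K: "K \<ge> 0" "\<And>z. z \<noteq> 0 \<Longrightarrow> cmod z * cmod (char_fun_deriv z) \<le> K * (1 + cmod z powr q)"
    by (rule char_fun_upper_bounds) blast
  show ?thesis
    by (rule symbol_class_powr_quotient[OF m(1) K(1) char_fun_has_derivative m(2) K(2) assms])
qed

text \<open>The factor z + 1 has no zero in the closed right half-plane and raises the order of the
  denominator to q + 1; without it the exponent q - 1 would leave the borderline decay 1 /
  |z|.\<close>

lemma char_fun_shifted_quotient_symbol:
  assumes "p \<ge> a - 1" "p - (q + 1) \<le> - 1 - \<eta>" "a - 1 \<ge> - 1 - \<eta>"
  shows "symbol_class a \<eta> (\<lambda>z. z powr of_real p / ((z + 1) * CF z))"
proof -
  obtain m where m: "m > 0" "\<And>z. Re z \<ge> 0 \<Longrightarrow> z \<noteq> 0 \<Longrightarrow> m * (1 + cmod z powr q) \<le> cmod (CF z)"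
    by (rule char_fun_lower_bound) blast
  obtain K where K: "K \<ge> 0" "\<And>z. z \<noteq> 0 \<Longrightarrow> cmod (CF z) \<le> K * (1 + cmod z powr q)"
     "\<And>z. z \<noteq> 0 \<Longrightarrow> cmod z * cmod (char_fun_deriv z) \<le> K * (1 + cmod z powr q)"
    by (rule char_fun_upper_bounds) blast
  have pw: "cmod z * cmod z powr q = cmod z powr (q + 1)" for z
    by (cases "z = 0") (simp_all add: powr_add)
  show ?thesis
  proof (rule symbol_class_powr_quotient[where D' = "\<lambda>z. CF z + char_fun_deriv z * (z + 1)" and m = m and K = "5 * K" and d = "q + 1", OF _ _ _ _ _ assms])
    fix z :: complex assume z: "Re z \<ge> 0" "z \<noteq> 0"
    have "((\<lambda>z. z + 1) has_field_derivative 1) (at z)" by (auto intro!: derivative_eq_intros)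
    from DERIV_mult[OF this char_fun_has_derivative[OF z]]
    show "((\<lambda>z. (z + 1) * CF z) has_field_derivative CF z + char_fun_deriv z * (z + 1)) (at z)" by simp
    \<comment> \<open>In the right half-plane |z + 1| dominates both 1 and |z|.\<close>
    have z1: "cmod (z + 1) \<ge> 1" using z abs_Re_le_cmod[of "z + 1"] by simp
    have z2: "cmod (z + 1) \<ge> cmod z"
      unfolding cmod_def using z by (intro real_sqrt_le_mono) (auto intro!: power_mono)
    have "1 + cmod z powr (q + 1) = 1 * 1 + cmod z * cmod z powr q" by (simp add: pw)
    also have "\<dots> \<le> cmod (z + 1) * 1 + cmod (z + 1) * cmod z powr q"
      using z1 z2 by (intro add_mono mult_right_mono) auto
    finally have "m * (1 + cmod z powr (q + 1)) \<le> m * (cmod (z + 1) * 1 + cmod (z + 1) * cmod z powr q)"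
      using m(1) by (intro mult_left_mono) auto
    also have "\<dots> = cmod (z + 1) * (m * (1 + cmod z powr q))" by (simp add: algebra_simps)
    also have "\<dots> \<le> cmod (z + 1) * cmod (CF z)" by (intro mult_left_mono m(2) z) auto
    finally show "m * (1 + cmod z powr (q + 1)) \<le> cmod ((z + 1) * CF z)" by (simp add: norm_mult)
    have l1: "cmod z \<le> 1 + cmod z powr (q + 1)" using powr_le_1_plus[of "cmod z" 1 "q + 1"] z par by simp
    have l2: "cmod z powr q \<le> 1 + cmod z powr (q + 1)" using powr_le_1_plus[of "cmod z" q "q + 1"] z par by simp
    have a1: "cmod z * (1 + cmod z powr q) \<le> 2 * (1 + cmod z powr (q + 1))"
      using l1 by (simp add: distrib_left pw)
    have "cmod (z + 1) * (1 + cmod z powr q) \<le> (cmod z + 1) * (1 + cmod z powr q)"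
      using norm_triangle_ineq[of z 1] by (intro mult_right_mono) (auto simp: add_nonneg_nonneg)
    also have "\<dots> \<le> 3 * (1 + cmod z powr (q + 1))" using l1 l2 by (simp add: distrib_left distrib_right pw)
    finally have a2: "cmod (z + 1) * (1 + cmod z powr q) \<le> 3 * (1 + cmod z powr (q + 1))" .
    have "cmod z * cmod (CF z + char_fun_deriv z * (z + 1)) \<le> cmod z * (cmod (CF z) + cmod (char_fun_deriv z) * cmod (z + 1))"
      using norm_triangle_ineq[of "CF z" "char_fun_deriv z * (z + 1)"] by (intro mult_left_mono) (auto simp: norm_mult)
    also have "\<dots> = cmod z * cmod (CF z) + cmod (z + 1) * (cmod z * cmod (char_fun_deriv z))" by (simp add: algebra_simps)
    also have "\<dots> \<le> cmod z * (K * (1 + cmod z powr q)) + cmod (z + 1) * (K * (1 + cmod z powr q))"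
      by (intro add_mono mult_left_mono K z) auto
    also have "\<dots> = K * (cmod z * (1 + cmod z powr q)) + K * (cmod (z + 1) * (1 + cmod z powr q))" by (simp only: mult.left_commute)
    also have "\<dots> \<le> K * (2 * (1 + cmod z powr (q + 1))) + K * (3 * (1 + cmod z powr (q + 1)))"
      using K(1) a1 a2 by (intro add_mono mult_left_mono) auto
    also have "\<dots> = 5 * K * (1 + cmod z powr (q + 1))" by (simp add: algebra_simps)
    finally show "cmod z * cmod (CF z + char_fun_deriv z * (z + 1)) \<le> 5 * K * (1 + cmod z powr (q + 1))" .
  qed (use m K in auto)
qed

text \<open>With Q the weighted sum of the powers r - 1, this is Q / \<Delta> - 1 / (z + 1) over a
  common denominator: the numerator Q (z + 1) - \<Delta> collapses to Q - \<gamma>, because z Q =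
  \<Delta> - \<gamma>. The constant is written as a power of exponent 0 to fit the general
  quotient.\<close>

definition position_symbol :: "complex \<Rightarrow> complex" where
  "position_symbol z = z powr of_real (q - 1) / ((z + 1) * CF z) + of_real \<alpha> * (z powr of_real (q1 - 1) / ((z + 1) * CF z))
     + of_real \<beta> * (z powr of_real (q2 - 1) / ((z + 1) * CF z)) + of_real (- \<gamma>) * (z powr of_real 0 / ((z + 1) * CF z))"

definition slope_symbol :: "complex \<Rightarrow> complex" where
  "slope_symbol z = (if q > 1 then z powr of_real (q - 2) / CF z else 0) + of_real \<alpha> * (if q1 > 1 then z powr of_real (q1 - 2) / CF z else 0)
     + of_real \<beta> * (if q2 > 1 then z powr of_real (q2 - 2) / CF z else 0)"

text \<open>Near 0 the exponents r - 1 ask for a \<le> r. At infinity the exponent q - 1 leaves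
  order -2 and the constant leaves -1 - q, hence \<eta> = min 1 q.\<close>

lemma position_symbol_class:
  assumes "\<And>r. r \<in> {q1, q2, q} \<Longrightarrow> a \<le> r" "0 < a" "a < 1"
  shows "symbol_class a (min 1 q) position_symbol"
  unfolding position_symbol_def[abs_def] using assms par
  by (intro symbol_class_add symbol_class_cmult char_fun_shifted_quotient_symbol) (auto simp: min_def)

text \<open>The exponents r - 2 ask for a \<le> r - 1 near 0, and at infinity they leave order at
  most -2.\<close>

lemma slope_symbol_class:
  assumes "\<And>r. r \<in> {q1, q2, q} \<Longrightarrow> r > 1 \<Longrightarrow> a \<le> r - 1" "0 < a" "a < 1"
  shows "symbol_class a (min 1 q) slope_symbol"
proof -
  have "symbol_class a (min 1 q) (\<lambda>z. if r > 1 then z powr of_real (r - 2) / CF z else 0)" if "r \<in> {q1, q2, q}" for r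
  proof (cases "r > 1")
    case True
    moreover have "symbol_class a (min 1 q) (\<lambda>z. z powr of_real (r - 2) / CF z)"
      using True assms(1)[OF that True] assms(2,3) par that by (intro char_fun_quotient_symbol) (auto simp: min_def)
    ultimately show ?thesis by simp
  qed (simp add: symbol_class_0)
  from this[of q] this[of q1] this[of q2] show ?thesis
    unfolding slope_symbol_def[abs_def] by (intro symbol_class_add symbol_class_cmult) auto
qed

lemma symbols_of_real:
  assumes s: "s > 0"
  defines "d \<equiv> s powr q + \<alpha> * s powr q1 + \<beta> * s powr q2 + \<gamma>"
  shows "d \<noteq> 0"
    and "Re (position_symbol (of_real s)) = (s powr (q - 1) + \<alpha> * s powr (q1 - 1) + \<beta> * s powr (q2 - 1)) / d - 1 / (s + 1)"
    and "Re (slope_symbol (of_real s)) = (slope_order q s + \<alpha> * slope_order q1 s + \<beta> * slope_order q2 s) / d"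
proof -
  have D: "CF (of_real s) = of_real d" using s by (simp add: char_fun_def powr_of_real d_def)
  have "CF (of_real s) \<noteq> 0" using s by (intro nr) auto
  thus d0: "d \<noteq> 0" unfolding D by simp
  define Q where "Q = s powr (q - 1) + \<alpha> * s powr (q1 - 1) + \<beta> * s powr (q2 - 1)"
  have p: "s powr (e - 1) * s = s powr e" for e using s powr_add[of s "e - 1" 1] by simp
  have "Q * s = s powr (q - 1) * s + \<alpha> * (s powr (q1 - 1) * s) + \<beta> * (s powr (q2 - 1) * s)" by (simp add: Q_def algebra_simps)
  hence Qs: "Q * s = d - \<gamma>" unfolding p by (simp add: d_def)
  have "position_symbol (of_real s) = of_real ((Q - \<gamma>) / ((s + 1) * d))"
  proof -
    have "position_symbol (of_real s) = of_real (s powr (q - 1) / ((s + 1) * d) + \<alpha> * (s powr (q1 - 1) / ((s + 1) * d)) + \<beta> * (s powr (q2 - 1) / ((s + 1) * d)) + (- \<gamma>) * (1 / ((s + 1) * d)))"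
      unfolding position_symbol_def D using s
      by (simp only: powr_of_real less_imp_le powr_zero_eq_one of_real_add of_real_mult of_real_divide of_real_minus of_real_1 of_real_0) simp
    also have "s powr (q - 1) / ((s + 1) * d) + \<alpha> * (s powr (q1 - 1) / ((s + 1) * d)) + \<beta> * (s powr (q2 - 1) / ((s + 1) * d)) + (- \<gamma>) * (1 / ((s + 1) * d)) = (Q - \<gamma>) / ((s + 1) * d)"
      by (simp add: Q_def add_divide_distrib diff_divide_distrib)
    finally show ?thesis .
  qed
  moreover have "(Q - \<gamma>) / ((s + 1) * d) = Q / d - 1 / (s + 1)"
  proof -
    have "Q - \<gamma> = Q * (s + 1) - d" using Qs by (simp add: algebra_simps)
    thus ?thesis using d0 s by (simp add: field_simps)
  qed
  ultimately show "Re (position_symbol (of_real s)) = Q / d - 1 / (s + 1)" by simp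
  have "slope_symbol (of_real s) = of_real ((slope_order q s + \<alpha> * slope_order q1 s + \<beta> * slope_order q2 s) / d)"
  proof -
    have pw: "complex_of_real s powr of_real e = of_real (s powr e)" for e using s by (simp add: powr_of_real)
    show ?thesis unfolding slope_symbol_def D slope_order_def pw by (simp add: add_divide_distrib)
  qed
  thus "Re (slope_symbol (of_real s)) = (slope_order q s + \<alpha> * slope_order q1 s + \<beta> * slope_order q2 s) / d" by simp
qed

text \<open>Every solution is x(0) exp(-t) + x(0) w0(t) + x'(0) w1(t) with fixed functions w0 and
  w1, the last term being absent for q \<le> 1. So one B serves all solutions, which gives
  stability, and the decay of w0 and w1 gives the rate.\<close>

lemma solution_decay:
  assumes a: "0 < a" "a < 1" and a1: "\<And>r. r \<in> {q1, q2, q} \<Longrightarrow> a \<le> r"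
    and a2: "\<And>r. r \<in> {q1, q2, q} \<Longrightarrow> r > 1 \<Longrightarrow> a \<le> r - 1"
  shows "\<exists>B\<ge>0. \<forall>x. is_solution \<alpha> \<beta> \<gamma> q1 q2 q x \<longrightarrow>
     (\<forall>t\<ge>0. \<bar>x t\<bar> \<le> B * initial_norm q x) \<and> (\<forall>t\<ge>1. \<bar>x t\<bar> \<le> B * initial_norm q x * t powr (- a))"
proof -
  have eta: "min 1 q > 0" using par by simp
  obtain w0 B0 where w0: "B0 \<ge> 0" "\<And>t. \<bar>w0 t\<bar> \<le> B0" "\<And>t. t > 0 \<Longrightarrow> \<bar>w0 t\<bar> \<le> B0 * t powr (- a)"
    "continuous_on {0..} w0" "\<And>s. s > 0 \<Longrightarrow> laplace w0 s = Re (position_symbol (of_real s))"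
    by (rule symbol_class_inverse[OF a eta position_symbol_class[OF a1 a]]) blast+
  obtain w1 B1 where w1: "B1 \<ge> 0" "\<And>t. \<bar>w1 t\<bar> \<le> B1" "\<And>t. t > 0 \<Longrightarrow> \<bar>w1 t\<bar> \<le> B1 * t powr (- a)"
    "continuous_on {0..} w1" "\<And>s. s > 0 \<Longrightarrow> laplace w1 s = Re (slope_symbol (of_real s))"
    by (rule symbol_class_inverse[OF a eta slope_symbol_class[OF a2 a]]) blast+
  \<comment> \<open>For q \<le> 1 the slope is not part of the initial data, and
    \<open>initial_norm\<close> does not control it.\<close>
  define x1 where "x1 = (\<lambda>x. if q > 1 then hderiv 1 x 0 else 0)"
  have rep: "x t = x 0 * exp (- t) + x 0 * w0 t + x1 x * w1 t" if sol: "is_solution \<alpha> \<beta> \<gamma> q1 q2 q x" and t: "t \<ge> 0" for x t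
  proof -
    obtain C \<sigma> where C: "\<sigma> \<ge> 3" "C \<ge> 0" "\<And>t. t \<ge> 0 \<Longrightarrow> \<bar>x t\<bar> \<le> C * exp (\<sigma> * t)"
      and L: "\<And>s. s > \<sigma> \<Longrightarrow> laplace x s * (s powr q + \<alpha> * s powr q1 + \<beta> * s powr q2 + \<gamma>) =
       x 0 * (s powr (q - 1) + \<alpha> * s powr (q1 - 1) + \<beta> * s powr (q2 - 1)) +
       hderiv 1 x 0 * (slope_order q s + \<alpha> * slope_order q1 s + \<beta> * slope_order q2 s)"
      by (rule solution_laplace[OF par(2-5) sol]) blast
    have xc: "continuous_on {0..} x"
      using regular_continuous[of q x] sol par by (simp add: is_solution_iff)
    \<comment> \<open>The representation is verified through its transform: the error grows at most
      exponentially, and its transform vanishes for s > \<sigma>.\<close>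
    define D where "D = (\<lambda>t. x t - x 0 * exp (- t) - x 0 * w0 t - x1 x * w1 t)"
    have Dc: "continuous_on {0..} D" unfolding D_def by (intro continuous_intros xc w0 w1)
    have e1: "1 \<le> exp (\<sigma> * t)" if "t \<ge> 0" for t using C that by simp
    have Db: "\<bar>D t\<bar> \<le> (C + \<bar>x 0\<bar> + \<bar>x 0\<bar> * B0 + \<bar>x1 x\<bar> * B1) * exp (\<sigma> * t)" if t: "t \<ge> 0" for t
    proof -
      have "\<bar>D t\<bar> \<le> \<bar>x t\<bar> + \<bar>x 0\<bar> * exp (- t) + \<bar>x 0\<bar> * \<bar>w0 t\<bar> + \<bar>x1 x\<bar> * \<bar>w1 t\<bar>"
      proof -
        have "\<bar>x 0 * exp (- t)\<bar> = \<bar>x 0\<bar> * exp (- t)" by (simp add: abs_mult)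
        thus ?thesis unfolding D_def abs_mult[symmetric, of "x 0" "w0 t"] abs_mult[symmetric, of "x1 x" "w1 t"] by linarith
      qed
      also have "\<dots> \<le> C * exp (\<sigma> * t) + \<bar>x 0\<bar> * exp (\<sigma> * t) + \<bar>x 0\<bar> * (B0 * exp (\<sigma> * t)) + \<bar>x1 x\<bar> * (B1 * exp (\<sigma> * t))"
      proof (intro add_mono mult_left_mono C(3) t)
        have "exp (- t) \<le> 1" using t by simp
        thus "exp (- t) \<le> exp (\<sigma> * t)" using e1[OF t] by linarith
        show "\<bar>w0 t\<bar> \<le> B0 * exp (\<sigma> * t)" using w0(2)[of t] mult_left_mono[OF e1[OF t] w0(1)] by simp
        show "\<bar>w1 t\<bar> \<le> B1 * exp (\<sigma> * t)" using w1(2)[of t] mult_left_mono[OF e1[OF t] w1(1)] by simp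
      qed auto
      finally show ?thesis by (simp add: algebra_simps)
    qed
    have "D t = 0"
    proof (rule laplace_unique[OF Dc Db _ t])
      fix s assume s: "s > \<sigma>"
      hence s0: "s > 0" using C by simp
      let ?L = "\<lambda>f t. indicator {0<..} t * f t * exp (- s * t)"
      have ix: "integrable lborel (?L x)" by (rule laplace_integrable[OF xc C(3) s])
      have ie: "integrable lborel (?L (\<lambda>t. exp (- t)))" "laplace (\<lambda>t. exp (- t)) s = 1 / (s + 1)"
      proof -
        have e: "?L (\<lambda>t. exp (- t)) = (\<lambda>t. frac_kernel 1 t * exp (- (s + 1) * t))"
          by (simp add: fun_eq_iff frac_kernel_1 exp_add[symmetric] algebra_simps)
        have k: "has_bochner_integral lborel (?L (\<lambda>t. exp (- t))) ((s + 1) powr - 1)"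
          unfolding e using s0 by (intro frac_kernel_laplace) auto
        show "integrable lborel (?L (\<lambda>t. exp (- t)))" using k by (simp only: has_bochner_integral_iff)
        show "laplace (\<lambda>t. exp (- t)) s = 1 / (s + 1)"
          using has_bochner_integral_integral_eq[OF k] s0 by (simp add: laplace_def powr_minus_divide)
      qed
      have i0: "integrable lborel (?L w0)"
        by (rule laplace_integrable[OF w0(4), of B0 0]) (use w0 s0 in auto)
      have i1: "integrable lborel (?L w1)"
        by (rule laplace_integrable[OF w1(4), of B1 0]) (use w1 s0 in auto)
      have "laplace D s = (LINT t|lborel. ?L x t - x 0 * ?L (\<lambda>t. exp (- t)) t - x 0 * ?L w0 t - x1 x * ?L w1 t)"
        unfolding laplace_def D_def by (intro Bochner_Integration.integral_cong) (auto simp: algebra_simps)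
      also have "\<dots> = laplace x s - x 0 * laplace (\<lambda>t. exp (- t)) s - x 0 * laplace w0 s - x1 x * laplace w1 s"
        using ix ie(1) i0 i1 unfolding laplace_def by simp
      finally have LD: "laplace D s = laplace x s - x 0 * (1 / (s + 1)) - x 0 * Re (position_symbol (of_real s)) - x1 x * Re (slope_symbol (of_real s))"
        using ie(2) w0(5)[OF s0] w1(5)[OF s0] by simp
      define d where "d = s powr q + \<alpha> * s powr q1 + \<beta> * s powr q2 + \<gamma>"
      define Q where "Q = s powr (q - 1) + \<alpha> * s powr (q1 - 1) + \<beta> * s powr (q2 - 1)"
      define P where "P = slope_order q s + \<alpha> * slope_order q1 s + \<beta> * slope_order q2 s"
      have "hderiv 1 x 0 * P = x1 x * P" using par by (auto simp: x1_def P_def slope_order_def)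
      hence "laplace x s * d = x 0 * Q + x1 x * P" using L[OF s] by (simp add: d_def Q_def P_def)
      hence "laplace x s = x 0 * (Q / d) + x1 x * (P / d)"
        using symbols_of_real(1)[OF s0, folded d_def] by (simp add: field_simps)
      thus "laplace D s = 0" unfolding LD symbols_of_real(2,3)[OF s0, folded d_def Q_def P_def]
        by (simp add: algebra_simps)
    qed
    thus ?thesis by (simp add: D_def)
  qed
  have n0: "\<bar>x 0\<bar> \<le> initial_norm q x" for x using norm_fst_le[of "(x 0, hderiv 1 x 0)"] by (simp add: initial_norm_def norm_Pair)
  have n1: "\<bar>x1 x\<bar> \<le> initial_norm q x" for x
    by (auto simp: initial_norm_def x1_def norm_Pair real_le_rsqrt)
  show ?thesis
  proof (intro exI[of _ "1 + B0 + B1"] conjI allI impI)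
    show "1 + B0 + B1 \<ge> 0" using w0 w1 by simp
    fix x assume sol: "is_solution \<alpha> \<beta> \<gamma> q1 q2 q x"
    have gen: "\<bar>x t\<bar> \<le> (1 + B0 + B1) * initial_norm q x * c"
      if t: "t \<ge> 0" and c: "exp (- t) \<le> c" "\<bar>w0 t\<bar> \<le> B0 * c" "\<bar>w1 t\<bar> \<le> B1 * c" for c t
    proof -
      have ex: "\<bar>x 0 * exp (- t)\<bar> = \<bar>x 0\<bar> * exp (- t)" by (simp add: abs_mult)
      have "\<bar>x t\<bar> \<le> \<bar>x 0\<bar> * exp (- t) + \<bar>x 0\<bar> * \<bar>w0 t\<bar> + \<bar>x1 x\<bar> * \<bar>w1 t\<bar>"
        unfolding rep[OF sol t] ex[symmetric] abs_mult[symmetric, of "x 0" "w0 t"] abs_mult[symmetric, of "x1 x" "w1 t"] by linarith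
      also have "\<dots> \<le> initial_norm q x * c + initial_norm q x * (B0 * c) + initial_norm q x * (B1 * c)"
        using c n0[of x] n1[of x] by (intro add_mono mult_mono) (auto intro: order.trans[OF abs_ge_zero])
      finally show ?thesis by (simp add: algebra_simps)
    qed
    show "\<bar>x t\<bar> \<le> (1 + B0 + B1) * initial_norm q x" if "t \<ge> 0" for t
      using gen[OF that, of 1] that w0(2)[of t] w1(2)[of t] by simp
    show "\<bar>x t\<bar> \<le> (1 + B0 + B1) * initial_norm q x * t powr (- a)" if t: "t \<ge> 1" for t
    proof -
      \<comment> \<open>Because a < 1, already exp(-t) \<le> 1 / t is within the rate.\<close>
      have "t \<le> exp t" using exp_ge_add_one_self[of t] by linarith
      hence "exp (- t) \<le> 1 / t" using t by (simp add: exp_minus field_simps)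
      also have "1 / t = t powr (- 1)" using t by (simp add: powr_minus_divide)
      also have "\<dots> \<le> t powr (- a)" using t a by (intro powr_mono) auto
      finally show ?thesis using t w0(3)[of t] w1(3)[of t] by (intro gen) auto
    qed
  qed
qed

lemma asymptotically_stable:
  assumes a: "0 < a" "a < 1" and a1: "\<And>r. r \<in> {q1, q2, q} \<Longrightarrow> a \<le> r"
    and a2: "\<And>r. r \<in> {q1, q2, q} \<Longrightarrow> r > 1 \<Longrightarrow> a \<le> r - 1"
  shows "O_asymptotically_stable a \<alpha> \<beta> \<gamma> q1 q2 q"
proof -
  obtain B where B: "B \<ge> 0" "\<And>x t. is_solution \<alpha> \<beta> \<gamma> q1 q2 q x \<Longrightarrow> t \<ge> 0 \<Longrightarrow> \<bar>x t\<bar> \<le> B * initial_norm q x"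
    "\<And>x t. is_solution \<alpha> \<beta> \<gamma> q1 q2 q x \<Longrightarrow> t \<ge> 1 \<Longrightarrow> \<bar>x t\<bar> \<le> B * initial_norm q x * t powr (- a)"
    using solution_decay[OF assms] by auto
  have "stable \<alpha> \<beta> \<gamma> q1 q2 q"
    unfolding stable_def
  proof (intro allI impI)
    fix e :: real assume e: "e > 0"
    show "\<exists>\<delta>>0. \<forall>x. is_solution \<alpha> \<beta> \<gamma> q1 q2 q x \<and> initial_norm q x < \<delta> \<longrightarrow> (\<forall>t\<ge>0. \<bar>x t\<bar> \<le> e)"
    \<comment> \<open>The 1 avoids a division by 0 when B = 0.\<close>
    proof (intro exI[of _ "e / (B + 1)"] conjI allI impI)
      show "e / (B + 1) > 0" using e B by simp
      fix x t assume x: "is_solution \<alpha> \<beta> \<gamma> q1 q2 q x \<and> initial_norm q x < e / (B + 1)" and t: "(t::real) \<ge> 0"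
      have "\<bar>x t\<bar> \<le> B * initial_norm q x" using B(2) x t by blast
      also have "\<dots> \<le> B * (e / (B + 1))" using B x by (intro mult_left_mono) auto
      also have "\<dots> \<le> e" using B e by (simp add: field_simps)
      finally show "\<bar>x t\<bar> \<le> e" .
    qed
  qed
  moreover have "x \<in> O[at_top](\<lambda>t. t powr (- a))" if "is_solution \<alpha> \<beta> \<gamma> q1 q2 q x" for x
  proof (rule bigoI[of _ "B * initial_norm q x"])
    show "\<forall>\<^sub>F t in at_top. norm (x t) \<le> B * initial_norm q x * norm (t powr (- a))"
      using eventually_ge_at_top[of "1::real"] by eventually_elim (use B(3)[OF that] in simp)
  qed
  ultimately show ?thesis unfolding O_asymptotically_stable_def by (auto intro!: exI[of _ 1])
qed

end

theorem theorem3p1: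
  fixes \<alpha> \<beta> \<gamma> q1 q2 q :: real
  assumes "\<gamma> > 0" and "0 < q1" and "q1 < q2" and "q2 < q" and "q \<le> 2"
  shows "((\<exists>s. Re s = 0 \<and> s \<noteq> cnj s \<and>
               char_fun \<alpha> \<beta> \<gamma> q1 q2 q s = 0 \<and> char_fun \<alpha> \<beta> \<gamma> q1 q2 q (cnj s) = 0)
            \<longleftrightarrow> (\<alpha>, \<beta>) \<in> Gamma_curve \<gamma> q1 q2 q) \<and>
         (O_asymptotically_stable (Min (frac ` ({q1, q2, q} - \<int>))) \<alpha> \<beta> \<gamma> q1 q2 q
            \<longleftrightarrow> \<beta> > phi \<gamma> q1 q2 q \<alpha>) \<and>
         (\<beta> < phi \<gamma> q1 q2 q \<alpha> \<longrightarrow> unstable \<alpha> \<beta> \<gamma> q1 q2 q)"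
proof -
  define a where "a = Min (frac ` ({q1, q2, q} - \<int>))"
  define N where "N = {q1, q2, q} - \<int>"
  have fin: "finite (frac ` N)" by (simp add: N_def)
  \<comment> \<open>Integer orders lie in (0, 2] and do not restrict the rate: r = 1 asks for a
    \<le> 1, and r = 2 for a \<le> 2 and a \<le> 1.\<close>
  have int: "r = 1 \<or> r = 2" if "r \<in> {q1, q2, q}" "r \<notin> N" for r
  proof -
    have "r \<in> \<int>" using that by (simp add: N_def)
    then obtain k where k: "r = of_int k" by (elim Ints_cases)
    moreover have "0 < r" "r \<le> 2" using that assms by auto
    ultimately have "0 < k" "k \<le> 2" by auto
    hence "k = 1 \<or> k = 2" by auto
    thus ?thesis using k by auto
  qed
  \<comment> \<open>The minimum is taken over a nonempty set: integers q1 < q2 would have to be 1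
    and 2, which leaves no room for q.\<close>
  have "N \<noteq> {}"
  proof
    assume "N = {}"
    hence "q1 = 1 \<or> q1 = 2" "q2 = 1 \<or> q2 = 2" using int[of q1] int[of q2] by auto
    thus False using assms by auto
  qed
  hence "a \<in> frac ` N" unfolding a_def N_def[symmetric] using fin by (intro Min_in) auto
  then obtain r0 where r0: "r0 \<in> N" "a = frac r0" by auto
  have a: "0 < a" "a < 1" using r0 frac_lt_1[of r0] frac_ge_0[of r0] frac_eq_0_iff[of r0] by (auto simp: N_def less_le)
  have ale: "a \<le> frac r" if "r \<in> N" for r unfolding a_def N_def[symmetric] using fin that by (intro Min_le) auto
  have a1: "a \<le> r" if r: "r \<in> {q1, q2, q}" for r
  proof (cases "r \<in> N")
    case True
    have "frac r \<le> r" using r assms by (auto simp: frac_def)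
    thus ?thesis using ale[OF True] by linarith
  next
    case False
    thus ?thesis using int[OF r False] a by auto
  qed
  \<comment> \<open>A non-integer r > 1 has floor at least 1, so its fractional part is at most r -
    1.\<close>
  have a2: "a \<le> r - 1" if r: "r \<in> {q1, q2, q}" "r > 1" for r
  proof (cases "r \<in> N")
    case True
    have "frac r \<le> r - 1" using r assms by (simp add: frac_def le_floor_iff)
    thus ?thesis using ale[OF True] by linarith
  next
    case False
    thus ?thesis using int[OF r(1) False] r a by auto
  qed
  have "unstable \<alpha> \<beta> \<gamma> q1 q2 q" if "\<beta> < phi \<gamma> q1 q2 q \<alpha>"
    using not_stable_if_rhp_root[OF assms rhp_root_below[OF assms that]] .
  \<comment> \<open>On the curve the imaginary root excludes decay; instability is claimed only
    below it.\<close>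
  moreover have "\<not> O_asymptotically_stable a \<alpha> \<beta> \<gamma> q1 q2 q" if "\<beta> = phi \<gamma> q1 q2 q \<alpha>"
  proof -
    have "(\<alpha>, \<beta>) \<in> Gamma_curve \<gamma> q1 q2 q" using curve_iff_phi[OF assms] that by simp
    then obtain v where "v > 0" "char_fun \<alpha> \<beta> \<gamma> q1 q2 q (\<i> * of_real v) = 0"
      using imaginary_root_iff_curve[OF assms] by blast
    thus ?thesis by (intro not_asymptotically_stable_if_imaginary_root[OF assms _ _ a(1)])
  qed
  moreover have "O_asymptotically_stable a \<alpha> \<beta> \<gamma> q1 q2 q" if above: "\<beta> > phi \<gamma> q1 q2 q \<alpha>"
  proof (rule asymptotically_stable[OF assms _ a a1 a2])
    fix z assume z: "Re z \<ge> 0" "z \<noteq> 0"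
    show "char_fun \<alpha> \<beta> \<gamma> q1 q2 q z \<noteq> 0"
    proof
      assume zero: "char_fun \<alpha> \<beta> \<gamma> q1 q2 q z = 0"
      show False
      proof (cases "Re z = 0")
        case True
        hence "(\<alpha>, \<beta>) \<in> Gamma_curve \<gamma> q1 q2 q" using nonzero_imaginary_root_on_curve[OF assms True z(2) zero] by simp
        thus False using curve_iff_phi[OF assms] above by simp
      next
        case False
        hence "rhp_root \<gamma> q1 q2 q \<alpha> \<beta>" using z zero unfolding rhp_root_def[OF assms] by (intro exI[of _ z]) auto
        thus False using no_rhp_root_above[OF assms above] by simp
      qed
    qed
  qed
  ultimately have "O_asymptotically_stable a \<alpha> \<beta> \<gamma> q1 q2 q \<longleftrightarrow> \<beta> > phi \<gamma> q1 q2 q \<alpha>"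
    unfolding O_asymptotically_stable_def by (meson linorder_cases)
  moreover have "\<beta> < phi \<gamma> q1 q2 q \<alpha> \<longrightarrow> unstable \<alpha> \<beta> \<gamma> q1 q2 q"
    using \<open>\<beta> < phi \<gamma> q1 q2 q \<alpha> \<Longrightarrow> unstable \<alpha> \<beta> \<gamma> q1 q2 q\<close> by blast
  ultimately show ?thesis unfolding a_def using root_pair_iff_curve[OF assms] by blast
qed

end
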